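(* Assume Conditions (B1)–(B3) hold, and $\kappa_l=\min_{|u|\le1}K(u)>0$. Let $(r,l,h)$ (with $r,l,h>0$) and $n$ satisfy $$20\upsilon_0^2\,r\le h\le f_l/(2l_0)\quad\text{and}\quad n\ge C\sigma_x^2f_uf_l^{-2}(l/r)^2h\log(2p)$$ for a sufficiently large constant $C$ (independent of $n,p,r,l,h$). Then the local restricted strong convexity event $\mathcal E_{\rm rsc}(r,l,\kappa)$ with $\kappa=(\kappa_lf_l)/2$ occurs with probability at least $1-(2p)^{-1}$; that is, with at least this probability, $$\langle\nabla\hat Q_h(\beta)-\nabla\hat Q_h(\beta^* ),\beta-\beta^*\rangle\ge\tfrac12\kappa_lf_l\,\|\beta-\beta^*\|_\Sigma^2$$ for all $\beta\in\mathbb{R}^p$ with $\|\beta-\beta^*\|_\Sigma\le r$ and $\|\beta-\beta^*\|_1\le l\|\beta-\beta^*\|_\Sigma$.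
   Context: Model. Fix $\tau\in(0,1)$. $x=(x_1,\dots,x_p)^T$ is a random vector with $x_1\equiv1$, $y=x^T\beta^*+\varepsilon$ with $P(\varepsilon\le0\mid x)=\tau$; $(y_i,x_i)_{i=1}^n$ are i.i.d. copies of $(y,x)$. $\Sigma=E(xx^T)$ is positive definite, $\|u\|_\Sigma=\|\Sigma^{1/2}u\|_2$, $\sigma_x^2=\max_jE(x_j^2)$. Covariates are normalized so that $E(x_j)=0$ for $2\le j\le p$. Smoothed loss. $\rho_\tau(u)=u\{\tau-1(u<0)\}$; $K_h(u)=h^{-1}K(u/h)$, $\bar K(u)=\int_{-\infty}^uK$, $\ell_h(u)=\int\rho_\tau(v)K_h(v-u)\,dv$, $\hat Q_h(\beta)=\frac1n\sum_i\ell_h(y_i-x_i^T\beta)$, with gradient $\nabla\hat Q_h(\beta)=\frac1n\sum_i\{\bar K((x_i^T\beta-y_i)/h)-\tau\}x_i$. (B1) The conditional density $f_{\varepsilon|x}$ of $\varepsilon$ given $x$ satisfies $f_l\le f_{\varepsilon|x}(0)\le f_u$ almost surely for some $f_u\ge f_l>0$, and $|f_{\varepsilon|x}(u)-f_{\varepsilon|x}(v)|\le l_0|u-v|$ for all $u,v$ almost surely, for some $l_0>0$. (B2) $K:\mathbb{R}\to[0,\infty)$ is symmetric about zero, $\int K=1$, $\int u^2K(u)\,du<\infty$. (B3) $z=\Sigma^{-1/2}x$ is sub-exponential: there is $\upsilon_0\ge1$ with $P(|z^Tu|\ge\upsilon_0\|u\|_2t)\le e^{-t}$ for all $u\in\mathbb{R}^p$,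 $t\ge0$.
   Formalization: Condition (B3) is taken with the bound 2e^{-t} and only for u ≠ 0, because as printed, with e^{-t} and all u, it cannot hold when x_1 ≡ 1 (take u = Σ^{1/2}e_1 and small t > 0); the condition used is weaker than the printed one. *)

theory Defs
  imports "HOL-Probability.Probability" "Jordan_Normal_Form.Gauss_Jordan_Elimination"
begin

unbundle no vec_syntax
unbundle no inner_syntax
hide_type (open) Finite_Cartesian_Product.vec

text \<open>Coordinates are indexed from 0, so the intercept \<open>x\<^sub>1\<close> is coordinate 0, and
  \<open>\<real>\<^sup>p\<close> is \<open>carrier_vec p\<close>, so that the dimension can be quantified.\<close>

definition l1_norm :: "real vec \<Rightarrow> real" where
  "l1_norm v = (\<Sum>j<dim_vec v. \<bar>v $ j\<bar>)"

definition l2_norm :: "real vec \<Rightarrow> real" where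
  "l2_norm v = sqrt (v \<bullet> v)"

definition pos_semidef_mat :: "nat \<Rightarrow> real mat \<Rightarrow> bool" where
  "pos_semidef_mat p A \<longleftrightarrow> A \<in> carrier_mat p p \<and> transpose_mat A = A \<and>
     (\<forall>v \<in> carrier_vec p. v \<bullet> (A *\<^sub>v v) \<ge> 0)"

definition pos_def_mat :: "nat \<Rightarrow> real mat \<Rightarrow> bool" where
  "pos_def_mat p A \<longleftrightarrow> A \<in> carrier_mat p p \<and> transpose_mat A = A \<and>
     (\<forall>v \<in> carrier_vec p. v \<noteq> 0\<^sub>v p \<longrightarrow> v \<bullet> (A *\<^sub>v v) > 0)"

text \<open>\<open>A\<^bsup>1/2\<^esup>\<close> and \<open>A\<^bsup>-1/2\<^esup>\<close>, meaningful for positive semidefinite, respectively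
  positive definite, \<open>A\<close>.\<close>

definition mat_sqrt :: "real mat \<Rightarrow> real mat" where
  "mat_sqrt A = (THE B. pos_semidef_mat (dim_row A) B \<and> B * B = A)"

definition mat_inv_sqrt :: "real mat \<Rightarrow> real mat" where
  "mat_inv_sqrt A = the (mat_inverse (mat_sqrt A))"

definition mat_norm :: "real mat \<Rightarrow> real vec \<Rightarrow> real" where
  "mat_norm S u = l2_norm (mat_sqrt S *\<^sub>v u)"


text \<open>A random vector is a measurable map into the product space \<open>rvec_space p\<close>; its value
  \<open>x \<omega>\<close> is the vector \<open>vec p (x \<omega>)\<close>.\<close>

abbreviation rvec_space :: "nat \<Rightarrow> (nat \<Rightarrow> real) measure" where
  "rvec_space p \<equiv> (\<Pi>\<^sub>M j\<in>{..<p}. (borel :: real measure))"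

definition second_moment_mat :: "'a measure \<Rightarrow> nat \<Rightarrow> ('a \<Rightarrow> nat \<Rightarrow> real) \<Rightarrow> real mat" where
  "second_moment_mat M p x = mat p p (\<lambda>(i, j). LINT \<omega>|M. x \<omega> i * x \<omega> j)"

definition sigma_x_sq :: "'a measure \<Rightarrow> nat \<Rightarrow> ('a \<Rightarrow> nat \<Rightarrow> real) \<Rightarrow> real" where
  "sigma_x_sq M p x = Max ((\<lambda>j. LINT \<omega>|M. (x \<omega> j)\<^sup>2) ` {..<p})"

text \<open>Square integrability of the coordinates is what makes \<open>E(x x\<^sup>T)\<close> exist. The sample
  is \<open>(Y i, X i)\<close> for \<open>i < n\<close>. The conditional probability in the definition of the quantile
  model is taken with respect to the \<open>\<sigma>\<close>-algebra generated by \<open>x\<close>.\<close>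

definition quantile_model ::
  "'a measure \<Rightarrow> real \<Rightarrow> nat \<Rightarrow> ('a \<Rightarrow> nat \<Rightarrow> real) \<Rightarrow> ('a \<Rightarrow> real) \<Rightarrow> ('a \<Rightarrow> real) \<Rightarrow> real vec \<Rightarrow>
   nat \<Rightarrow> (nat \<Rightarrow> 'a \<Rightarrow> nat \<Rightarrow> real) \<Rightarrow> (nat \<Rightarrow> 'a \<Rightarrow> real) \<Rightarrow> bool" where
  "quantile_model M \<tau> p x y \<epsilon> \<beta>s n X Y \<longleftrightarrow>
     prob_space M \<and> p \<ge> 1 \<and> \<beta>s \<in> carrier_vec p \<and>
     x \<in> measurable M (rvec_space p) \<and> \<epsilon> \<in> borel_measurable M \<and>
     (\<forall>\<omega>\<in>space M. x \<omega> 0 = 1) \<and>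
     (\<forall>\<omega>\<in>space M. y \<omega> = vec p (x \<omega>) \<bullet> \<beta>s + \<epsilon> \<omega>) \<and>
     (AE \<omega> in M. real_cond_exp M (vimage_algebra (space M) x (rvec_space p))
                    (indicator {\<omega>' \<in> space M. \<epsilon> \<omega>' \<le> 0}) \<omega> = \<tau>) \<and>
     (\<forall>j<p. integrable M (\<lambda>\<omega>. (x \<omega> j)\<^sup>2)) \<and>
     (\<forall>j\<in>{1..<p}. (LINT \<omega>|M. x \<omega> j) = 0) \<and>
     pos_def_mat p (second_moment_mat M p x) \<and>
     prob_space.indep_vars M (\<lambda>_. borel \<Otimes>\<^sub>M rvec_space p) (\<lambda>i \<omega>. (Y i \<omega>, X i \<omega>)) {..<n} \<and>
     (\<forall>i<n. distr M (borel \<Otimes>\<^sub>M rvec_space p) (\<lambda>\<omega>. (Y i \<omega>, X i \<omega>)) =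
            distr M (borel \<Otimes>\<^sub>M rvec_space p) (\<lambda>\<omega>. (y \<omega>, x \<omega>)))"

text \<open>\<open>f v u\<close> is the conditional density at \<open>u\<close> of \<open>\<epsilon>\<close> given \<open>x = v\<close>: the joint law of
  \<open>(x, \<epsilon>)\<close> is the law of \<open>x\<close> times the kernel with Lebesgue density \<open>f v\<close>.\<close>

definition conditional_density ::
  "'a measure \<Rightarrow> nat \<Rightarrow> ('a \<Rightarrow> nat \<Rightarrow> real) \<Rightarrow> ('a \<Rightarrow> real) \<Rightarrow> ((nat \<Rightarrow> real) \<Rightarrow> real \<Rightarrow> real) \<Rightarrow> bool"
where
  "conditional_density M p x \<epsilon> f \<longleftrightarrow> (\<forall>v u. f v u \<ge> 0) \<and>
     distributed M (distr M (rvec_space p) x \<Otimes>\<^sub>M lborel) (\<lambda>\<omega>. (x \<omega>, \<epsilon> \<omega>))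
       (\<lambda>(v, u). ennreal (f v u))"

definition condition_B1 ::
  "'a measure \<Rightarrow> nat \<Rightarrow> ('a \<Rightarrow> nat \<Rightarrow> real) \<Rightarrow> ('a \<Rightarrow> real) \<Rightarrow> real \<Rightarrow> real \<Rightarrow> real \<Rightarrow> bool" where
  "condition_B1 M p x \<epsilon> f\<^sub>l f\<^sub>u l\<^sub>0 \<longleftrightarrow> 0 < f\<^sub>l \<and> f\<^sub>l \<le> f\<^sub>u \<and> 0 < l\<^sub>0 \<and>
     (\<exists>f. conditional_density M p x \<epsilon> f \<and>
        (AE \<omega> in M. f\<^sub>l \<le> f (x \<omega>) 0 \<and> f (x \<omega>) 0 \<le> f\<^sub>u) \<and>
        (AE \<omega> in M. \<forall>u v. \<bar>f (x \<omega>) u - f (x \<omega>) v\<bar> \<le> l\<^sub>0 * \<bar>u - v\<bar>))"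

definition condition_B2 :: "(real \<Rightarrow> real) \<Rightarrow> bool" where
  "condition_B2 K \<longleftrightarrow> (\<forall>u. K u \<ge> 0) \<and> (\<forall>u. K (- u) = K u) \<and>
     integrable lborel K \<and> (LINT u|lborel. K u) = 1 \<and> integrable lborel (\<lambda>u. u\<^sup>2 * K u)"

text \<open>Two corrections make the tail bound satisfiable. The case \<open>u = 0\<close> is excluded, as
  \<open>P(0 \<ge> 0) = 1\<close>. The factor 2 is the usual one for sub-exponential variables: for
  \<open>u = \<Sigma>\<^bsup>1/2\<^esup>e\<^sub>1\<close> one has \<open>z\<^sup>Tu = x\<^sub>1 = 1 = \<parallel>u\<parallel>\<^sub>2\<close>, so that the bound \<open>e\<^bsup>-t\<^esup>\<close> without the factor
  fails for every \<open>0 < t \<le> 1/\<upsilon>\<^sub>0\<close>. The condition is weaker than the one without the factor.\<close>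

definition condition_B3 :: "'a measure \<Rightarrow> nat \<Rightarrow> ('a \<Rightarrow> nat \<Rightarrow> real) \<Rightarrow> real \<Rightarrow> bool" where
  "condition_B3 M p x \<upsilon>\<^sub>0 \<longleftrightarrow> \<upsilon>\<^sub>0 \<ge> 1 \<and>
     (let z = (\<lambda>\<omega>. mat_inv_sqrt (second_moment_mat M p x) *\<^sub>v vec p (x \<omega>)) in
      \<forall>u \<in> carrier_vec p. u \<noteq> 0\<^sub>v p \<longrightarrow> (\<forall>t\<ge>0.
        measure M {\<omega> \<in> space M. \<bar>z \<omega> \<bullet> u\<bar> \<ge> \<upsilon>\<^sub>0 * l2_norm u * t} \<le> 2 * exp (- t)))"


definition check_loss :: "real \<Rightarrow> real \<Rightarrow> real" where
  "check_loss \<tau> u = u * (\<tau> - of_bool (u < 0))"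

definition scaled_kernel :: "(real \<Rightarrow> real) \<Rightarrow> real \<Rightarrow> real \<Rightarrow> real" where
  "scaled_kernel K h u = K (u / h) / h"

definition smoothed_loss :: "real \<Rightarrow> (real \<Rightarrow> real) \<Rightarrow> real \<Rightarrow> real \<Rightarrow> real" where
  "smoothed_loss \<tau> K h u = (LINT v|lborel. check_loss \<tau> v * scaled_kernel K h (v - u))"

text \<open>The covariates \<open>X\<close> and responses \<open>Y\<close> are here the realized sample.\<close>

definition empirical_loss ::
  "real \<Rightarrow> (real \<Rightarrow> real) \<Rightarrow> real \<Rightarrow> nat \<Rightarrow> nat \<Rightarrow> (nat \<Rightarrow> nat \<Rightarrow> real) \<Rightarrow> (nat \<Rightarrow> real) \<Rightarrow> real vec \<Rightarrow> real"
where
  "empirical_loss \<tau> K h p n X Y \<beta> =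
     1 / real n * (\<Sum>i<n. smoothed_loss \<tau> K h (Y i - vec p (X i) \<bullet> \<beta>))"

definition gradient :: "nat \<Rightarrow> (real vec \<Rightarrow> real) \<Rightarrow> real vec \<Rightarrow> real vec" where
  "gradient p F \<beta> = vec p (\<lambda>j. deriv (\<lambda>t. F (\<beta> + t \<cdot>\<^sub>v unit_vec p j)) 0)"

definition rsc_event ::
  "'a measure \<Rightarrow> real \<Rightarrow> (real \<Rightarrow> real) \<Rightarrow> real \<Rightarrow> nat \<Rightarrow> nat \<Rightarrow> (nat \<Rightarrow> 'a \<Rightarrow> nat \<Rightarrow> real) \<Rightarrow>
   (nat \<Rightarrow> 'a \<Rightarrow> real) \<Rightarrow> real mat \<Rightarrow> real vec \<Rightarrow> real \<Rightarrow> real \<Rightarrow> real \<Rightarrow> 'a set" where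
  "rsc_event M \<tau> K h p n X Y \<Sigma> \<beta>s r l \<kappa> = {\<omega> \<in> space M.
     let grad = gradient p (empirical_loss \<tau> K h p n (\<lambda>i. X i \<omega>) (\<lambda>i. Y i \<omega>)) in
     \<forall>\<beta> \<in> carrier_vec p. mat_norm \<Sigma> (\<beta> - \<beta>s) \<le> r \<and> l1_norm (\<beta> - \<beta>s) \<le> l * mat_norm \<Sigma> (\<beta> - \<beta>s) \<longrightarrow>
       (grad \<beta> - grad \<beta>s) \<bullet> (\<beta> - \<beta>s) \<ge> \<kappa> * (mat_norm \<Sigma> (\<beta> - \<beta>s))\<^sup>2}"

end

theory Submission
  imports Defs "Jordan_Normal_Form.Determinant"
begin

text \<open>Where \<open>\<bar>\<epsilon>\<^sub>i\<bar> \<le> h/2\<close>, \<open>\<bar>x\<^sub>i\<^sup>T\<delta>\<bar> \<le> h/2\<close> the kernel is at least \<open>\<kappa>\<^sub>l\<close>, and monotonicity of its primitive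
  discards all other observations; so, with \<open>t = \<delta>/\<parallel>\<delta>\<parallel>\<^sub>\<Sigma>\<close> and \<open>R = h/(2r)\<close>, the inner product is at least
  \<open>(\<kappa>\<^sub>l/(nh)) \<parallel>\<delta>\<parallel>\<^sub>\<Sigma>\<^sup>2 \<Sum>\<^sub>i 1(\<bar>\<epsilon>\<^sub>i\<bar> \<le> h/2) \<phi>\<^sub>R(x\<^sub>i\<^sup>Tt)\<close>, where \<open>\<phi>\<^sub>R\<close> is a Lipschitz truncation of the square.
  Each summand has mean at least \<open>9f\<^sub>lh/16\<close>, by the sub-exponential tail and the lower bound on the
  conditional density.  The infimum over \<open>t\<close> is controlled without a concentration inequality for
  suprema: symmetrisation and the Ledoux--Talagrand contraction are carried out inside the exponential
  moment, one observation at a time, which replaces \<open>\<phi>\<^sub>R\<close> by a linear function of \<open>t\<close>.  Duality between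
  the \<open>\<ell>\<^sub>1\<close> and \<open>\<ell>\<^sub>\<infinity>\<close> norms then leaves \<open>2p\<close> scalar exponential moments and a Chernoff bound.
  The bound is uniform over finite sets of directions, and it passes to the whole cone by separability
  and continuity.\<close>

section \<open>Square roots of positive definite matrices\<close>

text \<open>The sample size may grow only linearly in \<open>h\<close>, although linearising the
  truncated square costs the slope \<open>8R = 4h/r\<close>. The powers of \<open>h\<close> cancel
  because the window on the noise survives the contraction as a factor of the linear majorant: the
  excess over 1 of each \<open>cosh\<close> moment then carries a factor \<open>f\<^sub>u h\<close>,
  while the gap between mean and target is of order \<open>f\<^sub>l h\<close>. Optimising the
  Chernoff parameter gives, per observation and up to constants and
  \<open>\<upsilon>\<^sub>0\<close>, the rate \<open>(f\<^sub>l h)\<^sup>2 / (f\<^sub>u h (h l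
  \<sigma> / r)\<^sup>2) = f\<^sub>l\<^sup>2 / (f\<^sub>u h (l \<sigma> / r)\<^sup>2)\<close>, the
  reciprocal of the required sample size without its logarithm.

  The linearised summands are unbounded because the covariates are. Working with exponential moments
  throughout asks no more of a coordinate than a sub-exponential tail, and averaging over signs
  leaves the even function \<open>cosh\<close>, which has no first-order term.

  Matrix roots have to be constructed since \<open>mat_sqrt\<close> is a definite description:
  before existence and uniqueness are known, neither the norm nor the standardised covariate can be
  computed with.\<close>

lemma compact_box:
  "compact {V :: nat \<Rightarrow> nat \<Rightarrow> real. \<forall>i j. \<bar>V i j\<bar> \<le> 1}"
proof -
  have box: "compact {V :: nat \<Rightarrow> 'b::topological_space. \<forall>i. V i \<in> S}" if "compact S" for S
  proof -
    have "compactin (product_topology (\<lambda>_. euclidean) UNIV) (PiE UNIV (\<lambda>_::nat. S))"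
      using that by (subst compactin_PiE) (auto simp: compactin_euclidean_iff)
    then show ?thesis
      by (simp add: euclidean_product_topology compactin_euclidean_iff PiE_def Pi_def)
  qed
  have "compact {V :: nat \<Rightarrow> nat \<Rightarrow> real. \<forall>i. V i \<in> {v. \<forall>j. v j \<in> {-1..1}}}"
    by (intro box) auto
  then show ?thesis
    by (simp add: abs_le_iff conj_commute minus_le_iff)
qed

lemma continuous_on_entry [continuous_intros]:
  "continuous_on UNIV (\<lambda>V :: nat \<Rightarrow> nat \<Rightarrow> real. V i j)"
  by (metis (no_types) continuous_on_product_then_coordinatewise continuous_on_id)

text \<open>A plane rotation mixes only the rows \<open>i\<close> and \<open>j\<close>, and
  \<open>c\<^sup>2 + s\<^sup>2 = 1\<close> keeps that pair orthonormal.\<close>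

lemma rotation_orthonormal:
  fixes V :: "nat \<Rightarrow> nat \<Rightarrow> real"
  assumes on: "\<And>k m. k < p \<Longrightarrow> m < p \<Longrightarrow> (\<Sum>a<p. V k a * V m a) = of_bool (k = m)"
    and ij: "i < p" "j < p" "i \<noteq> j" and cs: "c\<^sup>2 + s\<^sup>2 = 1"
    and W: "\<And>k a. a < p \<Longrightarrow> W k a = (if k = i then c * V i a + s * V j a
              else if k = j then c * V j a - s * V i a else V k a)"
    and k: "k < p" and m: "m < p"
  shows "(\<Sum>a<p. W k a * W m a) = of_bool (k = m)"
proof -
  have lin: "(\<Sum>a<p. (x * V q a + y * V q' a) * (x' * V w a + y' * V w' a)) =
      x * x' * of_bool (q = w) + x * y' * of_bool (q = w') + y * x' * of_bool (q' = w) + y * y' * of_bool (q' = w')"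
    if "q < p" "q' < p" "w < p" "w' < p" for x y x' y' q q' w w'
  proof -
    have "(\<Sum>a<p. (x * V q a + y * V q' a) * (x' * V w a + y' * V w' a)) =
      x * x' * (\<Sum>a<p. V q a * V w a) + x * y' * (\<Sum>a<p. V q a * V w' a) +
      y * x' * (\<Sum>a<p. V q' a * V w a) + y * y' * (\<Sum>a<p. V q' a * V w' a)"
      by (simp add: sum_distrib_left flip: sum.distrib) (simp add: algebra_simps)
    then show ?thesis using on that by simp
  qed
  \<comment> \<open>Uniform description: row \<open>k\<close> of \<open>W\<close> is
    \<open>x k\<close> times row \<open>q k\<close> plus \<open>y k\<close> times row
    \<open>q' k\<close>, with \<open>y k = 0\<close> for untouched rows. The expansion
    \<open>lin\<close> then covers all pairs at once.\<close>
  define x q y q' where "x = (\<lambda>k. if k = i \<or> k = j then c else 1)" and "q = (\<lambda>k :: nat. k)"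
    and "y = (\<lambda>k. if k = i then s else if k = j then - s else 0)"
    and "q' = (\<lambda>k. if k = i then j else if k = j then i else k)"
  note defs = x_def q_def y_def q'_def
  have "(\<Sum>a<p. W k a * W m a) =
      (\<Sum>a<p. (x k * V (q k) a + y k * V (q' k) a) * (x m * V (q m) a + y m * V (q' m) a))"
    using ij by (intro sum.cong refl) (simp add: W defs)
  also have "\<dots> = x k * x m * of_bool (q k = q m) + x k * y m * of_bool (q k = q' m) +
      y k * x m * of_bool (q' k = q m) + y k * y m * of_bool (q' k = q' m)"
    using ij k m by (intro lin) (auto simp: defs)
  also have "\<dots> = of_bool (k = m)"
    using ij k m cs by (auto simp: defs power2_eq_square)
  finally show ?thesis .
qed

text \<open>Maximising \<open>\<Sum>k. k * (V A V\<^sup>T)\<^sub>k\<^sub>k\<close> over the compact orthogonal group sorts the eigenvalues: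
  the derivative along the rotation in the plane \<open>(i, j)\<close> is \<open>2 (i - j) (V A V\<^sup>T)\<^sub>i\<^sub>j\<close>.\<close>
lemma orthogonal_diagonalization:
  fixes A :: "nat \<Rightarrow> nat \<Rightarrow> real"
  assumes sym: "\<And>a b. a < p \<Longrightarrow> b < p \<Longrightarrow> A a b = A b a"
  obtains V :: "nat \<Rightarrow> nat \<Rightarrow> real" where
    "\<And>k m. k < p \<Longrightarrow> m < p \<Longrightarrow> (\<Sum>a<p. V k a * V m a) = of_bool (k = m)"
    "\<And>k m. k < p \<Longrightarrow> m < p \<Longrightarrow> k \<noteq> m \<Longrightarrow> (\<Sum>a<p. \<Sum>b<p. V k a * A a b * V m b) = 0"
proof -
  define Q where "Q = (\<lambda>u v :: nat \<Rightarrow> real. \<Sum>a<p. \<Sum>b<p. u a * A a b * v b)"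
  define F where "F = (\<lambda>V :: nat \<Rightarrow> nat \<Rightarrow> real. \<Sum>k<p. real k * Q (V k) (V k))"
  \<comment> \<open>Orthonormality constrains only the leading \<open>p\<close> by \<open>p\<close>
    block; the bound 1 on every entry is what makes \<open>S\<close> compact in the product
    topology.\<close>
  define S where "S = {V :: nat \<Rightarrow> nat \<Rightarrow> real. \<forall>i j. \<bar>V i j\<bar> \<le> 1} \<inter>
    {V. \<forall>k\<in>{..<p}. \<forall>m\<in>{..<p}. (\<Sum>a<p. V k a * V m a) = of_bool (k = m)}"
  have "compact S"
    unfolding S_def
    by (intro compact_Int_closed compact_box)
      (simp only: Collect_ball_eq, intro closed_INT ballI closed_Collect_eq continuous_intros)
  moreover have "(\<lambda>i j. of_bool (i = j)) \<in> S"
    by (auto simp: S_def of_bool_def if_distrib if_distribR cong: if_cong)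
  moreover have "continuous_on S F"
    unfolding F_def Q_def
    by (rule continuous_on_subset[of UNIV]) (intro continuous_intros, auto)
  ultimately obtain V where V: "V \<in> S" "\<And>W. W \<in> S \<Longrightarrow> F W \<le> F V"
    using continuous_attains_sup[of S F] by blast
  have on: "(\<Sum>a<p. V k a * V m a) = of_bool (k = m)" if "k < p" "m < p" for k m
    using V(1) that by (simp add: S_def)
  have "Q (V i) (V j) = 0" if ij: "i < p" "j < p" "i \<noteq> j" for i j
  proof -
    define \<alpha> \<beta> \<gamma> where "\<alpha> = Q (V i) (V i)" and "\<beta> = Q (V i) (V j)" and "\<gamma> = Q (V j) (V j)"
    have Qsym: "Q (V j) (V i) = \<beta>"
      unfolding \<beta>_def Q_def by (subst sum.swap) (auto intro!: sum.cong simp: sym)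
    have Qlin: "Q (\<lambda>a. if a < p then x * V i a + y * V j a else 0)
        (\<lambda>a. if a < p then x * V i a + y * V j a else 0) = x\<^sup>2 * \<alpha> + 2 * x * y * \<beta> + y\<^sup>2 * \<gamma>" for x y
    proof -
      have "Q (\<lambda>a. if a < p then x * V i a + y * V j a else 0)
          (\<lambda>a. if a < p then x * V i a + y * V j a else 0) =
        x\<^sup>2 * Q (V i) (V i) + x * y * Q (V i) (V j) + x * y * Q (V j) (V i) + y\<^sup>2 * Q (V j) (V j)"
        unfolding Q_def
        by (simp add: sum_distrib_left flip: sum.distrib) (simp add: algebra_simps power2_eq_square)
      then show ?thesis by (simp add: Qsym) (simp add: \<alpha>_def \<beta>_def \<gamma>_def)
    qed
    define f where "f = (\<lambda>\<theta>. i * ((cos \<theta>)\<^sup>2 * \<alpha> + 2 * cos \<theta> * sin \<theta> * \<beta> + (sin \<theta>)\<^sup>2 * \<gamma>) +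
      j * ((- sin \<theta>)\<^sup>2 * \<alpha> + 2 * (- sin \<theta>) * cos \<theta> * \<beta> + (cos \<theta>)\<^sup>2 * \<gamma>))"
    have le: "f \<theta> \<le> f 0" for \<theta>
    proof -
      \<comment> \<open>Columns from \<open>p\<close> on are set to 0, because a rotated entry there
        need not stay in the box; \<open>F\<close> does not see them.\<close>
      define W where "W = (\<lambda>k a. if a < p then (if k = i then cos \<theta> * V i a + sin \<theta> * V j a
              else if k = j then (- sin \<theta>) * V i a + cos \<theta> * V j a else V k a) else 0)"
      have onW: "(\<Sum>a<p. W k a * W m a) = of_bool (k = m)" if "k < p" "m < p" for k m
        by (rule rotation_orthonormal[of p V i j "cos \<theta>" "sin \<theta>"])
          (use on ij that in \<open>auto simp: W_def\<close>)
      have "\<bar>W k a\<bar> \<le> 1" for k a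
      proof (cases "k < p \<and> a < p")
        case True
        then have "(W k a)\<^sup>2 \<le> (\<Sum>a<p. (W k a)\<^sup>2)"
          by (intro member_le_sum) auto
        also have "\<dots> = 1" using onW[of k k] True by (simp add: power2_eq_square)
        finally show ?thesis by (simp add: abs_square_le_1)
      next
        case False
        have "\<bar>V k a\<bar> \<le> 1" using V(1) by (simp add: S_def)
        then show ?thesis using False ij by (auto simp: W_def)
      qed
      then have "W \<in> S" using onW by (simp add: S_def)
      then have "F W \<le> F V" by (rule V)
      have split: "(\<Sum>k<p. g k) = g i + g j + (\<Sum>k\<in>{..<p} - {i, j}. g k)" for g :: "nat \<Rightarrow> real"
        using ij by (simp add: sum.remove[of "{..<p}" i] sum.remove[of "{..<p} - {i}" j] Diff_insert2[of _ i "{j}"] insert_commute add.assoc)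
      have "(\<Sum>k\<in>{..<p} - {i, j}. real k * Q (W k) (W k)) = (\<Sum>k\<in>{..<p} - {i, j}. real k * Q (V k) (V k))"
        by (intro sum.cong refl) (auto simp: Q_def W_def)
      moreover have "Q (W i) (W i) = (cos \<theta>)\<^sup>2 * \<alpha> + 2 * cos \<theta> * sin \<theta> * \<beta> + (sin \<theta>)\<^sup>2 * \<gamma>"
        using Qlin[of "cos \<theta>" "sin \<theta>"] unfolding W_def by (simp cong: if_cong)
      moreover have "Q (W j) (W j) = (- sin \<theta>)\<^sup>2 * \<alpha> + 2 * (- sin \<theta>) * cos \<theta> * \<beta> + (cos \<theta>)\<^sup>2 * \<gamma>"
        using Qlin[of "- sin \<theta>" "cos \<theta>"] ij(3) unfolding W_def by (simp cong: if_cong)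
      ultimately show ?thesis
        using \<open>F W \<le> F V\<close> unfolding F_def split f_def by (simp add: \<alpha>_def \<gamma>_def)
    qed
    have "DERIV f 0 :> 2 * (real i - real j) * \<beta>"
      unfolding f_def by (auto intro!: derivative_eq_intros simp: algebra_simps)
    then have "2 * (real i - real j) * \<beta> = 0"
      by (rule DERIV_local_max[of f _ 0 1]) (use le in auto)
    then show ?thesis using ij by (simp add: \<beta>_def)
  qed
  then show ?thesis using on that unfolding Q_def by blast
qed

section \<open>Existence and uniqueness of the root\<close>

lemma mult_square_mat_closed:
  "A \<in> carrier_mat p p \<Longrightarrow> B \<in> carrier_mat p p \<Longrightarrow> A * B \<in> carrier_mat p p"
  by (rule mult_carrier_mat)

lemma mult_square_mat_vec_closed:
  "A \<in> carrier_mat p p \<Longrightarrow> v \<in> carrier_vec p \<Longrightarrow> A *\<^sub>v v \<in> carrier_vec p"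
  by (rule mult_mat_vec_carrier)

text \<open>Diagonalise to \<open>D = P A P\<^sup>T\<close> and take roots on the diagonal: its
  entries are values of the quadratic form of \<open>A\<close>, hence nonnegative, and
  \<open>P\<^sup>T R P\<close> inherits symmetry and semidefiniteness from \<open>R\<close>.\<close>

lemma pos_semidef_sqrt_exists:
  assumes A: "pos_semidef_mat p A"
  shows "\<exists>B. pos_semidef_mat p B \<and> B * B = A"
proof -
  have car: "A \<in> carrier_mat p p" and tr: "transpose_mat A = A"
    and psd: "\<And>v. v \<in> carrier_vec p \<Longrightarrow> 0 \<le> v \<bullet> (A *\<^sub>v v)"
    using A by (auto simp: pos_semidef_mat_def)
  have sym: "A $$ (a, b) = A $$ (b, a)" if "a < p" "b < p" for a b
    using arg_cong[OF tr, of "\<lambda>M. M $$ (a, b)"] that car by auto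
  obtain V where on: "\<And>k m. k < p \<Longrightarrow> m < p \<Longrightarrow> (\<Sum>a<p. V k a * V m a) = of_bool (k = m)"
    and diag: "\<And>k m. k < p \<Longrightarrow> m < p \<Longrightarrow> k \<noteq> m \<Longrightarrow> (\<Sum>a<p. \<Sum>b<p. V k a * A $$ (a, b) * V m b) = 0"
    using orthogonal_diagonalization[of p "\<lambda>a b. A $$ (a, b)"] sym by blast
  define P where "P = mat p p (\<lambda>(k, a). V k a)"
  define D where "D = P * A * transpose_mat P"
  define R where "R = mat p p (\<lambda>(k, m). if k = m then sqrt (D $$ (k, k)) else 0)"
  have [simp]: "P \<in> carrier_mat p p" "D \<in> carrier_mat p p" "R \<in> carrier_mat p p" "A \<in> carrier_mat p p"
      "transpose_mat P \<in> carrier_mat p p"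
    using car by (auto simp: P_def D_def R_def)
  have [simp]: "dim_row P = p" "dim_col P = p" "dim_row A = p" "dim_col A = p" "dim_row R = p" "dim_col R = p"
    "dim_row D = p" "dim_col D = p"
    by (simp_all add: P_def R_def D_def carrier_matD[OF car])
  note [simp] = mult_square_mat_closed mult_square_mat_vec_closed
  have PP: "P * transpose_mat P = 1\<^sub>m p"
    by (intro eq_matI) (auto simp: P_def scalar_prod_def on lessThan_atLeast0[symmetric] one_mat_def)
  then have P'P: "transpose_mat P * P = 1\<^sub>m p"
    by (intro mat_mult_left_right_inverse[of P p]) auto
  have D_row: "D $$ (k, m) = row P k \<bullet> (A *\<^sub>v row P m)" if "k < p" "m < p" for k m
  proof -
    have "D $$ (k, m) = row P k \<bullet> (col (A * transpose_mat P) m)"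
      using that unfolding D_def by (subst assoc_mult_mat[of _ p p _ p _ p]) auto
    also have "col (A * transpose_mat P) m = A *\<^sub>v row P m"
      using that by (intro eq_vecI) auto
    finally show ?thesis .
  qed
  have D_off: "D $$ (k, m) = 0" if "k < p" "m < p" "k \<noteq> m" for k m
    using diag[OF that] D_row[of k m] that
    by (simp add: scalar_prod_def P_def lessThan_atLeast0[symmetric] mult_mat_vec_def sum_distrib_left mult.assoc)
  have D_diag: "0 \<le> D $$ (k, k)" if "k < p" for k
    unfolding D_row[OF that that] using that by (intro psd) (simp add: row_carrier_vec[of _ p])
  have RR: "R * R = D"
    by (intro eq_matI) (auto simp: R_def scalar_prod_def D_off D_diag mult_delta_left mult_delta_right)
  have Rt: "transpose_mat R = R"
    by (intro eq_matI) (auto simp: R_def)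
  define B where "B = transpose_mat P * R * P"
  have [simp]: "B \<in> carrier_mat p p" by (simp add: B_def)
  note assoc = assoc_mult_mat[of _ p p _ p _ p]
  have "B * B = transpose_mat P * R * (P * transpose_mat P) * R * P"
    unfolding B_def by (simp only: assoc mult_square_mat_closed \<open>P \<in> _\<close> \<open>R \<in> _\<close> \<open>transpose_mat P \<in> _\<close>)
  also have "\<dots> = transpose_mat P * (R * R) * P"
    by (simp add: PP assoc)
  also have "\<dots> = (transpose_mat P * P) * A * (transpose_mat P * P)"
    unfolding RR unfolding D_def by (simp only: assoc mult_square_mat_closed \<open>P \<in> _\<close> \<open>A \<in> _\<close> \<open>transpose_mat P \<in> _\<close>)
  also have "\<dots> = A" by (simp add: P'P)
  finally have "B * B = A" .
  moreover have "transpose_mat B = B"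
    unfolding B_def by (simp add: transpose_mult[of _ p p _ p] Rt) (simp add: assoc)
  moreover have "0 \<le> v \<bullet> (B *\<^sub>v v)" if v: "v \<in> carrier_vec p" for v
  proof -
    define w where "w = P *\<^sub>v v"
    have [simp]: "w \<in> carrier_vec p" using v by (simp add: w_def)
    have dw: "dim_vec w = p" by (simp add: w_def)
    have B: "B *\<^sub>v v = transpose_mat P *\<^sub>v (R *\<^sub>v w)"
      unfolding B_def w_def using v by (simp add: assoc_mult_mat_vec[of _ p p _ p])
    have "v \<bullet> (B *\<^sub>v v) = (transpose_mat P *\<^sub>v (R *\<^sub>v w)) \<bullet> v"
      unfolding B using v by (intro comm_scalar_prod[of _ p]) auto
    also have "\<dots> = (R *\<^sub>v w) \<bullet> (P *\<^sub>v v)"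
      using v by (intro transpose_vec_mult_scalar[of P p p]) auto
    also have "\<dots> = w \<bullet> (R *\<^sub>v w)"
      unfolding w_def[symmetric] by (intro comm_scalar_prod[of _ p]) auto
    also have "\<dots> = (\<Sum>k<p. sqrt (D $$ (k, k)) * (w $ k)\<^sup>2)"
      by (auto simp: dw scalar_prod_def R_def mult_mat_vec_def lessThan_atLeast0[symmetric] mult_delta_left
        power2_eq_square mult.assoc mult.left_commute intro!: sum.cong)
    also have "\<dots> \<ge> 0" by (intro sum_nonneg) (auto simp: D_diag)
    finally show ?thesis .
  qed
  ultimately have "pos_semidef_mat p B" by (simp add: pos_semidef_mat_def)
  with \<open>B * B = A\<close> show ?thesis by blast
qed

text \<open>Moving from \<open>d\<close> in the direction \<open>e = B d\<close> gives the form
  value \<open>2 s (e \<bullet> e) + s\<^sup>2 q\<close>; for nonzero \<open>e\<close> the linear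
  term would win at small negative \<open>s\<close>.\<close>

lemma pos_semidef_null:
  assumes B: "pos_semidef_mat p B" and d: "d \<in> carrier_vec p" and z: "d \<bullet> (B *\<^sub>v d) = 0"
  shows "B *\<^sub>v d = 0\<^sub>v p"
proof -
  have car: "B \<in> carrier_mat p p" and tr: "transpose_mat B = B"
    and psd: "\<And>v. v \<in> carrier_vec p \<Longrightarrow> 0 \<le> v \<bullet> (B *\<^sub>v v)"
    using B by (auto simp: pos_semidef_mat_def)
  define e where "e = B *\<^sub>v d"
  have e: "e \<in> carrier_vec p" using car d by (auto simp: e_def)
  define q where "q = e \<bullet> (B *\<^sub>v e)"
  have "0 \<le> 2 * s * (e \<bullet> e) + s\<^sup>2 * q" for s
  proof -
    have Be: "B *\<^sub>v e \<in> carrier_vec p" using car e by auto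
    have "0 \<le> (d + s \<cdot>\<^sub>v e) \<bullet> (B *\<^sub>v (d + s \<cdot>\<^sub>v e))" using d e by (intro psd) auto
    also have "B *\<^sub>v (d + s \<cdot>\<^sub>v e) = e + s \<cdot>\<^sub>v (B *\<^sub>v e)"
      using car d e by (simp add: mult_add_distrib_mat_vec[of _ p p] mult_mat_vec[of _ p p] e_def)
    also have "(d + s \<cdot>\<^sub>v e) \<bullet> (e + s \<cdot>\<^sub>v (B *\<^sub>v e)) =
        d \<bullet> e + s * (e \<bullet> e) + (s * (d \<bullet> (B *\<^sub>v e)) + s * s * q)"
      using d e Be by (simp add: scalar_prod_add_distrib[of _ p] add_scalar_prod_distrib[of _ p] q_def algebra_simps)
    also have "d \<bullet> (B *\<^sub>v e) = e \<bullet> e"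
      using transpose_vec_mult_scalar[OF car e d] tr by (simp add: e_def)
    finally show ?thesis using z by (simp add: e_def power2_eq_square)
  qed
  have q: "q \<ge> 0" unfolding q_def by (rule psd[OF e])
  have ee: "e \<bullet> e \<ge> 0" by (simp add: scalar_prod_def sum_nonneg)
  have "e \<bullet> e = 0"
  proof (rule ccontr)
    assume "e \<bullet> e \<noteq> 0"
    then have pos: "e \<bullet> e > 0" using ee by simp
    \<comment> \<open>Small enough that \<open>s q\<close> stays below \<open>e \<bullet> e\<close>;
      the 1 in the denominator covers \<open>q = 0\<close>.\<close>
    define s where "s = (e \<bullet> e) / (1 + q)"
    have "s > 0" using pos q by (simp add: s_def)
    have "0 \<le> s * (- 2 * (e \<bullet> e) + s * q)"
      using \<open>\<And>s. 0 \<le> 2 * s * (e \<bullet> e) + s\<^sup>2 * q\<close>[of "- s"] by (simp add: algebra_simps power2_eq_square)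
    then have "2 * (e \<bullet> e) \<le> s * q" using \<open>s > 0\<close> by (simp add: zero_le_mult_iff)
    also have "s * q \<le> e \<bullet> e" using pos q by (simp add: s_def field_simps)
    finally show False using pos by simp
  qed
  then show ?thesis
    using e unfolding e_def[symmetric]
    by (intro eq_vecI) (auto simp: scalar_prod_def sum_nonneg_eq_0_iff)
qed

text \<open>With \<open>D = B - B'\<close>, the identity \<open>B D + D B' = B\<^sup>2 - B'\<^sup>2 = 0\<close> gives
  \<open>tr (D B D) + tr (D B' D) = 0\<close>, and both traces are nonnegative.\<close>
lemma pos_semidef_sqrt_unique:
  assumes A: "pos_def_mat p A" and B: "pos_semidef_mat p B" "B * B = A"
    and B': "pos_semidef_mat p B'" "B' * B' = A"
  shows "B = B'"
proof -
  have car: "B \<in> carrier_mat p p" "B' \<in> carrier_mat p p" and tr: "transpose_mat B = B" "transpose_mat B' = B'"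
    and psd: "\<And>v. v \<in> carrier_vec p \<Longrightarrow> 0 \<le> v \<bullet> (B *\<^sub>v v)"
     "\<And>v. v \<in> carrier_vec p \<Longrightarrow> 0 \<le> v \<bullet> (B' *\<^sub>v v)"
    using B B' by (auto simp: pos_semidef_mat_def)
  define D where "D = B - B'"
  have D: "D \<in> carrier_mat p p" using car by (auto simp: D_def)
  have Dt: "D $$ (i, j) = D $$ (j, i)" if "i < p" "j < p" for i j
    using arg_cong[OF tr(1), of "\<lambda>M. M $$ (i, j)"] arg_cong[OF tr(2), of "\<lambda>M. M $$ (i, j)"] that car
    by (auto simp: D_def)
  have dims [simp]: "dim_row D = p" "dim_col D = p" "dim_row B = p" "dim_col B = p" "dim_row B' = p" "dim_col B' = p"
    using D car by auto
  have trace: "(\<Sum>i<p. col D i \<bullet> (X *\<^sub>v col D i)) = (\<Sum>i<p. (D * (X * D)) $$ (i, i))"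
    if "X \<in> carrier_mat p p" for X
  proof (intro sum.cong refl)
    fix i assume "i \<in> {..<p}"
    then have i: "i < p" by simp
    have "row D i = col D i" using i by (intro eq_vecI) (auto simp: Dt)
    moreover have "col (X * D) i = X *\<^sub>v col D i" using that i by (intro eq_vecI) auto
    ultimately show "col D i \<bullet> (X *\<^sub>v col D i) = (D * (X * D)) $$ (i, i)" using i that by auto
  qed
  have comm: "(\<Sum>i<p. (X * Y) $$ (i, i)) = (\<Sum>i<p. (Y * X) $$ (i, i))"
    if "X \<in> carrier_mat p p" "Y \<in> carrier_mat p p" for X Y :: "real mat"
    using that by (simp add: scalar_prod_def lessThan_atLeast0[symmetric]) (subst sum.swap, simp add: mult.commute)
  have zero: "B * D + D * B' = 0\<^sub>m p p"
  proof -
    have "B * D + D * B' = (B * B - B * B') + (B * B' - B' * B')"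
      unfolding D_def using car by (simp add: mult_minus_distrib_mat[of _ p p _ p] minus_mult_distrib_mat[of _ p p _ _ p])
    also have "\<dots> = 0\<^sub>m p p"
      unfolding B B' using car A by (intro eq_matI) (auto simp: pos_def_mat_def)
    finally show ?thesis .
  qed
  have "(\<Sum>i<p. col D i \<bullet> (B *\<^sub>v col D i)) + (\<Sum>i<p. col D i \<bullet> (B' *\<^sub>v col D i)) =
     (\<Sum>i<p. (D * (B * D)) $$ (i, i)) + (\<Sum>i<p. ((D * B') * D) $$ (i, i))"
    using trace[OF car(1)] trace[OF car(2)] D car by (simp add: assoc_mult_mat[of _ p p _ p _ p])
  also have "(\<Sum>i<p. ((D * B') * D) $$ (i, i)) = (\<Sum>i<p. (D * (D * B')) $$ (i, i))"
    using D car by (intro comm) auto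
  also have "(\<Sum>i<p. (D * (B * D)) $$ (i, i)) + (\<Sum>i<p. (D * (D * B')) $$ (i, i)) =
      (\<Sum>i<p. (D * (B * D + D * B')) $$ (i, i))"
    using D car by (simp add: mult_add_distrib_mat[of _ p p _ p] sum.distrib)
  also have "\<dots> = 0" using D by (simp add: zero)
  finally have "(\<Sum>i<p. col D i \<bullet> (B *\<^sub>v col D i)) + (\<Sum>i<p. col D i \<bullet> (B' *\<^sub>v col D i)) = 0" .
  moreover have "col D i \<in> carrier_vec p" for i by (simp add: col_def)
  ultimately have "(\<Sum>i<p. col D i \<bullet> (B *\<^sub>v col D i)) = 0"
    using psd by (subst (asm) add_nonneg_eq_0_iff) (auto intro!: sum_nonneg)
  then have nul: "col D i \<bullet> (B *\<^sub>v col D i) = 0" if "i < p" for i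
    using psd \<open>\<And>i. col D i \<in> carrier_vec p\<close> that by (subst (asm) sum_nonneg_eq_0_iff) auto
  \<comment> \<open>A column on which the form of \<open>B\<close> vanishes lies in the kernel of
    \<open>B\<close>, hence in that of \<open>A = B * B\<close>, which is trivial.\<close>
  have "col D i = 0\<^sub>v p" if "i < p" for i
  proof (rule ccontr)
    assume "col D i \<noteq> 0\<^sub>v p"
    then have "col D i \<bullet> (A *\<^sub>v col D i) > 0"
      using A \<open>\<And>i. col D i \<in> carrier_vec p\<close> by (auto simp: pos_def_mat_def)
    moreover have "A *\<^sub>v col D i = B *\<^sub>v (B *\<^sub>v col D i)"
      unfolding B(2)[symmetric] using car \<open>\<And>i. col D i \<in> carrier_vec p\<close> by (intro assoc_mult_mat_vec) auto
    moreover have "B *\<^sub>v col D i = 0\<^sub>v p"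
      using B(1) nul that \<open>\<And>i. col D i \<in> carrier_vec p\<close> by (intro pos_semidef_null) auto
    moreover have "B *\<^sub>v 0\<^sub>v p = 0\<^sub>v p" using car by (intro eq_vecI) auto
    ultimately show False using \<open>\<And>i. col D i \<in> carrier_vec p\<close>[of i] by simp
  qed
  then have D0: "D $$ (k, i) = 0" if "i < p" "k < p" for i k
    using that by (metis dims index_col index_zero_vec(1))
  show ?thesis
    by (intro eq_matI) (use D0 in \<open>auto simp: D_def\<close>)
qed

lemma mat_sqrt:
  assumes A: "pos_def_mat p A"
  shows "pos_semidef_mat p (mat_sqrt A)" "mat_sqrt A * mat_sqrt A = A"
proof -
  have [simp]: "dim_row A = p" using A by (auto simp: pos_def_mat_def)
  have "pos_semidef_mat p A"
    using A unfolding pos_def_mat_def pos_semidef_mat_def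
    by (metis less_eq_real_def mult_mat_vec_carrier scalar_prod_left_zero)
  then have "\<exists>!B. pos_semidef_mat p B \<and> B * B = A"
    using pos_semidef_sqrt_exists pos_semidef_sqrt_unique[OF A] by metis
  from theI'[OF this] show "pos_semidef_mat p (mat_sqrt A)" "mat_sqrt A * mat_sqrt A = A"
    by (simp_all add: mat_sqrt_def)
qed

lemma mat_sqrt_carrier:
  assumes "pos_def_mat p A"
  shows "mat_sqrt A \<in> carrier_mat p p" "transpose_mat (mat_sqrt A) = mat_sqrt A"
  using mat_sqrt[OF assms] by (auto simp: pos_semidef_mat_def)

lemma mat_norm_eq:
  assumes A: "pos_def_mat p A" and u: "u \<in> carrier_vec p"
  shows "mat_norm A u = sqrt (u \<bullet> (A *\<^sub>v u))"
proof -
  note S = mat_sqrt_carrier[OF A]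
  have c: "mat_sqrt A *\<^sub>v u \<in> carrier_vec p" using S u by (intro mult_mat_vec_carrier)
  have "(mat_sqrt A *\<^sub>v u) \<bullet> (mat_sqrt A *\<^sub>v u) = (mat_sqrt A *\<^sub>v (mat_sqrt A *\<^sub>v u)) \<bullet> u"
    using transpose_vec_mult_scalar[OF S(1) u c] S by simp
  also have "\<dots> = u \<bullet> (mat_sqrt A *\<^sub>v (mat_sqrt A *\<^sub>v u))"
    using S u c by (intro comm_scalar_prod[of _ p] mult_mat_vec_carrier)
  also have "mat_sqrt A *\<^sub>v (mat_sqrt A *\<^sub>v u) = A *\<^sub>v u"
    using assoc_mult_mat_vec[OF S(1) S(1) u] mat_sqrt(2)[OF A] by simp
  finally show ?thesis by (simp add: mat_norm_def l2_norm_def)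
qed

text \<open>Translates tail bounds for the standardised covariate into tail bounds for linear forms
  in \<open>x\<close>. The root is invertible because its kernel is contained in that of
  \<open>A\<close>.\<close>

lemma mat_inv_sqrt_scalar_prod:
  assumes A: "pos_def_mat p A" and t: "t \<in> carrier_vec p" and w: "w \<in> carrier_vec p"
  shows "(mat_inv_sqrt A *\<^sub>v w) \<bullet> (mat_sqrt A *\<^sub>v t) = w \<bullet> t"
proof -
  let ?S = "mat_sqrt A"
  note S = mat_sqrt_carrier[OF A]
  have "Determinant.det ?S \<noteq> 0"
  proof
    assume "Determinant.det ?S = 0"
    then obtain v where v: "v \<in> carrier_vec p" "v \<noteq> 0\<^sub>v p" "?S *\<^sub>v v = 0\<^sub>v p"
      using det_0_iff_vec_prod_zero[OF S(1)] by blast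
    have "A *\<^sub>v v = ?S *\<^sub>v (?S *\<^sub>v v)"
      using assoc_mult_mat_vec[OF S(1) S(1) v(1)] mat_sqrt(2)[OF A] by simp
    also have "\<dots> = 0\<^sub>v p" unfolding v(3) using S by (intro eq_vecI) auto
    finally have "v \<bullet> (A *\<^sub>v v) = 0" using v(1) by simp
    moreover have "v \<bullet> (A *\<^sub>v v) > 0" using A v by (auto simp: pos_def_mat_def)
    ultimately show False by simp
  qed
  then have "?S \<in> Units (ring_mat TYPE(real) p ())" by (rule det_non_zero_imp_unit[OF S(1)])
  then obtain T where "mat_inverse ?S = Some T" using mat_inverse(1)[OF S(1)] by fastforce
  then have T: "mat_inv_sqrt A = T" "?S * T = 1\<^sub>m p" "T \<in> carrier_mat p p"
    using mat_inverse(2)[OF S(1)] by (auto simp: mat_inv_sqrt_def)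
  have "(T *\<^sub>v w) \<bullet> (?S *\<^sub>v t) = (?S *\<^sub>v (T *\<^sub>v w)) \<bullet> t"
    using transpose_vec_mult_scalar[OF S(1) t, of "T *\<^sub>v w"] S(2) T(3) w by simp
  also have "?S *\<^sub>v (T *\<^sub>v w) = w"
    using assoc_mult_mat_vec[OF S(1) T(3) w] T(2) w by simp
  finally show ?thesis by (simp add: T(1))
qed

section \<open>Symmetrisation and contraction\<close>

text \<open>\<open>x\<close> and \<open>y\<close> are the offsets at the points where the maxima
  with plus and with minus sign are attained; the inequalities \<open>xy\<close> express that
  neither point could replace the other. The maximum on the right permits an exchange of the signs
  of \<open>c\<close> and \<open>d\<close>, which also reduces the claim to
  \<open>0 \<le> c\<close>.\<close>

lemma exp_contraction_two_points:
  fixes x y a b c d :: real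
  assumes "0 \<le> a" "a \<le> \<bar>c\<bar>" "0 \<le> b" "b \<le> \<bar>d\<bar>" "\<bar>a - b\<bar> \<le> \<bar>c - d\<bar>"
    and xy: "y + b \<le> x + a" "x - a \<le> y - b"
  shows "exp (x + a) + exp (y - b) \<le> max (exp (x + c) + exp (y - d)) (exp (x - c) + exp (y + d))"
proof -
  have pos: "exp (x + a) + exp (y - b) \<le> max (exp (x + c) + exp (y - d)) (exp (x - c) + exp (y + d))"
    if "0 \<le> c" "a \<le> c" "b \<le> \<bar>d\<bar>" "\<bar>a - b\<bar> \<le> \<bar>c - d\<bar>" for c d
  proof -
    consider "d \<le> b" | "b < d" "d - b \<le> c - a" | "b < d" "c - a < d - b" by linarith
    then show ?thesis
    proof cases
      case 1
      then have "exp (x + a) + exp (y - b) \<le> exp (x + c) + exp (y - d)"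
        using that by (intro add_mono) auto
      then show ?thesis by simp
    next
      case 2
      \<comment> \<open>The loss in the second exponential is at most the gain in the first:
        \<open>1 - exp (-u) \<le> u \<le> exp u - 1\<close>, and the prefactor at the first point is
        the larger one.\<close>
      have "1 - exp (- (d - b)) \<le> exp (c - a) - 1"
        using exp_ge_add_one_self[of "- (d - b)"] exp_ge_add_one_self[of "c - a"] 2 by linarith
      then have "exp (y - b) * (1 - exp (- (d - b))) \<le> exp (x + a) * (exp (c - a) - 1)"
        using xy assms 2 by (intro mult_mono) auto
      then have "exp (x + a) + exp (y - b) \<le> exp (x + c) + exp (y - d)"
        by (simp add: algebra_simps flip: exp_add)
      then show ?thesis by simp
    next
      case 3
      \<comment> \<open>The signs are exchanged here. \<open>d \<le> c\<close> would contradict the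
        Lipschitz hypothesis, so \<open>a - b \<le> d - c\<close>, that is,
        \<open>a + c \<le> d + b\<close>.\<close>
      have "exp (x - c) * (exp (a + c) - 1) \<le> exp (y - b) * (exp (d + b) - 1)"
        using 3 that assms by (intro mult_mono) auto
      then have "exp (x + a) + exp (y - b) \<le> exp (x - c) + exp (y + d)"
        by (simp add: algebra_simps flip: exp_add)
      then show ?thesis by simp
    qed
  qed
  show ?thesis
  proof (cases "0 \<le> c")
    case True
    then show ?thesis using pos[of c d] assms by simp
  next
    case False
    then show ?thesis using pos[of "- c" "- d"] assms by (simp add: max.commute)
  qed
qed

lemma Max_image_attained:
  assumes "finite T" "T \<noteq> {}"
  shows "\<exists>t\<in>T. (MAX t\<in>T. f t) = f t"
proof -
  have "(MAX t\<in>T. f t) \<in> f ` T" using assms by (intro Max_in) auto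
  then show ?thesis by blast
qed

text \<open>Contraction for a single random sign, averaged over its two values. Only the maximisers
  of the two left-hand maxima matter, which leaves two points. The offsets \<open>a\<close> stand
  for everything that the remaining observations contribute.\<close>

lemma exp_Max_contraction:
  fixes a g v :: "'t \<Rightarrow> real"
  assumes T: "finite T" "T \<noteq> {}"
    and g: "\<And>t. t \<in> T \<Longrightarrow> 0 \<le> g t" "\<And>t. t \<in> T \<Longrightarrow> g t \<le> \<bar>v t\<bar>"
    and lip: "\<And>s t. s \<in> T \<Longrightarrow> t \<in> T \<Longrightarrow> \<bar>g s - g t\<bar> \<le> \<bar>v s - v t\<bar>"
  shows "exp (MAX t\<in>T. a t + g t) + exp (MAX t\<in>T. a t - g t) \<le>
    exp (MAX t\<in>T. a t + v t) + exp (MAX t\<in>T. a t - v t)"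
proof -
  obtain s where s: "s \<in> T" "(MAX t\<in>T. a t + g t) = a s + g s"
    using Max_image_attained[OF T, of "\<lambda>t. a t + g t"] by auto
  obtain u where u: "u \<in> T" "(MAX t\<in>T. a t - g t) = a u - g u"
    using Max_image_attained[OF T, of "\<lambda>t. a t - g t"] by auto
  have le: "f t \<le> (MAX t\<in>T. f t)" if "t \<in> T" for f :: "'t \<Rightarrow> real" and t
    using T that by simp
  have "exp (a s + g s) + exp (a u - g u) \<le>
    max (exp (a s + v s) + exp (a u - v u)) (exp (a s - v s) + exp (a u + v u))"
    using s u g lip[of s u] le[of u "\<lambda>t. a t + g t"] le[of s "\<lambda>t. a t - g t"]
    by (intro exp_contraction_two_points) auto
  also have "\<dots> \<le> exp (MAX t\<in>T. a t + v t) + exp (MAX t\<in>T. a t - v t)"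
    using le[OF s(1), of "\<lambda>t. a t + v t"] le[OF u(1), of "\<lambda>t. a t - v t"]
      le[OF s(1), of "\<lambda>t. a t - v t"] le[OF u(1), of "\<lambda>t. a t + v t"]
    by (auto intro!: add_mono add_mono[of "exp (a s - v s)" _ "exp (a u + v u)", THEN order_trans] simp: add.commute)
  finally show ?thesis using s u by simp
qed

text \<open>Jensen's inequality: the tangent of \<open>exp\<close> at the mean lies below
  \<open>exp\<close> and integrates to \<open>exp\<close> of the mean.\<close>

lemma (in prob_space) exp_expectation_le:
  assumes [measurable]: "f \<in> borel_measurable M" and b: "\<And>z. z \<in> space M \<Longrightarrow> \<bar>f z\<bar> \<le> b"
  shows "ennreal (exp (expectation f)) \<le> (\<integral>\<^sup>+z. ennreal (exp (f z)) \<partial>M)"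
proof -
  define m where "m = expectation f"
  have int: "integrable M f"
    using b by (intro integrable_const_bound[of _ b]) auto
  have iexp: "integrable M (\<lambda>z. exp (f z))"
    using b by (intro integrable_const_bound[of _ "exp b"]) (auto simp: abs_le_iff)
  have "exp m = expectation (\<lambda>z. exp m * (1 + f z - m))"
    using int by (simp add: prob_space m_def)
  also have "\<dots> \<le> expectation (\<lambda>z. exp (f z))"
  proof (intro integral_mono iexp)
    fix z
    have "exp m * (1 + f z - m) \<le> exp m * exp (f z - m)"
      using exp_ge_add_one_self[of "f z - m"] by (intro mult_left_mono) (linarith, simp)
    then show "exp m * (1 + f z - m) \<le> exp (f z)" by (simp flip: exp_add)
  qed (use int in auto)
  finally show ?thesis
    using iexp by (simp add: m_def nn_integral_eq_integral)
qed

text \<open>Convexity of \<open>exp\<close> separates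
  the observation from its ghost copy, so that the random sign only enters through the average.\<close>
lemma (in prob_space) exp_Max_symmetrization:
  fixes a :: "'t \<Rightarrow> real" and g v :: "'t \<Rightarrow> 'a \<Rightarrow> real"
  assumes T: "finite T" "T \<noteq> {}"
    and meas [measurable]: "\<And>t. t \<in> T \<Longrightarrow> g t \<in> borel_measurable M" "\<And>t. t \<in> T \<Longrightarrow> v t \<in> borel_measurable M"
    and bound: "\<And>t z. t \<in> T \<Longrightarrow> z \<in> space M \<Longrightarrow> g t z \<le> b"
    and g: "\<And>t z. t \<in> T \<Longrightarrow> z \<in> space M \<Longrightarrow> 0 \<le> g t z"
      "\<And>t z. t \<in> T \<Longrightarrow> z \<in> space M \<Longrightarrow> g t z \<le> \<bar>v t z\<bar>"
    and lip: "\<And>s t z. s \<in> T \<Longrightarrow> t \<in> T \<Longrightarrow> z \<in> space M \<Longrightarrow> \<bar>g s z - g t z\<bar> \<le> \<bar>v s z - v t z\<bar>"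
  shows "(\<integral>\<^sup>+z. ennreal (exp (MAX t\<in>T. a t + (expectation (g t) - g t z))) \<partial>M) \<le>
    (\<integral>\<^sup>+z. ennreal ((exp (MAX t\<in>T. a t + 2 * v t z) + exp (MAX t\<in>T. a t - 2 * v t z)) / 2) \<partial>M)"
proof -
  define P where "P = (\<lambda>z. exp (MAX t\<in>T. a t + 2 * g t z))"
  define Q where "Q = (\<lambda>z. exp (MAX t\<in>T. a t - 2 * g t z))"
  have [measurable]: "P \<in> borel_measurable M" "Q \<in> borel_measurable M"
    unfolding P_def Q_def using T by measurable
  have pq: "P z \<ge> 0" "Q z \<ge> 0" for z by (auto simp: P_def Q_def)
  have "(\<integral>\<^sup>+z. ennreal (exp (MAX t\<in>T. a t + (expectation (g t) - g t z))) \<partial>M) \<le>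
     (\<integral>\<^sup>+z. (\<integral>\<^sup>+z'. ennreal (P z' / 2) + ennreal (Q z / 2) \<partial>M) \<partial>M)"
  proof (intro nn_integral_mono)
    fix z assume z: "z \<in> space M"
    \<comment> \<open>The maximiser depends on \<open>z\<close> alone, so it can be fixed before the
      ghost copy \<open>z'\<close> is integrated out.\<close>
    obtain t where t: "t \<in> T" "(MAX t\<in>T. a t + (expectation (g t) - g t z)) = a t + (expectation (g t) - g t z)"
      using Max_image_attained[OF T, of "\<lambda>t. a t + (expectation (g t) - g t z)"] by auto
    have int: "integrable M (g t)"
      using bound g t by (intro integrable_const_bound[of _ b]) auto
    have "ennreal (exp (a t + (expectation (g t) - g t z))) =
        ennreal (exp (expectation (\<lambda>z'. a t + (g t z' - g t z))))"
      using int by (simp add: prob_space)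
    also have "\<dots> \<le> (\<integral>\<^sup>+z'. ennreal (exp (a t + (g t z' - g t z))) \<partial>M)"
    proof (rule exp_expectation_le)
      fix z' assume "z' \<in> space M"
      then show "\<bar>a t + (g t z' - g t z)\<bar> \<le> \<bar>a t\<bar> + 2 * b"
        using g(1)[OF t(1)] bound[OF t(1)] z by (smt (verit))
    qed (use t in measurable)
    also have "\<dots> \<le> (\<integral>\<^sup>+z'. ennreal (P z' / 2) + ennreal (Q z / 2) \<partial>M)"
    proof (intro nn_integral_mono)
      fix z'
      \<comment> \<open>By \<open>X Y \<le> (X\<^sup>2 + Y\<^sup>2) / 2\<close> ghost and
        observation are separated at the price of doubling \<open>g\<close>; this is the origin of
        the factor 2 in front of \<open>v\<close>.\<close>
      define X Y where "X = exp ((a t + 2 * g t z') / 2)" and "Y = exp ((a t - 2 * g t z) / 2)"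
      have "exp (a t + (g t z' - g t z)) = X * Y"
        unfolding X_def Y_def exp_add[symmetric] by (simp add: field_simps)
      also have "\<dots> \<le> (X\<^sup>2 + Y\<^sup>2) / 2"
        using sum_squares_bound[of X Y] by simp
      also have "\<dots> = (exp (a t + 2 * g t z') + exp (a t - 2 * g t z)) / 2"
        unfolding X_def Y_def power2_eq_square exp_add[symmetric] by simp
      also have "\<dots> \<le> (P z' + Q z) / 2"
        using T t(1) by (intro divide_right_mono add_mono) (auto simp: P_def Q_def)
      finally show "ennreal (exp (a t + (g t z' - g t z))) \<le> ennreal (P z' / 2) + ennreal (Q z / 2)"
        using pq by (simp flip: ennreal_plus add: add_divide_distrib)
    qed
    finally show "ennreal (exp (MAX t\<in>T. a t + (expectation (g t) - g t z))) \<le>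
        (\<integral>\<^sup>+z'. ennreal (P z' / 2) + ennreal (Q z / 2) \<partial>M)"
      using t by simp
  qed
  also have "\<dots> = (\<integral>\<^sup>+z. ennreal (P z / 2) + ennreal (Q z / 2) \<partial>M)"
    by (simp add: nn_integral_add emeasure_space_1)
  also have "\<dots> \<le> (\<integral>\<^sup>+z. ennreal ((exp (MAX t\<in>T. a t + 2 * v t z) + exp (MAX t\<in>T. a t - 2 * v t z)) / 2) \<partial>M)"
  proof (intro nn_integral_mono)
    fix z assume z: "z \<in> space M"
    have "P z + Q z \<le> exp (MAX t\<in>T. a t + 2 * v t z) + exp (MAX t\<in>T. a t - 2 * v t z)"
      unfolding P_def Q_def
    proof (rule exp_Max_contraction[OF T])
      fix s t assume st: "s \<in> T" "t \<in> T"
      show "0 \<le> 2 * g t z" "2 * g t z \<le> \<bar>2 * v t z\<bar>" using g[OF st(2) z] by simp_all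
      show "\<bar>2 * g s z - 2 * g t z\<bar> \<le> \<bar>2 * v s z - 2 * v t z\<bar>" using lip[OF st z] by linarith
    qed
    then show "ennreal (P z / 2) + ennreal (Q z / 2) \<le>
        ennreal ((exp (MAX t\<in>T. a t + 2 * v t z) + exp (MAX t\<in>T. a t - 2 * v t z)) / 2)"
      using pq by (simp flip: ennreal_plus add_divide_distrib add: divide_right_mono)
  qed
  finally show ?thesis .
qed

text \<open>A linear form on an l1 ball is at most the radius times the largest coefficient in
  modulus. The maximum over coordinates and signs is paid by the sum of all \<open>2p\<close>
  exponentials, grouped into \<open>cosh\<close> terms.\<close>

lemma exp_Max_l1_ball:
  fixes w :: "nat \<Rightarrow> real"
  assumes T: "finite T" "T \<noteq> {}" and l1: "\<And>t. t \<in> T \<Longrightarrow> (\<Sum>j<p. \<bar>t j\<bar>) \<le> l" and p: "p > 0"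
  shows "exp (MAX t\<in>T. \<Sum>j<p. w j * t j) \<le> (\<Sum>j<p. 2 * cosh (l * w j))"
proof -
  obtain t where t: "t \<in> T" "(MAX t\<in>T. \<Sum>j<p. w j * t j) = (\<Sum>j<p. w j * t j)"
    using Max_image_attained[OF T, of "\<lambda>t. \<Sum>j<p. w j * t j"] by auto
  define m where "m = (MAX j\<in>{..<p}. \<bar>w j\<bar>)"
  obtain k where k: "k < p" "m = \<bar>w k\<bar>"
    using Max_image_attained[of "{..<p}" "\<lambda>j. \<bar>w j\<bar>"] p by (auto simp: m_def)
  have m: "\<bar>w j\<bar> \<le> m" if "j < p" for j using that by (simp add: m_def)
  have "m \<ge> 0" using k by simp
  have "(\<Sum>j<p. w j * t j) \<le> (\<Sum>j<p. m * \<bar>t j\<bar>)"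
  proof (intro sum_mono)
    fix j assume "j \<in> {..<p}"
    then show "w j * t j \<le> m * \<bar>t j\<bar>"
      using mult_right_mono[OF m, of j "\<bar>t j\<bar>"] abs_ge_self[of "w j * t j"] by (simp add: abs_mult)
  qed
  also have "\<dots> \<le> m * l"
    using l1[OF t(1)] \<open>m \<ge> 0\<close> by (simp add: mult_left_mono flip: sum_distrib_left)
  finally have "exp (\<Sum>j<p. w j * t j) \<le> exp (l * \<bar>w k\<bar>)" by (simp add: k mult.commute)
  also have "\<dots> \<le> 2 * cosh (l * w k)"
    by (cases "w k \<ge> 0") (auto simp: cosh_def)
  also have "\<dots> \<le> (\<Sum>j<p. 2 * cosh (l * w j))"
    using k by (intro member_le_sum) auto
  finally show ?thesis using t by simp
qed

text \<open>Replacing one observation by its signed linearisation shifts the weight vector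
  \<open>w\<close> by plus or minus \<open>2 u\<close>. The induction on \<open>n\<close> therefore
  runs over all \<open>w\<close>, although only \<open>w = 0\<close> is wanted in the end.\<close>

lemma (in prob_space) exp_Max_empirical_process:
  fixes g :: "(nat \<Rightarrow> real) \<Rightarrow> 'a \<Rightarrow> real" and u :: "nat \<Rightarrow> 'a \<Rightarrow> real" and B :: ennreal and p :: nat
  defines "v \<equiv> \<lambda>t z. \<Sum>j<p. u j z * t j"
  assumes T: "finite T" "T \<noteq> {}" and l1: "\<And>t. t \<in> T \<Longrightarrow> (\<Sum>j<p. \<bar>t j\<bar>) \<le> l" and p: "p > 0"
    and meas [measurable]: "\<And>t. t \<in> T \<Longrightarrow> g t \<in> borel_measurable M" "\<And>j. j < p \<Longrightarrow> u j \<in> borel_measurable M"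
    and bound: "\<And>t z. t \<in> T \<Longrightarrow> z \<in> space M \<Longrightarrow> g t z \<le> b"
    and g: "\<And>t z. t \<in> T \<Longrightarrow> z \<in> space M \<Longrightarrow> 0 \<le> g t z"
      "\<And>t z. t \<in> T \<Longrightarrow> z \<in> space M \<Longrightarrow> g t z \<le> \<bar>v t z\<bar>"
    and lip: "\<And>s t z. s \<in> T \<Longrightarrow> t \<in> T \<Longrightarrow> z \<in> space M \<Longrightarrow> \<bar>g s z - g t z\<bar> \<le> \<bar>v s z - v t z\<bar>"
    and B: "\<And>j. j < p \<Longrightarrow> (\<integral>\<^sup>+z. ennreal (cosh (2 * l * u j z)) \<partial>M) \<le> B"
  shows "(\<integral>\<^sup>+Z. ennreal (exp (MAX t\<in>T. (\<Sum>j<p. w j * t j) + (\<Sum>i<n. expectation (g t) - g t (Z i))))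
      \<partial>(\<Pi>\<^sub>M i\<in>{..<n}. M)) \<le> ennreal (\<Sum>j<p. 2 * cosh (l * w j)) * B ^ n"
proof (induction n arbitrary: w)
  case 0
  have "ennreal (exp (MAX t\<in>T. \<Sum>j<p. w j * t j)) \<le> ennreal (\<Sum>j<p. 2 * cosh (l * w j))"
    by (intro ennreal_leI exp_Max_l1_ball T l1 p)
  moreover have "emeasure (\<Pi>\<^sub>M i\<in>({} :: nat set). M) (space (\<Pi>\<^sub>M i\<in>{}. M)) = 1"
    by (intro prob_space.emeasure_space_1 prob_space_PiM prob_space_axioms)
  ultimately show ?case by simp
next
  case (Suc n)
  interpret product_sigma_finite "\<lambda>_ :: nat. M" by standard
  interpret P: prob_space "\<Pi>\<^sub>M i\<in>{..<n}. M" by (intro prob_space_PiM prob_space_axioms)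
  interpret pair_sigma_finite "\<Pi>\<^sub>M i\<in>{..<n}. M" M ..
  have [measurable]: "v t \<in> borel_measurable M" if "t \<in> T" for t
    unfolding v_def by measurable
  have [measurable]: "(\<lambda>z. cosh (2 * l * u j z)) \<in> borel_measurable M" if "j < p" for j
    using that unfolding cosh_def by measurable
  have half: "ennreal ((x + y) / 2) = ennreal (1/2) * (ennreal x + ennreal y)" if "0 \<le> x" "0 \<le> y" for x y
    using that by (subst ennreal_plus[symmetric], simp, simp, subst ennreal_mult[symmetric]) auto
  define S where "S = (\<lambda>w Z t. (\<Sum>j<p. w j * t j) + (\<Sum>i<n. expectation (g t) - g t (Z i)))"
  have [measurable]: "(\<lambda>Z. S w Z t) \<in> borel_measurable (\<Pi>\<^sub>M i\<in>{..<n}. M)" if "t \<in> T" for w t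
    using that unfolding S_def by measurable
  have "(\<integral>\<^sup>+Z. ennreal (exp (MAX t\<in>T. (\<Sum>j<p. w j * t j) + (\<Sum>i<Suc n. expectation (g t) - g t (Z i))))
      \<partial>(\<Pi>\<^sub>M i\<in>{..<Suc n}. M)) =
    (\<integral>\<^sup>+Z. (\<integral>\<^sup>+z. ennreal (exp (MAX t\<in>T. (\<Sum>j<p. w j * t j) + (\<Sum>i<Suc n. expectation (g t) - g t ((Z(n := z)) i)))) \<partial>M)
      \<partial>(\<Pi>\<^sub>M i\<in>{..<n}. M))"
    unfolding lessThan_Suc
    using T by (intro product_nn_integral_insert) (auto simp flip: lessThan_Suc)
  also have "\<dots> = (\<integral>\<^sup>+Z. (\<integral>\<^sup>+z. ennreal (exp (MAX t\<in>T. S w Z t + (expectation (g t) - g t z))) \<partial>M)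
      \<partial>(\<Pi>\<^sub>M i\<in>{..<n}. M))"
    by (simp add: S_def add.assoc)
  also have "\<dots> \<le> (\<integral>\<^sup>+Z. (\<integral>\<^sup>+z. ennreal ((exp (MAX t\<in>T. S w Z t + 2 * v t z) +
      exp (MAX t\<in>T. S w Z t - 2 * v t z)) / 2) \<partial>M) \<partial>(\<Pi>\<^sub>M i\<in>{..<n}. M))"
    using g lip by (intro nn_integral_mono exp_Max_symmetrization[OF T _ _ bound]) auto
  \<comment> \<open>The order of integration is exchanged because for fixed \<open>z\<close> the
    shift of \<open>w\<close> is a constant, and the induction hypothesis applies to the integral
    over \<open>Z\<close>.\<close>
  also have "\<dots> = (\<integral>\<^sup>+z. (\<integral>\<^sup>+Z. ennreal ((exp (MAX t\<in>T. S w Z t + 2 * v t z) +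
      exp (MAX t\<in>T. S w Z t - 2 * v t z)) / 2) \<partial>(\<Pi>\<^sub>M i\<in>{..<n}. M)) \<partial>M)"
    using T by (intro Fubini'[symmetric]) measurable
  also have "\<dots> \<le> (\<integral>\<^sup>+z. ennreal (\<Sum>j<p. 2 * cosh (l * w j) * cosh (2 * l * u j z)) * B ^ n \<partial>M)"
  proof (intro nn_integral_mono)
    fix z
    have S: "S w Z t + 2 * v t z = S (\<lambda>j. w j + 2 * u j z) Z t"
      "S w Z t - 2 * v t z = S (\<lambda>j. w j - 2 * u j z) Z t" for Z t
      by (simp_all add: S_def v_def sum_distrib_left algebra_simps sum.distrib sum_subtractf)
    define c d where "c = (\<Sum>j<p. 2 * cosh (l * (w j + 2 * u j z)))" and "d = (\<Sum>j<p. 2 * cosh (l * (w j - 2 * u j z)))"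
    have cd: "0 \<le> c" "0 \<le> d" unfolding c_def d_def by (auto intro!: sum_nonneg)
    have "(\<integral>\<^sup>+Z. ennreal ((exp (MAX t\<in>T. S w Z t + 2 * v t z) +
      exp (MAX t\<in>T. S w Z t - 2 * v t z)) / 2) \<partial>(\<Pi>\<^sub>M i\<in>{..<n}. M)) =
      (\<integral>\<^sup>+Z. ennreal (1/2) * (ennreal (exp (MAX t\<in>T. S (\<lambda>j. w j + 2 * u j z) Z t)) +
        ennreal (exp (MAX t\<in>T. S (\<lambda>j. w j - 2 * u j z) Z t))) \<partial>(\<Pi>\<^sub>M i\<in>{..<n}. M))"
      unfolding S by (intro nn_integral_cong half) auto
    also have "\<dots> = ennreal (1/2) * ((\<integral>\<^sup>+Z. ennreal (exp (MAX t\<in>T. S (\<lambda>j. w j + 2 * u j z) Z t)) \<partial>(\<Pi>\<^sub>M i\<in>{..<n}. M)) +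
        (\<integral>\<^sup>+Z. ennreal (exp (MAX t\<in>T. S (\<lambda>j. w j - 2 * u j z) Z t)) \<partial>(\<Pi>\<^sub>M i\<in>{..<n}. M)))"
      using T by (subst nn_integral_cmult) (measurable, subst nn_integral_add, measurable)
    also have "\<dots> \<le> ennreal (1/2) * (ennreal c * B ^ n + ennreal d * B ^ n)"
      unfolding S_def c_def d_def by (intro mult_left_mono add_mono Suc) auto
    also have "\<dots> = ennreal ((c + d) / 2) * B ^ n"
      unfolding half[OF cd] by (simp only: distrib_right mult.assoc)
    \<comment> \<open>The \<open>sinh\<close> terms cancel in the average, so each coordinate only
      picks up the even factor \<open>cosh (2 l u)\<close>.\<close>
    also have "(c + d) / 2 = (\<Sum>j<p. 2 * cosh (l * w j) * cosh (2 * l * u j z))"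
      unfolding c_def d_def sum.distrib[symmetric] sum_divide_distrib
      by (intro sum.cong refl) (simp add: cosh_add cosh_diff algebra_simps)
    finally show "(\<integral>\<^sup>+Z. ennreal ((exp (MAX t\<in>T. S w Z t + 2 * v t z) +
      exp (MAX t\<in>T. S w Z t - 2 * v t z)) / 2) \<partial>(\<Pi>\<^sub>M i\<in>{..<n}. M)) \<le>
      ennreal (\<Sum>j<p. 2 * cosh (l * w j) * cosh (2 * l * u j z)) * B ^ n" .
  qed
  also have "\<dots> = (\<integral>\<^sup>+z. (\<Sum>j<p. ennreal (2 * cosh (l * w j)) * ennreal (cosh (2 * l * u j z))) \<partial>M) * B ^ n"
    by (subst nn_integral_multc, measurable) (simp flip: sum_ennreal ennreal_mult)
  also have "\<dots> = (\<Sum>j<p. ennreal (2 * cosh (l * w j)) * (\<integral>\<^sup>+z. ennreal (cosh (2 * l * u j z)) \<partial>M)) * B ^ n"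
    by (subst nn_integral_sum) (auto simp: nn_integral_cmult)
  also have "\<dots> \<le> (\<Sum>j<p. ennreal (2 * cosh (l * w j)) * B) * B ^ n"
    by (intro mult_right_mono sum_mono mult_left_mono B) auto
  also have "\<dots> = ennreal (\<Sum>j<p. 2 * cosh (l * w j)) * B ^ Suc n"
    unfolding sum_distrib_right[symmetric] by (subst sum_ennreal) (auto simp: mult.assoc)
  finally show ?case .
qed

section \<open>Sub-exponential moments\<close>

text \<open>Sharp enough for the numerics of the fourth moment below; \<open>145 / 128\<close> is
  \<open>1 + x + x\<^sup>2 / 2\<close> at \<open>x = 1 / 8\<close>.\<close>

lemma exp_one_ge: "27 / 10 \<le> exp (1 :: real)"
proof -
  have "(27 / 10 :: real) \<le> (145 / 128) ^ 8" by (simp add: power_divide)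
  also have "\<dots> \<le> exp (1 / 8) ^ 8"
    using exp_lower_Taylor_quadratic[of "1 / 8 :: real"] by (intro power_mono) (simp_all add: power2_eq_square)
  also have "\<dots> = exp 1" by (simp flip: exp_of_nat_mult)
  finally show ?thesis .
qed

text \<open>A sum over unit slabs in place of the layer-cake integral: where \<open>U\<close> lies
  between \<open>m + k\<close> and \<open>m + k + 1\<close>, \<open>F\<close> is taken at the right
  end and the tail bound at the left end.\<close>

lemma (in prob_space) nn_integral_tail_sum:
  fixes U :: "'a \<Rightarrow> real" and F :: "real \<Rightarrow> real"
  assumes [measurable]: "U \<in> borel_measurable M"
    and tail: "\<And>t. 0 \<le> t \<Longrightarrow> prob {\<omega> \<in> space M. t \<le> U \<omega>} \<le> 2 * exp (- t)"
    and F: "\<And>a b. real m \<le> a \<Longrightarrow> a \<le> b \<Longrightarrow> F a \<le> F b"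
  shows "(\<integral>\<^sup>+\<omega>. ennreal (F (U \<omega>)) * indicator {\<omega>. m \<le> U \<omega>} \<omega> \<partial>M) \<le>
    (\<Sum>k. ennreal (F (real m + k + 1) * (2 * exp (- real (m + k)))))"
proof -
  define A where "A = (\<lambda>k. {\<omega> \<in> space M. real (m + k) \<le> U \<omega>})"
  have [measurable]: "A k \<in> sets M" for k unfolding A_def by measurable
  have "(\<integral>\<^sup>+\<omega>. ennreal (F (U \<omega>)) * indicator {\<omega>. m \<le> U \<omega>} \<omega> \<partial>M) \<le>
      (\<integral>\<^sup>+\<omega>. (\<Sum>k. ennreal (F (real m + k + 1)) * indicator (A k) \<omega>) \<partial>M)"
  proof (intro nn_integral_mono)
    fix \<omega> assume \<omega>: "\<omega> \<in> space M"
    show "ennreal (F (U \<omega>)) * indicator {\<omega>. m \<le> U \<omega>} \<omega> \<le> (\<Sum>k. ennreal (F (real m + k + 1)) * indicator (A k) \<omega>)"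
    proof (cases "real m \<le> U \<omega>")
      case True
      define k where "k = nat \<lfloor>U \<omega> - m\<rfloor>"
      have k: "m + k \<le> U \<omega>" "U \<omega> \<le> m + k + 1" using True unfolding k_def by linarith+
      define f where "f = (\<lambda>i. ennreal (F (real m + i + 1)) * indicator (A i) \<omega>)"
      have "ennreal (F (U \<omega>)) * indicator {\<omega>. m \<le> U \<omega>} \<omega> \<le> f k"
        using k True \<omega> by (auto simp: A_def f_def intro!: ennreal_leI F)
      also have "f k = sum f {k}" by simp
      also have "\<dots> \<le> suminf f" by (intro sum_le_suminf) auto
      finally show ?thesis by (simp only: f_def)
    qed simp
  qed
  also have "\<dots> = (\<Sum>k. ennreal (F (real m + k + 1)) * emeasure M (A k))"
    by (subst nn_integral_suminf) (auto simp: nn_integral_cmult_indicator)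
  also have "\<dots> \<le> (\<Sum>k. ennreal (F (real m + k + 1) * (2 * exp (- real (m + k)))))"
  proof (intro suminf_le allI)
    fix k
    have "emeasure M (A k) \<le> ennreal (2 * exp (- real (m + k)))"
      using tail[of "real (m + k)"] by (simp add: A_def emeasure_eq_measure ennreal_leI)
    then have "ennreal (F (real m + k + 1)) * emeasure M (A k) \<le> ennreal (F (real m + k + 1)) * ennreal (2 * exp (- real (m + k)))"
      by (intro mult_left_mono) auto
    then show "ennreal (F (real m + k + 1)) * emeasure M (A k) \<le> ennreal (F (real m + k + 1) * (2 * exp (- real (m + k))))"
      by (simp add: ennreal_mult'')
  qed auto
  finally show ?thesis .
qed

lemma suminf_ennreal_le_geometric:
  fixes a :: "nat \<Rightarrow> real"
  assumes "\<And>k. a k \<le> c * q ^ k" "0 \<le> c" "0 \<le> q" "q < 1"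
  shows "(\<Sum>k. ennreal (a k)) \<le> ennreal (c / (1 - q))"
proof -
  have "(\<Sum>k. ennreal (a k)) \<le> (\<Sum>k. ennreal (c * q ^ k))"
    using assms by (intro suminf_le allI ennreal_leI) auto
  also have "\<dots> = ennreal (c / (1 - q))"
    using sums_mult[OF geometric_sums[of q], of c] assms by (intro suminf_ennreal_eq) auto
  finally show ?thesis .
qed

lemma (in prob_space) subexp_exp_moment:
  fixes U :: "'a \<Rightarrow> real"
  assumes [measurable]: "U \<in> borel_measurable M" and "\<And>\<omega>. \<omega> \<in> space M \<Longrightarrow> 0 \<le> U \<omega>"
    and tail: "\<And>t. 0 \<le> t \<Longrightarrow> prob {\<omega> \<in> space M. t \<le> U \<omega>} \<le> 2 * exp (- t)"
  shows "(\<integral>\<^sup>+\<omega>. ennreal (exp (U \<omega> / 2)) \<partial>M) \<le> 12"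
proof -
  have e: "exp (1 / 2 :: real) \<le> 2"
  proof (rule power2_le_imp_le)
    show "(exp (1 / 2 :: real))\<^sup>2 \<le> 2\<^sup>2" using exp_le by (simp flip: exp_of_nat_mult)
  qed simp
  have q: "exp (- (1 / 2) :: real) \<le> 2 / 3"
    using exp_ge_add_one_self[of "1 / 2 :: real"] by (simp add: exp_minus field_simps)
  have "(\<integral>\<^sup>+\<omega>. ennreal (exp (U \<omega> / 2)) \<partial>M) =
      (\<integral>\<^sup>+\<omega>. ennreal (exp (U \<omega> / 2)) * indicator {\<omega>. real 0 \<le> U \<omega>} \<omega> \<partial>M)"
    using assms by (intro nn_integral_cong) auto
  also have "\<dots> \<le> (\<Sum>k. ennreal (exp ((real 0 + k + 1) / 2) * (2 * exp (- real (0 + k)))))"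
    by (rule nn_integral_tail_sum[where F = "\<lambda>u. exp (u / 2)", OF _ tail]) auto
  \<comment> \<open>The ratio of the terms is \<open>exp (-1/2) \<le> 2/3\<close>, and the leading
    factor is \<open>2 * exp (1/2) \<le> 4\<close>.\<close>
  also have "\<dots> \<le> ennreal (4 / (1 - 2 / 3))"
  proof (rule suminf_ennreal_le_geometric)
    fix k :: nat
    have "exp ((real 0 + k + 1) / 2) * (2 * exp (- real (0 + k))) = 2 * (exp (1 / 2) * exp (- (1 / 2)) ^ k)"
      by (simp add: field_simps flip: exp_add exp_of_nat_mult)
    also have "\<dots> \<le> 2 * (2 * (2 / 3) ^ k)"
      by (intro mult_left_mono mult_mono power_mono e q) auto
    finally show "exp ((real 0 + k + 1) / 2) * (2 * exp (- real (0 + k))) \<le> 4 * (2 / 3) ^ k" by simp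
  qed auto
  finally show ?thesis by simp
qed

lemma (in prob_space) subexp_fourth_moment_tail:
  fixes U :: "'a \<Rightarrow> real"
  assumes [measurable]: "U \<in> borel_measurable M"
    and tail: "\<And>t. 0 \<le> t \<Longrightarrow> prob {\<omega> \<in> space M. t \<le> U \<omega>} \<le> 2 * exp (- t)"
  shows "(\<integral>\<^sup>+\<omega>. ennreal (U \<omega> ^ 4) * indicator {\<omega>. 8 \<le> U \<omega>} \<omega> \<partial>M) \<le> 16"
proof -
  have "(\<integral>\<^sup>+\<omega>. ennreal (U \<omega> ^ 4) * indicator {\<omega>. real 8 \<le> U \<omega>} \<omega> \<partial>M) \<le>
    (\<Sum>k. ennreal ((real 8 + k + 1) ^ 4 * (2 * exp (- real (8 + k)))))"
    by (rule nn_integral_tail_sum[where F = "\<lambda>u. u ^ 4", OF _ tail]) (auto intro: power_mono)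
  \<comment> \<open>The first term is \<open>2 * 9^4 * exp (-8) \<le> 5\<close>, and successive
    ratios are at most \<open>(10/9)^4 / exp 1 \<le> 3/5\<close>.\<close>
  also have "\<dots> \<le> ennreal (5 / (1 - 3 / 5))"
  proof (rule suminf_ennreal_le_geometric)
    fix k :: nat
    show "(real 8 + k + 1) ^ 4 * (2 * exp (- real (8 + k))) \<le> 5 * (3 / 5) ^ k"
    proof (induction k)
      case 0
      have "(27 / 10) ^ 8 \<le> exp (1 :: real) ^ 8" by (intro power_mono exp_one_ge) auto
      also have "\<dots> = exp 8" by (simp flip: exp_of_nat_mult)
      finally have "2 * 9 ^ 4 \<le> 5 * exp (8 :: real)" by (simp add: power_divide)
      then show ?case by (simp add: exp_minus field_simps)
    next
      case (Suc k)
      have "real 8 + Suc k + 1 \<le> 10 / 9 * (real 8 + k + 1)" by simp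
      then have "(real 8 + Suc k + 1) ^ 4 \<le> (10 / 9 * (real 8 + k + 1)) ^ 4" by (intro power_mono) auto
      also have "\<dots> \<le> (3 / 5 * (27 / 10)) * (real 8 + k + 1) ^ 4"
        unfolding power_mult_distrib by (intro mult_right_mono) (auto simp: power_divide)
      also have "\<dots> \<le> (3 / 5 * exp 1) * (real 8 + k + 1) ^ 4"
        by (intro mult_right_mono mult_left_mono exp_one_ge) auto
      finally have "(real 8 + Suc k + 1) ^ 4 * (2 * exp (- real (8 + Suc k))) \<le>
          (3 / 5 * exp 1) * (real 8 + k + 1) ^ 4 * (2 * exp (- real (8 + Suc k)))"
        by (intro mult_right_mono) auto
      also have "\<dots> = 3 / 5 * ((real 8 + k + 1) ^ 4 * (2 * (exp 1 * exp (- real (8 + Suc k)))))" by simp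
      also have "exp 1 * exp (- real (8 + Suc k)) = exp (- real (8 + k))"
        by (simp flip: exp_add)
      also have "3 / 5 * ((real 8 + k + 1) ^ 4 * (2 * exp (- real (8 + k)))) \<le> 3 / 5 * (5 * (3 / 5) ^ k)"
        by (intro mult_left_mono Suc) auto
      finally show ?case by simp
    qed
  qed auto
  \<comment> \<open>The sum is 12.5; the rounded value 16 becomes \<open>1/4\<close> once a factor
    \<open>1/64\<close> is gained from the threshold 8.\<close>
  also have "\<dots> \<le> 16" by (simp add: ennreal_leI flip: ennreal_numeral)
  finally show ?thesis by simp
qed

text \<open>\<open>cosh x - 1 \<le> x\<^sup>2 exp x / 2\<close> keeps the factor
  \<open>\<theta>\<^sup>2\<close>. As \<open>x \<le> y/4\<close>, one \<open>exp (y/4)\<close> pays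
  for \<open>exp x\<close> and another for \<open>y\<^sup>2 \<le> 32 exp (y/4)\<close>; together
  they make the moment \<open>exp (y/2)\<close>, which a sub-exponential tail allows.\<close>

lemma cosh_minus_one_le:
  fixes \<theta> y :: real
  assumes "0 \<le> y" "0 \<le> \<theta>" "\<theta> \<le> 1 / 4"
  shows "cosh (\<theta> * y) - 1 \<le> 16 * \<theta>\<^sup>2 * exp (y / 2)"
proof -
  define x where "x = \<theta> * y"
  have x: "0 \<le> x" "x \<le> y / 4" using assms mult_right_mono[of \<theta> "1 / 4" y] by (auto simp: x_def)
  \<comment> \<open>With the halved exponent, \<open>2 (cosh x - 1)\<close> is the perfect square
    \<open>(u - 1/u)\<^sup>2\<close>.\<close>
  define u where "u = exp (x / 2)"
  have u: "u > 0" "exp x = u\<^sup>2" "exp (- x) = 1 / u\<^sup>2"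
    by (simp_all add: u_def exp_minus field_simps flip: exp_of_nat_mult)
  have "1 - exp (- x) \<le> x" using exp_ge_add_one_self[of "- x"] by simp
  then have "u * (1 - exp (- x)) \<le> u * x" using u by (intro mult_left_mono) auto
  then have d: "u - 1 / u \<le> u * x" using u by (simp add: right_diff_distrib power2_eq_square)
  have "0 \<le> u - 1 / u"
  proof -
    have "1 \<le> u" using x by (simp add: u_def)
    then have "1 / u \<le> 1" by simp
    with \<open>1 \<le> u\<close> show ?thesis by linarith
  qed
  with d have "(u - 1 / u)\<^sup>2 \<le> (u * x)\<^sup>2" by (intro power_mono)
  moreover have "2 * (cosh x - 1) = (u - 1 / u)\<^sup>2"
    using u by (simp add: cosh_def power2_eq_square field_simps)
  moreover have "(u * x)\<^sup>2 = x\<^sup>2 * exp x"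
    using u by (simp add: power_mult_distrib mult.commute)
  ultimately have "cosh x - 1 \<le> x\<^sup>2 / 2 * exp x" by simp
  also have "\<dots> \<le> x\<^sup>2 / 2 * exp (y / 4)" using x by (intro mult_left_mono) auto
  also have "\<dots> = \<theta>\<^sup>2 / 2 * y\<^sup>2 * exp (y / 4)" by (simp add: x_def power_mult_distrib)
  also have "\<dots> \<le> \<theta>\<^sup>2 / 2 * (32 * exp (y / 4)) * exp (y / 4)"
    using exp_lower_Taylor_quadratic[of "y / 4"] assms
    by (intro mult_right_mono mult_left_mono) (auto simp: power2_eq_square)
  also have "\<dots> = 16 * \<theta>\<^sup>2 * exp (y / 2)" by (simp flip: exp_add)
  finally show ?thesis by (simp add: x_def)
qed

text \<open>Only the excess over 1 is bounded, with \<open>192 = 16 * 12\<close>: later an indicator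
  of small probability multiplies this excess but not the 1.\<close>

lemma (in prob_space) subexp_cosh_moment:
  fixes V :: "'a \<Rightarrow> real"
  assumes [measurable]: "V \<in> borel_measurable M" and s: "s > 0"
    and tail: "\<And>t. 0 \<le> t \<Longrightarrow> prob {\<omega> \<in> space M. s * t \<le> \<bar>V \<omega>\<bar>} \<le> 2 * exp (- t)"
    and c: "0 \<le> c" "c * s \<le> 1 / 4"
  shows "(\<integral>\<^sup>+\<omega>. ennreal (cosh (c * V \<omega>) - 1) \<partial>M) \<le> ennreal (192 * (c * s)\<^sup>2)"
proof -
  define U where "U = (\<lambda>\<omega>. \<bar>V \<omega>\<bar> / s)"
  have [measurable]: "U \<in> borel_measurable M" unfolding U_def by measurable
  have U: "0 \<le> U \<omega>" "\<bar>V \<omega>\<bar> = s * U \<omega>" for \<omega> using s by (simp_all add: U_def)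
  have "(\<integral>\<^sup>+\<omega>. ennreal (cosh (c * V \<omega>) - 1) \<partial>M) \<le> (\<integral>\<^sup>+\<omega>. ennreal (16 * (c * s)\<^sup>2) * ennreal (exp (U \<omega> / 2)) \<partial>M)"
  proof (intro nn_integral_mono)
    fix \<omega>
    have "cosh (c * V \<omega>) = cosh \<bar>c * V \<omega>\<bar>" by (cases "c * V \<omega> \<ge> 0") auto
    also have "\<bar>c * V \<omega>\<bar> = c * s * U \<omega>" using c U[of \<omega>] by (simp add: abs_mult)
    finally have eq: "cosh (c * V \<omega>) = cosh (c * s * U \<omega>)" .
    have "cosh (c * V \<omega>) - 1 \<le> 16 * (c * s)\<^sup>2 * exp (U \<omega> / 2)"
      unfolding eq using c s by (intro cosh_minus_one_le U(1)) auto
    then show "ennreal (cosh (c * V \<omega>) - 1) \<le> ennreal (16 * (c * s)\<^sup>2) * ennreal (exp (U \<omega> / 2))"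
      by (simp flip: ennreal_mult add: ennreal_leI)
  qed
  also have "\<dots> = ennreal (16 * (c * s)\<^sup>2) * (\<integral>\<^sup>+\<omega>. ennreal (exp (U \<omega> / 2)) \<partial>M)"
    by (intro nn_integral_cmult) measurable
  also have "\<dots> \<le> ennreal (16 * (c * s)\<^sup>2) * 12"
  proof (intro mult_left_mono subexp_exp_moment)
    fix t :: real assume "0 \<le> t"
    then show "prob {\<omega> \<in> space M. t \<le> U \<omega>} \<le> 2 * exp (- t)"
      using tail[of t] s by (simp add: U_def pos_le_divide_eq mult.commute)
  qed (auto simp: U)
  also have "\<dots> = ennreal (192 * (c * s)\<^sup>2)"
    by (simp flip: ennreal_mult ennreal_numeral)
  finally show ?thesis .
qed

text \<open>The threshold is \<open>8 s\<^sup>2\<close> rather than \<open>8 s\<close>, so that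
  \<open>U = |V| / s\<close> is at least \<open>8 s\<close> there and the factor
  \<open>s\<^sup>2\<close> of \<open>V\<^sup>2 = s\<^sup>2 U\<^sup>2\<close> is absorbed into
  \<open>U\<^sup>2 / 64\<close>.\<close>

lemma (in prob_space) subexp_second_moment_tail:
  fixes V :: "'a \<Rightarrow> real"
  assumes [measurable]: "V \<in> borel_measurable M" and s: "s \<ge> 1"
    and tail: "\<And>t. 0 \<le> t \<Longrightarrow> prob {\<omega> \<in> space M. s * t \<le> \<bar>V \<omega>\<bar>} \<le> 2 * exp (- t)"
  shows "(\<integral>\<^sup>+\<omega>. ennreal ((V \<omega>)\<^sup>2) * indicator {\<omega>. 8 * s\<^sup>2 \<le> \<bar>V \<omega>\<bar>} \<omega> \<partial>M) \<le> ennreal (1 / 4)"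
proof -
  define U where "U = (\<lambda>\<omega>. \<bar>V \<omega>\<bar> / s)"
  have [measurable]: "U \<in> borel_measurable M" unfolding U_def by measurable
  have U: "0 \<le> U \<omega>" "\<bar>V \<omega>\<bar> = s * U \<omega>" for \<omega> using s by (simp_all add: U_def)
  have "(\<integral>\<^sup>+\<omega>. ennreal ((V \<omega>)\<^sup>2) * indicator {\<omega>. 8 * s\<^sup>2 \<le> \<bar>V \<omega>\<bar>} \<omega> \<partial>M) \<le>
      (\<integral>\<^sup>+\<omega>. ennreal (1 / 64) * (ennreal (U \<omega> ^ 4) * indicator {\<omega>. 8 \<le> U \<omega>} \<omega>) \<partial>M)"
  proof (intro nn_integral_mono)
    fix \<omega>
    show "ennreal ((V \<omega>)\<^sup>2) * indicator {\<omega>. 8 * s\<^sup>2 \<le> \<bar>V \<omega>\<bar>} \<omega> \<le>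
        ennreal (1 / 64) * (ennreal (U \<omega> ^ 4) * indicator {\<omega>. 8 \<le> U \<omega>} \<omega>)"
    proof (cases "8 * s\<^sup>2 \<le> \<bar>V \<omega>\<bar>")
      case True
      then have 8: "8 * s \<le> U \<omega>" using s by (simp add: U_def field_simps power2_eq_square)
      then have "8 \<le> U \<omega>" using s by linarith
      have "(V \<omega>)\<^sup>2 = s\<^sup>2 * (U \<omega>)\<^sup>2" using U(2)[of \<omega>] by (metis power2_abs power_mult_distrib)
      also have "\<dots> \<le> ((U \<omega>)\<^sup>2 / 64) * (U \<omega>)\<^sup>2"
        using power_mono[OF 8, of 2] s by (intro mult_right_mono) (auto simp: power_mult_distrib)
      also have "\<dots> = 1 / 64 * U \<omega> ^ 4" by (simp add: power4_eq_xxxx power2_eq_square)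
      finally have "(V \<omega>)\<^sup>2 \<le> 1 / 64 * U \<omega> ^ 4" .
      then have "ennreal ((V \<omega>)\<^sup>2) \<le> ennreal (1 / 64) * ennreal (U \<omega> ^ 4)"
        using U[of \<omega>] by (subst ennreal_mult[symmetric]) (auto intro: ennreal_leI)
      then show ?thesis using True \<open>8 \<le> U \<omega>\<close> by simp
    qed simp
  qed
  also have "\<dots> = ennreal (1 / 64) * (\<integral>\<^sup>+\<omega>. ennreal (U \<omega> ^ 4) * indicator {\<omega>. 8 \<le> U \<omega>} \<omega> \<partial>M)"
    by (intro nn_integral_cmult) measurable
  also have "\<dots> \<le> ennreal (1 / 64) * 16"
  proof (intro mult_left_mono subexp_fourth_moment_tail)
    fix t :: real assume "0 \<le> t"
    then show "prob {\<omega> \<in> space M. t \<le> U \<omega>} \<le> 2 * exp (- t)"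
      using tail[of t] s by (simp add: U_def pos_le_divide_eq mult.commute)
  qed auto
  also have "\<dots> = ennreal (1 / 4)"
    by (subst ennreal_numeral[symmetric], subst ennreal_mult[symmetric]) auto
  finally show ?thesis .
qed

text \<open>The slope 4 puts the corner at \<open>\<bar>u\<bar> = 4R/5\<close>. For \<open>R \<ge> 10\<upsilon>\<^sup>2\<close> this is at least \<open>8\<upsilon>\<^sup>2\<close>, where the tail
  of the second moment has dropped below \<open>1/4\<close>; a corner at \<open>R/2\<close> would be too small for the tail
  bound \<open>2e\<^bsup>-t\<^esup>\<close> with its factor 2.\<close>

definition truncated_square :: "real \<Rightarrow> real \<Rightarrow> real" where
  "truncated_square R u = (max 0 (min \<bar>u\<bar> (4 * (R - \<bar>u\<bar>))))\<^sup>2"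

lemma truncated_square_measurable [measurable]: "truncated_square R \<in> borel_measurable borel"
  unfolding truncated_square_def by measurable

lemma truncated_square_nonneg: "0 \<le> truncated_square R u"
  by (simp add: truncated_square_def)

lemma truncated_square_le: "truncated_square R u \<le> of_bool (\<bar>u\<bar> \<le> R) * u\<^sup>2"
proof (cases "\<bar>u\<bar> \<le> R")
  case True
  have "(max 0 (min \<bar>u\<bar> (4 * (R - \<bar>u\<bar>))))\<^sup>2 \<le> \<bar>u\<bar>\<^sup>2" by (intro power_mono) auto
  then show ?thesis using True by (simp add: truncated_square_def)
qed (simp add: truncated_square_def)

lemma truncated_square_eq:
  assumes "\<bar>u\<bar> \<le> 4 / 5 * R"
  shows "truncated_square R u = u\<^sup>2"
proof -
  have "max 0 (min \<bar>u\<bar> (4 * (R - \<bar>u\<bar>))) = \<bar>u\<bar>" using assms by auto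
  then show ?thesis by (simp add: truncated_square_def)
qed

text \<open>The function being squared has slope at most 4 and values in \<open>[0, R]\<close>; the
  difference of squares then gives \<open>4 * 2R\<close>.\<close>

lemma truncated_square_lipschitz:
  assumes "0 \<le> R"
  shows "\<bar>truncated_square R a - truncated_square R b\<bar> \<le> 8 * R * \<bar>a - b\<bar>"
proof -
  define \<psi> where "\<psi> = (\<lambda>u. max 0 (min \<bar>u\<bar> (4 * (R - \<bar>u\<bar>))))"
  have b: "0 \<le> \<psi> u" "\<psi> u \<le> R" for u using assms by (auto simp: \<psi>_def)
  have l: "\<bar>\<psi> a - \<psi> b\<bar> \<le> 4 * \<bar>a - b\<bar>" unfolding \<psi>_def by (smt (verit))
  have "\<bar>truncated_square R a - truncated_square R b\<bar> = \<bar>\<psi> a - \<psi> b\<bar> * \<bar>\<psi> a + \<psi> b\<bar>"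
  proof -
    have "truncated_square R u = (\<psi> u)\<^sup>2" for u by (simp add: truncated_square_def \<psi>_def)
    then have "truncated_square R a - truncated_square R b = (\<psi> a - \<psi> b) * (\<psi> a + \<psi> b)"
      by (simp only: power2_eq_square square_diff_square_factored mult.commute)
    then show ?thesis by (simp only: abs_mult)
  qed
  also have "\<dots> \<le> (4 * \<bar>a - b\<bar>) * (2 * R)"
    using b[of a] b[of b] by (intro mult_mono l) auto
  finally show ?thesis by (simp add: mult_ac)
qed

lemma truncated_square_le_linear:
  assumes "0 \<le> R"
  shows "truncated_square R u \<le> 8 * R * \<bar>u\<bar>"
  using truncated_square_lipschitz[OF assms, of u 0] assms by (simp add: truncated_square_def)

lemma truncated_square_le_bound:
  assumes "0 \<le> R"
  shows "truncated_square R u \<le> R\<^sup>2"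
  unfolding truncated_square_def using assms by (intro power_mono) auto

text \<open>Below \<open>8 s\<^sup>2 \<le> 4R/5\<close> the truncation is inactive, so of the second
  moment 1 at most the part beyond that threshold is lost.\<close>

lemma (in prob_space) truncated_square_expectation_ge:
  fixes V :: "'a \<Rightarrow> real"
  assumes V [measurable]: "V \<in> borel_measurable M" and s: "s \<ge> 1"
    and tail: "\<And>t. 0 \<le> t \<Longrightarrow> prob {\<omega> \<in> space M. s * t \<le> \<bar>V \<omega>\<bar>} \<le> 2 * exp (- t)"
    and R: "10 * s\<^sup>2 \<le> R" and one: "(\<integral>\<^sup>+\<omega>. ennreal ((V \<omega>)\<^sup>2) \<partial>M) = 1"
  shows "ennreal (3 / 4) \<le> (\<integral>\<^sup>+\<omega>. ennreal (truncated_square R (V \<omega>)) \<partial>M)"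
proof -
  define I where "I = (\<integral>\<^sup>+\<omega>. ennreal (truncated_square R (V \<omega>)) \<partial>M)"
  have "1 \<le> (\<integral>\<^sup>+\<omega>. ennreal (truncated_square R (V \<omega>)) + ennreal ((V \<omega>)\<^sup>2) * indicator {\<omega>. 8 * s\<^sup>2 \<le> \<bar>V \<omega>\<bar>} \<omega> \<partial>M)"
    unfolding one[symmetric]
  proof (intro nn_integral_mono)
    fix \<omega>
    show "ennreal ((V \<omega>)\<^sup>2) \<le> ennreal (truncated_square R (V \<omega>)) + ennreal ((V \<omega>)\<^sup>2) * indicator {\<omega>. 8 * s\<^sup>2 \<le> \<bar>V \<omega>\<bar>} \<omega>"
      using R by (cases "8 * s\<^sup>2 \<le> \<bar>V \<omega>\<bar>") (auto simp: truncated_square_eq)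
  qed
  also have "\<dots> = I + (\<integral>\<^sup>+\<omega>. ennreal ((V \<omega>)\<^sup>2) * indicator {\<omega>. 8 * s\<^sup>2 \<le> \<bar>V \<omega>\<bar>} \<omega> \<partial>M)"
    unfolding I_def by (intro nn_integral_add) measurable
  also have "\<dots> \<le> I + ennreal (1 / 4)"
    by (intro add_left_mono subexp_second_moment_tail V s tail)
  finally have le: "1 \<le> I + ennreal (1 / 4)" .
  show ?thesis
  proof (cases I rule: ennreal_cases)
    case (real x)
    with le have "ennreal 1 \<le> ennreal (x + 1 / 4)" by (simp add: ennreal_plus)
    then have "3 / 4 \<le> x" using real by (subst (asm) ennreal_le_iff) auto
    then show ?thesis using real by (simp add: I_def[symmetric] ennreal_leI)
  qed (simp add: I_def)
qed

section \<open>The gradient of the smoothed loss\<close>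

text \<open>The primitive of \<open>K\<close>, taken as a distribution function so that monotonicity
  and continuity come from a law without atoms.\<close>

definition kernel_cdf :: "(real \<Rightarrow> real) \<Rightarrow> real \<Rightarrow> real" where
  "kernel_cdf K = cdf (density lborel (\<lambda>u. ennreal (K u)))"

text \<open>The difference quotient is squeezed between \<open>G u\<close> and
  \<open>G (u + s)\<close>. This replaces differentiation under the integral, where the kink of the
  check loss would be in the way.\<close>

lemma has_field_derivative_of_subgradient:
  fixes L G :: "real \<Rightarrow> real"
  assumes sub: "\<And>u v. (v - u) * G u \<le> L v - L u" and G: "isCont G u"
  shows "(L has_field_derivative G u) (at u)"
proof -
  have "\<bar>(L (u + s) - L u) / s - G u\<bar> \<le> \<bar>G (u + s) - G u\<bar>" if "s \<noteq> 0" for s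
  proof -
    have lo: "0 \<le> L (u + s) - L u - s * G u" using sub[of "u + s" u] by simp
    have hi: "L (u + s) - L u - s * G u \<le> s * (G (u + s) - G u)"
      using sub[of u "u + s"] by (simp add: algebra_simps)
    define q where "q = (L (u + s) - L u) / s"
    have "L (u + s) - L u = s * q" using that by (simp add: q_def)
    then have "s * (q - G u) = L (u + s) - L u - s * G u" by (simp add: right_diff_distrib)
    then have "\<bar>s\<bar> * \<bar>q - G u\<bar> = \<bar>L (u + s) - L u - s * G u\<bar>"
      by (simp only: flip: abs_mult)
    also have "\<dots> \<le> \<bar>s * (G (u + s) - G u)\<bar>" using lo hi by linarith
    finally have "\<bar>s\<bar> * \<bar>q - G u\<bar> \<le> \<bar>s\<bar> * \<bar>G (u + s) - G u\<bar>" by (simp only: abs_mult)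
    then show ?thesis unfolding q_def[symmetric] by (rule mult_left_le_imp_le) (use that in simp)
  qed
  then have "\<forall>\<^sub>F s in at 0. norm ((L (u + s) - L u) / s - G u) \<le> \<bar>G (u + s) - G u\<bar>"
    by (simp add: eventually_at_filter)
  moreover have "((\<lambda>s. \<bar>G (u + s) - G u\<bar>) \<longlongrightarrow> 0) (at 0)"
    using G unfolding isCont_iff by (intro tendsto_rabs_zero LIM_zero)
  ultimately have "((\<lambda>s. (L (u + s) - L u) / s - G u) \<longlongrightarrow> 0) (at 0)"
    by (rule Lim_null_comparison)
  then show ?thesis unfolding DERIV_def by (rule LIM_zero_cancel)
qed

lemma check_loss_measurable [measurable]: "check_loss \<tau> \<in> borel_measurable borel"
  unfolding check_loss_def by measurable

context
  fixes K :: "real \<Rightarrow> real"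
  assumes B2: "condition_B2 K"
begin

abbreviation (input) "\<nu> \<equiv> density lborel (\<lambda>u. ennreal (K u))"

lemma kernel_nonneg: "0 \<le> K u"
  using B2 by (simp add: condition_B2_def)

lemma kernel_measurable: "K \<in> borel_measurable borel"
  using B2 by (auto simp: condition_B2_def dest!: borel_measurable_integrable)

lemma kernel_integrable: "integrable lborel K" "integral\<^sup>L lborel K = 1" "integrable lborel (\<lambda>u. u\<^sup>2 * K u)"
  using B2 by (simp_all add: condition_B2_def)

lemma kernel_real_distribution: "real_distribution \<nu>"
proof -
  note [measurable] = kernel_measurable
  have "emeasure \<nu> (space \<nu>) = 1"
    using kernel_integrable kernel_nonneg by (simp add: emeasure_density nn_integral_eq_integral)
  then show ?thesis
    by (auto simp: real_distribution_def real_distribution_axioms_def intro: prob_spaceI)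
qed

interpretation \<nu>: real_distribution \<nu> by (rule kernel_real_distribution)

lemma kernel_measure_singleton: "measure \<nu> {x} = 0"
proof -
  note [measurable] = kernel_measurable
  have "emeasure \<nu> {x} = 0"
    by (simp add: emeasure_density nn_integral_null_set null_setsI)
  then show ?thesis by (simp add: measure_def)
qed

lemma kernel_cdf_isCont: "isCont (kernel_cdf K) x"
  unfolding kernel_cdf_def by (simp add: \<nu>.isCont_cdf kernel_measure_singleton)

lemma kernel_cdf_mono: "x \<le> y \<Longrightarrow> kernel_cdf K x \<le> kernel_cdf K y"
  unfolding kernel_cdf_def by (rule \<nu>.cdf_nondecreasing)

lemma kernel_cdf_diff_ge:
  assumes "-1 \<le> x" "x \<le> y" "y \<le> 1" and \<kappa>: "\<And>u. \<bar>u\<bar> \<le> 1 \<Longrightarrow> \<kappa> \<le> K u" "0 \<le> \<kappa>"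
  shows "\<kappa> * (y - x) \<le> kernel_cdf K y - kernel_cdf K x"
proof (cases "x = y")
  case False
  note [measurable] = kernel_measurable
  have "ennreal (\<kappa> * (y - x)) = ennreal \<kappa> * emeasure lborel {x<..y}"
    using assms by (simp add: ennreal_mult)
  also have "\<dots> = (\<integral>\<^sup>+u. ennreal \<kappa> * indicator {x<..y} u \<partial>lborel)"
    by (intro nn_integral_cmult_indicator[symmetric]) simp
  also have "\<dots> \<le> (\<integral>\<^sup>+u. ennreal (K u) * indicator {x<..y} u \<partial>lborel)"
    using assms by (intro nn_integral_mono) (auto simp: indicator_def intro!: ennreal_leI)
  also have "\<dots> = emeasure \<nu> {x<..y}" by (simp add: emeasure_density)
  also have "\<dots> = ennreal (measure \<nu> {x<..y})" by (simp add: \<nu>.emeasure_eq_measure)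
  finally show ?thesis
    using False assms by (simp add: kernel_cdf_def \<nu>.cdf_diff_eq)
qed simp

lemma kernel_integrable_id: "integrable \<nu> (\<lambda>w. w)"
proof -
  note [measurable] = kernel_measurable
  have "integrable lborel (\<lambda>u. K u * u)"
  proof (rule Bochner_Integration.integrable_bound)
    show "integrable lborel (\<lambda>u. K u + u\<^sup>2 * K u)" using kernel_integrable by simp
    show "AE u in lborel. norm (K u * u) \<le> norm (K u + u\<^sup>2 * K u)"
    proof (intro AE_I2)
      fix u :: real
      have "\<bar>u\<bar> \<le> 1 + u\<^sup>2"
        using sum_squares_bound[of "\<bar>u\<bar>" 1] by simp
      then have "K u * \<bar>u\<bar> \<le> K u * (1 + u\<^sup>2)" by (intro mult_left_mono kernel_nonneg)
      then show "norm (K u * u) \<le> norm (K u + u\<^sup>2 * K u)"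
        using kernel_nonneg[of u] by (simp add: abs_mult algebra_simps)
    qed
  qed measurable
  then show ?thesis
    using kernel_nonneg by (subst integrable_density) auto
qed

text \<open>Substituting \<open>v = u + h w\<close> moves \<open>u\<close> from the kernel, which
  need not be smooth, into the check loss, which is convex.\<close>

lemma smoothed_loss_eq:
  assumes h: "h > 0"
  shows "smoothed_loss \<tau> K h u = (LINT w|\<nu>. check_loss \<tau> (u + h * w))"
proof -
  note [measurable] = kernel_measurable
  have "smoothed_loss \<tau> K h u = \<bar>h\<bar> *\<^sub>R (LINT w|lborel. check_loss \<tau> (u + h * w) * scaled_kernel K h (u + h * w - u))"
    unfolding smoothed_loss_def using h by (intro lborel_integral_real_affine) auto
  also have "\<dots> = (LINT w|lborel. K w * check_loss \<tau> (u + h * w))"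
    using h by (subst integral_scaleR_right[symmetric]) (simp add: scaled_kernel_def mult.commute)
  also have "\<dots> = (LINT w|\<nu>. check_loss \<tau> (u + h * w))"
    using kernel_nonneg by (subst integral_density) auto
  finally show ?thesis .
qed

lemma smoothed_loss_has_derivative:
  assumes h: "h > 0"
  shows "(smoothed_loss \<tau> K h has_field_derivative \<tau> - kernel_cdf K (- u / h)) (at u)"
proof (rule has_field_derivative_of_subgradient)
  have int: "integrable \<nu> (\<lambda>w. check_loss \<tau> (u + h * w))" for u
  proof (rule Bochner_Integration.integrable_bound)
    show "integrable \<nu> (\<lambda>w. (1 + \<bar>\<tau>\<bar>) * (\<bar>u\<bar> + h * \<bar>w\<bar>))"
      using kernel_integrable_id by auto
    show "AE w in \<nu>. norm (check_loss \<tau> (u + h * w)) \<le> norm ((1 + \<bar>\<tau>\<bar>) * (\<bar>u\<bar> + h * \<bar>w\<bar>))"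
    proof (intro AE_I2)
      fix w
      have "\<bar>u + h * w\<bar> * \<bar>\<tau> - of_bool (u + h * w < 0)\<bar> \<le> (\<bar>u\<bar> + h * \<bar>w\<bar>) * (1 + \<bar>\<tau>\<bar>)"
        using h abs_triangle_ineq[of u "h * w"] by (intro mult_mono) (auto simp: abs_mult)
      then show "norm (check_loss \<tau> (u + h * w)) \<le> norm ((1 + \<bar>\<tau>\<bar>) * (\<bar>u\<bar> + h * \<bar>w\<bar>))"
        using h by (simp add: check_loss_def abs_mult mult.commute)
    qed
  qed measurable
  \<comment> \<open>The subgradient of the check loss comes with a strict inequality, the
    distribution function with a weak one; they agree because single points are null.\<close>
  have cdf: "kernel_cdf K (- u / h) = measure \<nu> {w. u + h * w < 0}" for u
  proof -
    have "{..- u / h} = {w. u + h * w < 0} \<union> {- u / h}"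
      using h by (auto simp: field_simps)
    moreover have "measure \<nu> ({w. u + h * w < 0} \<union> {- u / h}) = measure \<nu> {w. u + h * w < 0} + measure \<nu> {- u / h}"
      using h by (intro \<nu>.finite_measure_Union) auto
    ultimately show ?thesis
      by (simp add: kernel_cdf_def cdf_def kernel_measure_singleton)
  qed
  fix u v
  have "(v - u) * (\<tau> - kernel_cdf K (- u / h)) = (LINT w|\<nu>. (v - u) * (\<tau> - indicator {w. u + h * w < 0} w))"
    using \<nu>.prob_space cdf[of u] by (simp add: \<nu>.emeasure_eq_measure)
  also have "\<dots> \<le> (LINT w|\<nu>. check_loss \<tau> (v + h * w) - check_loss \<tau> (u + h * w))"
  proof (intro integral_mono Bochner_Integration.integrable_diff int)
    fix w
    show "(v - u) * (\<tau> - indicator {w. u + h * w < 0} w) \<le> check_loss \<tau> (v + h * w) - check_loss \<tau> (u + h * w)"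
      by (auto simp: check_loss_def indicator_def algebra_simps)
  qed (auto simp: \<nu>.emeasure_eq_measure)
  also have "\<dots> = smoothed_loss \<tau> K h v - smoothed_loss \<tau> K h u"
    by (simp add: smoothed_loss_eq[OF h] int)
  finally show "(v - u) * (\<tau> - kernel_cdf K (- u / h)) \<le> smoothed_loss \<tau> K h v - smoothed_loss \<tau> K h u" .
next
  show "isCont (\<lambda>u. \<tau> - kernel_cdf K (- u / h)) u"
    using h by (intro continuous_intros isCont_o2[OF _ kernel_cdf_isCont]) auto
qed

lemma gradient_empirical_loss:
  assumes h: "h > 0" and \<beta>: "\<beta> \<in> carrier_vec p"
  shows "gradient p (empirical_loss \<tau> K h p n X Y) \<beta> =
    vec p (\<lambda>j. 1 / real n * (\<Sum>i<n. (kernel_cdf K ((vec p (X i) \<bullet> \<beta> - Y i) / h) - \<tau>) * X i j))"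
proof (unfold gradient_def, intro eq_vecI)
  fix j assume "j < dim_vec (vec p (\<lambda>j. 1 / real n * (\<Sum>i<n. (kernel_cdf K ((vec p (X i) \<bullet> \<beta> - Y i) / h) - \<tau>) * X i j)))"
  then have j: "j < p" by simp
  have lin: "vec p (X i) \<bullet> (\<beta> + t \<cdot>\<^sub>v unit_vec p j) = vec p (X i) \<bullet> \<beta> + t * X i j" for i t
    using \<beta> j by (simp add: scalar_prod_add_distrib[of _ p])
  have "((\<lambda>t. smoothed_loss \<tau> K h (Y i - (vec p (X i) \<bullet> \<beta> + t * X i j))) has_field_derivative
      (\<tau> - kernel_cdf K (- (Y i - (vec p (X i) \<bullet> \<beta> + 0 * X i j)) / h)) * (- X i j)) (at 0)" for i
    by (rule DERIV_chain2[OF smoothed_loss_has_derivative[OF h]]) (auto intro!: derivative_eq_intros)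
  then have "((\<lambda>t. empirical_loss \<tau> K h p n X Y (\<beta> + t \<cdot>\<^sub>v unit_vec p j)) has_field_derivative
     1 / real n * (\<Sum>i<n. (\<tau> - kernel_cdf K (- (Y i - (vec p (X i) \<bullet> \<beta> + 0 * X i j)) / h)) * (- X i j))) (at 0)"
    unfolding empirical_loss_def lin by (intro DERIV_cmult DERIV_sum)
  then have "deriv (\<lambda>t. empirical_loss \<tau> K h p n X Y (\<beta> + t \<cdot>\<^sub>v unit_vec p j)) 0 =
    1 / real n * (\<Sum>i<n. (\<tau> - kernel_cdf K (- (Y i - (vec p (X i) \<bullet> \<beta> + 0 * X i j)) / h)) * (- X i j))"
    by (rule DERIV_imp_deriv)
  also have "(\<Sum>i<n. (\<tau> - kernel_cdf K (- (Y i - (vec p (X i) \<bullet> \<beta> + 0 * X i j)) / h)) * (- X i j)) =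
    (\<Sum>i<n. (kernel_cdf K ((vec p (X i) \<bullet> \<beta> - Y i) / h) - \<tau>) * X i j)"
    by (intro sum.cong refl) (simp add: algebra_simps)
  finally show "vec p (\<lambda>j. deriv (\<lambda>t. empirical_loss \<tau> K h p n X Y (\<beta> + t \<cdot>\<^sub>v unit_vec p j)) 0) $ j =
    vec p (\<lambda>j. 1 / real n * (\<Sum>i<n. (kernel_cdf K ((vec p (X i) \<bullet> \<beta> - Y i) / h) - \<tau>) * X i j)) $ j"
    using j by simp
qed simp

text \<open>The level \<open>\<tau>\<close> cancels in the difference. What remains are increments
  of the kernel primitive, started at the residuals with respect to \<open>\<beta>s\<close>.\<close>

lemma gradient_diff_scalar_prod:
  assumes h: "h > 0" and \<beta>: "\<beta> \<in> carrier_vec p" "\<beta>s \<in> carrier_vec p"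
    and \<delta>_def: "\<delta> = \<beta> - \<beta>s" and F_def: "F = empirical_loss \<tau> K h p n X Y"
  shows "(gradient p F \<beta> - gradient p F \<beta>s) \<bullet> \<delta> =
    1 / real n * (\<Sum>i<n. (kernel_cdf K ((vec p (X i) \<bullet> \<delta> - (Y i - vec p (X i) \<bullet> \<beta>s)) / h) -
      kernel_cdf K (- (Y i - vec p (X i) \<bullet> \<beta>s) / h)) * (vec p (X i) \<bullet> \<delta>))"
proof -
  have \<delta>: "\<delta> \<in> carrier_vec p" using \<beta> by (simp add: \<delta>_def)
  have X\<delta>: "vec p (X i) \<bullet> \<delta> = vec p (X i) \<bullet> \<beta> - vec p (X i) \<bullet> \<beta>s" for i
    using \<beta> by (simp add: \<delta>_def scalar_prod_minus_distrib[of _ p])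
  define g where "g = (\<lambda>\<beta> i. kernel_cdf K ((vec p (X i) \<bullet> \<beta> - Y i) / h))"
  have "(gradient p F \<beta> - gradient p F \<beta>s) \<bullet> \<delta> =
      (\<Sum>j<p. (1 / real n * (\<Sum>i<n. (g \<beta> i - \<tau>) * X i j) - 1 / real n * (\<Sum>i<n. (g \<beta>s i - \<tau>) * X i j)) * \<delta> $ j)"
    using carrier_vecD[OF \<delta>]
    by (simp add: F_def gradient_empirical_loss[OF h] \<beta> scalar_prod_def lessThan_atLeast0 g_def)
  also have "\<dots> = (\<Sum>j<p. \<Sum>i<n. 1 / real n * ((g \<beta> i - g \<beta>s i) * (X i j * \<delta> $ j)))"
    unfolding right_diff_distrib[symmetric] sum_subtractf[symmetric] sum_distrib_left sum_distrib_right
    by (intro sum.cong refl) (simp only: left_diff_distrib[symmetric] mult.assoc, simp)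
  also have "\<dots> = 1 / real n * (\<Sum>i<n. (g \<beta> i - g \<beta>s i) * (vec p (X i) \<bullet> \<delta>))"
    using carrier_vecD[OF \<delta>]
    by (subst sum.swap) (simp add: scalar_prod_def lessThan_atLeast0[symmetric] sum_distrib_left)
  finally show ?thesis by (simp add: g_def X\<delta>)
qed

lemma kernel_cdf_increment_ge:
  assumes h: "h > 0" and \<kappa>: "\<And>u. \<bar>u\<bar> \<le> 1 \<Longrightarrow> \<kappa> \<le> K u" "0 \<le> \<kappa>"
  shows "\<kappa> / h * (of_bool (\<bar>e\<bar> \<le> h / 2 \<and> \<bar>v\<bar> \<le> h / 2) * v\<^sup>2) \<le>
    (kernel_cdf K ((v - e) / h) - kernel_cdf K (- e / h)) * v"
proof -
  \<comment> \<open>On the window both \<open>b\<close> and \<open>b + a\<close> lie in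
    \<open>[-1, 1]\<close>, where \<open>K\<close> is bounded below; this is why each of the two
    thresholds is half of \<open>h\<close>.\<close>
  define a b where "a = v / h" and "b = - e / h"
  have v: "v = h * a" "(v - e) / h = b + a" using h by (simp_all add: a_def b_def diff_divide_distrib)
  have "\<kappa> * (of_bool (\<bar>e\<bar> \<le> h / 2 \<and> \<bar>v\<bar> \<le> h / 2) * a\<^sup>2) \<le> (kernel_cdf K (b + a) - kernel_cdf K b) * a"
  proof (cases "\<bar>e\<bar> \<le> h / 2 \<and> \<bar>v\<bar> \<le> h / 2")
    case True
    then have ab: "\<bar>a\<bar> \<le> 1 / 2" "\<bar>b\<bar> \<le> 1 / 2" using h by (auto simp: a_def b_def field_simps)
    show ?thesis
    proof (cases "a \<ge> 0")
      case True
      have "\<kappa> * a \<le> kernel_cdf K (b + a) - kernel_cdf K b"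
        using kernel_cdf_diff_ge[of b "b + a", OF _ _ _ \<kappa>] ab True by (simp add: abs_le_iff)
      from mult_right_mono[OF this True] show ?thesis using \<open>_ \<and> _\<close> by (simp add: power2_eq_square)
    next
      case False
      then have "\<kappa> * (- a) \<le> kernel_cdf K b - kernel_cdf K (b + a)"
        using kernel_cdf_diff_ge[of "b + a" b, OF _ _ _ \<kappa>] ab by (simp add: abs_le_iff)
      from mult_right_mono[OF this, of "- a"] False show ?thesis
        using \<open>_ \<and> _\<close> by (simp add: power2_eq_square algebra_simps)
    qed
  next
    case False
    have "0 \<le> (kernel_cdf K (b + a) - kernel_cdf K b) * a"
      using kernel_cdf_mono[of b "b + a"] kernel_cdf_mono[of "b + a" b]
      by (cases "a \<ge> 0") (simp, simp add: mult_nonpos_nonpos)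
    then show ?thesis using False by (simp only: simp_thms of_bool_eq mult_zero_left mult_zero_right)
  qed
  from mult_left_mono[OF this, of h] show ?thesis
    using h unfolding v(2) b_def[symmetric] by (simp add: v(1) power2_eq_square mult_ac)
qed

end

section \<open>Conditional density and design\<close>

lemma (in prob_space) conditional_density_nn_integral:
  fixes H :: "(nat \<Rightarrow> real) \<Rightarrow> ennreal"
  assumes cd: "conditional_density M p x \<epsilon> f"
    and [measurable]: "x \<in> measurable M (rvec_space p)" "\<epsilon> \<in> borel_measurable M" "H \<in> borel_measurable (rvec_space p)"
      "S \<in> sets borel"
  shows "(\<integral>\<^sup>+\<omega>. H (x \<omega>) * indicator S (\<epsilon> \<omega>) \<partial>M) =
    (\<integral>\<^sup>+\<omega>. H (x \<omega>) * (\<integral>\<^sup>+u. ennreal (f (x \<omega>) u) * indicator S u \<partial>lborel) \<partial>M)"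
proof -
  let ?L = "distr M (rvec_space p) x"
  have dist: "distributed M (?L \<Otimes>\<^sub>M lborel) (\<lambda>\<omega>. (x \<omega>, \<epsilon> \<omega>)) (\<lambda>(v, u). ennreal (f v u))"
    using cd by (simp add: conditional_density_def)
  have fm: "(\<lambda>(v, u). ennreal (f v u)) \<in> borel_measurable (?L \<Otimes>\<^sub>M lborel)"
    using dist by (simp add: distributed_def)
  then have [measurable]: "(\<lambda>(v, u). ennreal (f v u)) \<in> borel_measurable (rvec_space p \<Otimes>\<^sub>M borel)"
    by (simp cong: measurable_cong_sets add: sets_pair_measure_cong[of ?L "rvec_space p" lborel borel])
  have "(\<integral>\<^sup>+\<omega>. H (x \<omega>) * indicator S (\<epsilon> \<omega>) \<partial>M) =
    (\<integral>\<^sup>+z. (\<lambda>(v, u). ennreal (f v u)) z * (H (fst z) * indicator S (snd z)) \<partial>(?L \<Otimes>\<^sub>M lborel))"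
    by (subst distributed_nn_integral[OF dist]) auto
  also have "\<dots> = (\<integral>\<^sup>+v. (\<integral>\<^sup>+u. ennreal (f v u) * (H v * indicator S u) \<partial>lborel) \<partial>?L)"
    by (subst lborel.nn_integral_fst[symmetric]) (auto simp: split_beta')
  also have "\<dots> = (\<integral>\<^sup>+v. H v * (\<integral>\<^sup>+u. ennreal (f v u) * indicator S u \<partial>lborel) \<partial>?L)"
  proof (intro nn_integral_cong)
    fix v assume "v \<in> space ?L"
    then have v: "v \<in> space (rvec_space p)" by simp
    have [measurable]: "(\<lambda>u. ennreal (f v u)) \<in> borel_measurable borel"
      using measurable_Pair2[OF fm, of v] v by simp
    have "(\<integral>\<^sup>+u. ennreal (f v u) * (H v * indicator S u) \<partial>lborel) =
        (\<integral>\<^sup>+u. H v * (ennreal (f v u) * indicator S u) \<partial>lborel)"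
      by (intro nn_integral_cong) (simp add: mult_ac)
    also have "\<dots> = H v * (\<integral>\<^sup>+u. ennreal (f v u) * indicator S u \<partial>lborel)"
      by (intro nn_integral_cmult) measurable
    finally show "(\<integral>\<^sup>+u. ennreal (f v u) * (H v * indicator S u) \<partial>lborel) =
      H v * (\<integral>\<^sup>+u. ennreal (f v u) * indicator S u \<partial>lborel)" .
  qed
  also have "\<dots> = (\<integral>\<^sup>+\<omega>. H (x \<omega>) * (\<integral>\<^sup>+u. ennreal (f (x \<omega>) u) * indicator S u \<partial>lborel) \<partial>M)"
    by (subst nn_integral_distr) measurable
  finally show ?thesis .
qed

text \<open>Since \<open>l\<^sub>0 h / 2 \<le> f\<^sub>l / 4\<close>, the density on the window
  differs from its value at 0 by at most \<open>f\<^sub>l / 4\<close>. The lower bound serves the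
  mean of the summands, the upper one their exponential moments.\<close>

lemma (in prob_space) condition_B1_window:
  fixes H :: "(nat \<Rightarrow> real) \<Rightarrow> ennreal"
  assumes B1: "condition_B1 M p x \<epsilon> f\<^sub>l f\<^sub>u l\<^sub>0"
    and meas [measurable]: "x \<in> measurable M (rvec_space p)" "\<epsilon> \<in> borel_measurable M" "H \<in> borel_measurable (rvec_space p)"
    and h: "h > 0" "h \<le> f\<^sub>l / (2 * l\<^sub>0)"
  shows "ennreal (3 / 4 * f\<^sub>l * h) * (\<integral>\<^sup>+\<omega>. H (x \<omega>) \<partial>M) \<le> (\<integral>\<^sup>+\<omega>. H (x \<omega>) * indicator {- (h / 2)..h / 2} (\<epsilon> \<omega>) \<partial>M)"
    and "(\<integral>\<^sup>+\<omega>. H (x \<omega>) * indicator {- (h / 2)..h / 2} (\<epsilon> \<omega>) \<partial>M) \<le> ennreal (5 / 4 * f\<^sub>u * h) * (\<integral>\<^sup>+\<omega>. H (x \<omega>) \<partial>M)"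
proof -
  obtain f where cd: "conditional_density M p x \<epsilon> f"
    and zero: "AE \<omega> in M. f\<^sub>l \<le> f (x \<omega>) 0 \<and> f (x \<omega>) 0 \<le> f\<^sub>u"
    and lip: "AE \<omega> in M. \<forall>u v. \<bar>f (x \<omega>) u - f (x \<omega>) v\<bar> \<le> l\<^sub>0 * \<bar>u - v\<bar>"
    and pos: "0 < f\<^sub>l" "f\<^sub>l \<le> f\<^sub>u" "0 < l\<^sub>0"
    using B1 by (auto simp: condition_B1_def)
  let ?S = "{- (h / 2)..h / 2}"
  let ?I = "\<lambda>\<omega>. \<integral>\<^sup>+u. ennreal (f (x \<omega>) u) * indicator ?S u \<partial>lborel"
  have lh: "l\<^sub>0 * (h / 2) \<le> f\<^sub>l / 4" using h pos by (simp add: field_simps)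
  have bd: "AE \<omega> in M. \<forall>u. \<bar>u\<bar> \<le> h / 2 \<longrightarrow> 3 / 4 * f\<^sub>l \<le> f (x \<omega>) u \<and> f (x \<omega>) u \<le> 5 / 4 * f\<^sub>u"
    using zero lip
  proof eventually_elim
    case (elim \<omega>)
    show ?case
    proof (intro allI impI)
      fix u :: real assume "\<bar>u\<bar> \<le> h / 2"
      then have "l\<^sub>0 * \<bar>u\<bar> \<le> l\<^sub>0 * (h / 2)" using pos by (intro mult_left_mono) auto
      moreover have "\<bar>f (x \<omega>) u - f (x \<omega>) 0\<bar> \<le> l\<^sub>0 * \<bar>u\<bar>" using elim(2)[rule_format, of u 0] by simp
      ultimately show "3 / 4 * f\<^sub>l \<le> f (x \<omega>) u \<and> f (x \<omega>) u \<le> 5 / 4 * f\<^sub>u"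
        using elim(1) lh pos by linarith
    qed
  qed
  have const: "ennreal c * emeasure lborel ?S = (\<integral>\<^sup>+u. ennreal c * indicator ?S u \<partial>lborel)" for c
    by (intro nn_integral_cmult_indicator[symmetric]) simp
  have leb: "ennreal c * emeasure lborel ?S = ennreal (c * h)" if "0 \<le> c" for c
    using h that by (simp add: ennreal_mult)
  have lo: "AE \<omega> in M. ennreal (3 / 4 * f\<^sub>l * h) \<le> ?I \<omega>"
    using bd
  proof eventually_elim
    case (elim \<omega>)
    have "ennreal (3 / 4 * f\<^sub>l * h) = (\<integral>\<^sup>+u. ennreal (3 / 4 * f\<^sub>l) * indicator ?S u \<partial>lborel)"
      using leb[of "3 / 4 * f\<^sub>l"] const[of "3 / 4 * f\<^sub>l"] pos by simp
    also have "\<dots> \<le> ?I \<omega>"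
      using elim by (intro nn_integral_mono) (auto simp: indicator_def abs_le_iff intro!: ennreal_leI)
    finally show ?case .
  qed
  have hi: "AE \<omega> in M. ?I \<omega> \<le> ennreal (5 / 4 * f\<^sub>u * h)"
    using bd
  proof eventually_elim
    case (elim \<omega>)
    have "?I \<omega> \<le> (\<integral>\<^sup>+u. ennreal (5 / 4 * f\<^sub>u) * indicator ?S u \<partial>lborel)"
      using elim by (intro nn_integral_mono) (auto simp: indicator_def abs_le_iff intro!: ennreal_leI)
    also have "\<dots> = ennreal (5 / 4 * f\<^sub>u * h)"
      using leb[of "5 / 4 * f\<^sub>u"] const[of "5 / 4 * f\<^sub>u"] pos by simp
    finally show ?case .
  qed
  have eq: "(\<integral>\<^sup>+\<omega>. H (x \<omega>) * indicator ?S (\<epsilon> \<omega>) \<partial>M) = (\<integral>\<^sup>+\<omega>. H (x \<omega>) * ?I \<omega> \<partial>M)"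
    by (rule conditional_density_nn_integral[OF cd meas]) simp
  have "ennreal (3 / 4 * f\<^sub>l * h) * (\<integral>\<^sup>+\<omega>. H (x \<omega>) \<partial>M) = (\<integral>\<^sup>+\<omega>. ennreal (3 / 4 * f\<^sub>l * h) * H (x \<omega>) \<partial>M)"
    by (intro nn_integral_cmult[symmetric]) measurable
  also have "\<dots> \<le> (\<integral>\<^sup>+\<omega>. H (x \<omega>) * ?I \<omega> \<partial>M)"
    using lo by (intro nn_integral_mono_AE) (auto elim!: eventually_mono simp: mult.commute intro!: mult_left_mono)
  finally show "ennreal (3 / 4 * f\<^sub>l * h) * (\<integral>\<^sup>+\<omega>. H (x \<omega>) \<partial>M) \<le> (\<integral>\<^sup>+\<omega>. H (x \<omega>) * indicator ?S (\<epsilon> \<omega>) \<partial>M)"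
    by (simp only: eq)
  have "(\<integral>\<^sup>+\<omega>. H (x \<omega>) * ?I \<omega> \<partial>M) \<le> (\<integral>\<^sup>+\<omega>. ennreal (5 / 4 * f\<^sub>u * h) * H (x \<omega>) \<partial>M)"
    using hi by (intro nn_integral_mono_AE) (auto elim!: eventually_mono simp: mult.commute intro!: mult_left_mono)
  also have "\<dots> = ennreal (5 / 4 * f\<^sub>u * h) * (\<integral>\<^sup>+\<omega>. H (x \<omega>) \<partial>M)"
    by (intro nn_integral_cmult) measurable
  finally show "(\<integral>\<^sup>+\<omega>. H (x \<omega>) * indicator ?S (\<epsilon> \<omega>) \<partial>M) \<le> ennreal (5 / 4 * f\<^sub>u * h) * (\<integral>\<^sup>+\<omega>. H (x \<omega>) \<partial>M)"
    by (simp only: eq)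
qed

section \<open>Second moments and tails of linear forms in the covariates\<close>

lemma vec_scalar_prod_eq:
  assumes "t \<in> carrier_vec p"
  shows "vec p v \<bullet> t = (\<Sum>j<p. v j * t $ j)"
  using assms by (simp add: scalar_prod_def lessThan_atLeast0)

locale design = prob_space M for M :: "'a measure" +
  fixes p :: nat and x :: "'a \<Rightarrow> nat \<Rightarrow> real"
  assumes x_meas [measurable]: "x \<in> measurable M (rvec_space p)"
    and sq_int: "\<And>j. j < p \<Longrightarrow> integrable M (\<lambda>\<omega>. (x \<omega> j)\<^sup>2)"
    and pd: "pos_def_mat p (second_moment_mat M p x)"
    and intercept: "p \<ge> 1" "\<And>\<omega>. \<omega> \<in> space M \<Longrightarrow> x \<omega> 0 = 1"
begin

abbreviation "\<Sigma> \<equiv> second_moment_mat M p x"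

lemma coord_measurable [measurable]: "j < p \<Longrightarrow> (\<lambda>\<omega>. x \<omega> j) \<in> borel_measurable M"
  using measurable_compose[OF x_meas measurable_component_singleton[of j "{..<p}"]] by simp

lemma prod_int: "i < p \<Longrightarrow> j < p \<Longrightarrow> integrable M (\<lambda>\<omega>. x \<omega> i * x \<omega> j)"
proof -
  assume ij: "i < p" "j < p"
  show "integrable M (\<lambda>\<omega>. x \<omega> i * x \<omega> j)"
  proof (rule Bochner_Integration.integrable_bound)
    show "integrable M (\<lambda>\<omega>. (x \<omega> i)\<^sup>2 + (x \<omega> j)\<^sup>2)" using sq_int ij by simp
    show "AE \<omega> in M. norm (x \<omega> i * x \<omega> j) \<le> norm ((x \<omega> i)\<^sup>2 + (x \<omega> j)\<^sup>2)"
    proof (intro AE_I2)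
      fix \<omega>
      have "2 * \<bar>x \<omega> i\<bar> * \<bar>x \<omega> j\<bar> \<le> (x \<omega> i)\<^sup>2 + (x \<omega> j)\<^sup>2"
        using sum_squares_bound[of "\<bar>x \<omega> i\<bar>" "\<bar>x \<omega> j\<bar>"] by simp
      moreover have "0 \<le> \<bar>x \<omega> i\<bar> * \<bar>x \<omega> j\<bar>" by simp
      ultimately have "\<bar>x \<omega> i\<bar> * \<bar>x \<omega> j\<bar> \<le> (x \<omega> i)\<^sup>2 + (x \<omega> j)\<^sup>2" by linarith
      then show "norm (x \<omega> i * x \<omega> j) \<le> norm ((x \<omega> i)\<^sup>2 + (x \<omega> j)\<^sup>2)"
        by (simp add: abs_mult)
    qed
  qed (use ij in measurable)
qed

lemma scalar_prod_square_sum: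
  assumes "t \<in> carrier_vec p"
  shows "(vec p (x \<omega>) \<bullet> t)\<^sup>2 = (\<Sum>i<p. \<Sum>j<p. t $ i * t $ j * (x \<omega> i * x \<omega> j))"
  unfolding vec_scalar_prod_eq[OF assms] power2_eq_square sum_product
  by (intro sum.cong refl) simp

lemma scalar_prod_square_integrable:
  assumes "t \<in> carrier_vec p"
  shows "integrable M (\<lambda>\<omega>. (vec p (x \<omega>) \<bullet> t)\<^sup>2)"
  unfolding scalar_prod_square_sum[OF assms]
  by (intro Bochner_Integration.integrable_sum integrable_mult_right prod_int) auto

lemma scalar_prod_second_moment:
  assumes "t \<in> carrier_vec p"
  shows "(LINT \<omega>|M. (vec p (x \<omega>) \<bullet> t)\<^sup>2) = (\<Sum>i<p. \<Sum>j<p. t $ i * t $ j * (LINT \<omega>|M. x \<omega> i * x \<omega> j))"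
proof -
  have "(LINT \<omega>|M. (\<Sum>i<p. \<Sum>j<p. t $ i * t $ j * (x \<omega> i * x \<omega> j))) =
      (\<Sum>i<p. LINT \<omega>|M. (\<Sum>j<p. t $ i * t $ j * (x \<omega> i * x \<omega> j)))"
    by (intro Bochner_Integration.integral_sum Bochner_Integration.integrable_sum integrable_mult_right prod_int) auto
  also have "\<dots> = (\<Sum>i<p. \<Sum>j<p. LINT \<omega>|M. t $ i * t $ j * (x \<omega> i * x \<omega> j))"
    by (intro sum.cong refl Bochner_Integration.integral_sum integrable_mult_right prod_int) auto
  finally show ?thesis unfolding scalar_prod_square_sum[OF assms] by simp
qed

text \<open>The \<open>\<Sigma>\<close>-norm is the L2 norm of a linear form in \<open>x\<close>;
  scaling and the comparison with the l1 norm are read off from this.\<close>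

lemma mat_norm_second_moment:
  assumes t: "t \<in> carrier_vec p"
  shows "(mat_norm \<Sigma> t)\<^sup>2 = (LINT \<omega>|M. (vec p (x \<omega>) \<bullet> t)\<^sup>2)"
proof -
  have "t \<bullet> (\<Sigma> *\<^sub>v t) = (\<Sum>i<p. t $ i * (\<Sum>j<p. (LINT \<omega>|M. x \<omega> i * x \<omega> j) * t $ j))"
    using t by (simp add: scalar_prod_def second_moment_mat_def lessThan_atLeast0 mult_mat_vec_def)
  also have "\<dots> = (\<Sum>i<p. \<Sum>j<p. t $ i * t $ j * (LINT \<omega>|M. x \<omega> i * x \<omega> j))"
    by (simp add: sum_distrib_left mult_ac)
  also have "\<dots> = (LINT \<omega>|M. (vec p (x \<omega>) \<bullet> t)\<^sup>2)"
    unfolding scalar_prod_second_moment[OF t] ..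
  finally have eq: "t \<bullet> (\<Sigma> *\<^sub>v t) = (LINT \<omega>|M. (vec p (x \<omega>) \<bullet> t)\<^sup>2)" .
  then have "0 \<le> t \<bullet> (\<Sigma> *\<^sub>v t)" by simp
  with eq show ?thesis unfolding mat_norm_eq[OF pd t] by simp
qed

lemma mat_norm_nonneg: "0 \<le> mat_norm \<Sigma> t"
  unfolding mat_norm_def l2_norm_def by (simp add: scalar_prod_def sum_nonneg)

lemma mat_norm_pos:
  assumes "t \<in> carrier_vec p" "t \<noteq> 0\<^sub>v p"
  shows "0 < mat_norm \<Sigma> t"
  using assms pd by (auto simp: mat_norm_eq[OF pd] pos_def_mat_def)

lemma mat_norm_smult:
  assumes t: "t \<in> carrier_vec p" and c: "0 \<le> c"
  shows "mat_norm \<Sigma> (c \<cdot>\<^sub>v t) = c * mat_norm \<Sigma> t"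
proof (rule power2_eq_imp_eq)
  show "(mat_norm \<Sigma> (c \<cdot>\<^sub>v t))\<^sup>2 = (c * mat_norm \<Sigma> t)\<^sup>2"
    using t by (simp add: mat_norm_second_moment power_mult_distrib)
qed (use c in \<open>auto intro!: mat_norm_nonneg mult_nonneg_nonneg\<close>)

lemma second_moment_le: "j < p \<Longrightarrow> (LINT \<omega>|M. (x \<omega> j)\<^sup>2) \<le> sigma_x_sq M p x"
  unfolding sigma_x_sq_def by (intro Max_ge) auto

lemma sigma_x_sq_ge_1: "1 \<le> sigma_x_sq M p x"
proof -
  have "(LINT \<omega>|M. (x \<omega> 0)\<^sup>2) = (LINT \<omega>|M. 1)"
    by (intro Bochner_Integration.integral_cong refl) (simp add: intercept)
  then show ?thesis using second_moment_le[of 0] intercept prob_space by simp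
qed

text \<open>The entries of \<open>\<Sigma>\<close> are at most \<open>sigma_x_sq M p x\<close> in
  modulus. For a cone direction of norm 1 this yields \<open>1 \<le> l \<sigma>\<close>, which keeps
  the Chernoff parameter admissible.\<close>

lemma mat_norm_le_l1_norm:
  assumes t: "t \<in> carrier_vec p"
  shows "mat_norm \<Sigma> t \<le> sqrt (sigma_x_sq M p x) * l1_norm t"
proof (rule power2_le_imp_le)
  let ?s = "sigma_x_sq M p x"
  have c: "\<bar>LINT \<omega>|M. x \<omega> i * x \<omega> j\<bar> \<le> ?s" if "i < p" "j < p" for i j
  proof -
    have "\<bar>LINT \<omega>|M. x \<omega> i * x \<omega> j\<bar> \<le> (LINT \<omega>|M. \<bar>x \<omega> i * x \<omega> j\<bar>)" by (rule integral_abs_bound)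
    also have "\<dots> \<le> (LINT \<omega>|M. ((x \<omega> i)\<^sup>2 + (x \<omega> j)\<^sup>2) / 2)"
    proof (intro integral_mono)
      fix \<omega>
      show "\<bar>x \<omega> i * x \<omega> j\<bar> \<le> ((x \<omega> i)\<^sup>2 + (x \<omega> j)\<^sup>2) / 2"
        using sum_squares_bound[of "\<bar>x \<omega> i\<bar>" "\<bar>x \<omega> j\<bar>"] by (simp add: abs_mult)
    qed (use that prod_int sq_int in auto)
    also have "\<dots> \<le> ?s" using that second_moment_le[of i] second_moment_le[of j] sq_int by simp
    finally show ?thesis .
  qed
  have "(mat_norm \<Sigma> t)\<^sup>2 = (\<Sum>i<p. \<Sum>j<p. t $ i * t $ j * (LINT \<omega>|M. x \<omega> i * x \<omega> j))"
    unfolding mat_norm_second_moment[OF t] scalar_prod_second_moment[OF t] ..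
  also have "\<dots> \<le> (\<Sum>i<p. \<Sum>j<p. \<bar>t $ i\<bar> * \<bar>t $ j\<bar> * ?s)"
  proof (intro sum_mono)
    fix i j assume "i \<in> {..<p}" "j \<in> {..<p}"
    then have "\<bar>t $ i * t $ j\<bar> * \<bar>LINT \<omega>|M. x \<omega> i * x \<omega> j\<bar> \<le> \<bar>t $ i * t $ j\<bar> * ?s"
      by (intro mult_left_mono c) auto
    then show "t $ i * t $ j * (LINT \<omega>|M. x \<omega> i * x \<omega> j) \<le> \<bar>t $ i\<bar> * \<bar>t $ j\<bar> * ?s"
      using abs_ge_self[of "t $ i * t $ j * (LINT \<omega>|M. x \<omega> i * x \<omega> j)"] by (simp add: abs_mult)
  qed
  also have "\<dots> = ?s * (l1_norm t)\<^sup>2"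
    using carrier_vecD[OF t] by (simp add: l1_norm_def power2_eq_square sum_product sum_distrib_left mult_ac)
  also have "\<dots> = (sqrt ?s * l1_norm t)\<^sup>2"
    using sigma_x_sq_ge_1 by (simp add: power_mult_distrib)
  finally show "(mat_norm \<Sigma> t)\<^sup>2 \<le> (sqrt ?s * l1_norm t)\<^sup>2" .
  show "0 \<le> sqrt ?s * l1_norm t" using sigma_x_sq_ge_1 by (simp add: l1_norm_def sum_nonneg)
qed

text \<open>\<open>condition_B3\<close> in the direction
  \<open>mat_sqrt \<Sigma> *\<^sub>v t\<close>. A bound \<open>s\<close> replaces the norm so that
  all coordinates can share one scale; it also admits \<open>t = 0\<close>, where the event is empty
  for \<open>a > 0\<close>.\<close>

lemma subexp_tail:
  assumes B3: "condition_B3 M p x \<upsilon>" and t: "t \<in> carrier_vec p" and nt: "mat_norm \<Sigma> t \<le> s" "0 < s" and a: "0 \<le> a"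
  shows "prob {\<omega> \<in> space M. \<upsilon> * s * a \<le> \<bar>vec p (x \<omega>) \<bullet> t\<bar>} \<le> 2 * exp (- a)"
proof (cases "t = 0\<^sub>v p")
  case True
  have \<upsilon>: "\<upsilon> \<ge> 1" using B3 by (simp add: condition_B3_def)
  show ?thesis
  proof (cases "a = 0")
    case True
    then show ?thesis by (simp add: prob_space)
  next
    case False
    then have "0 < \<upsilon> * s * a" using \<upsilon> nt a by simp
    moreover have "vec p v \<bullet> t = 0" for v using True by simp
    ultimately show ?thesis by (simp add: not_le)
  qed
next
  case False
  have \<upsilon>: "\<upsilon> \<ge> 1" using B3 by (simp add: condition_B3_def)
  let ?u = "mat_sqrt \<Sigma> *\<^sub>v t"
  have u: "?u \<in> carrier_vec p" using mat_sqrt_carrier[OF pd] t by (intro mult_mat_vec_carrier)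
  have n: "l2_norm ?u = mat_norm \<Sigma> t" by (simp add: mat_norm_def)
  have "?u \<noteq> 0\<^sub>v p"
  proof
    assume "?u = 0\<^sub>v p"
    then have "mat_norm \<Sigma> t = 0" by (simp add: mat_norm_def l2_norm_def)
    then show False using mat_norm_pos[OF t False] by simp
  qed
  then have "prob {\<omega> \<in> space M. \<bar>(mat_inv_sqrt \<Sigma> *\<^sub>v vec p (x \<omega>)) \<bullet> ?u\<bar> \<ge> \<upsilon> * l2_norm ?u * a} \<le> 2 * exp (- a)"
    using B3 u a unfolding condition_B3_def Let_def by blast
  then have le: "prob {\<omega> \<in> space M. \<upsilon> * mat_norm \<Sigma> t * a \<le> \<bar>vec p (x \<omega>) \<bullet> t\<bar>} \<le> 2 * exp (- a)"
    unfolding n by (simp add: mat_inv_sqrt_scalar_prod[OF pd t])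
  have [measurable]: "(\<lambda>\<omega>. vec p (x \<omega>) \<bullet> t) \<in> borel_measurable M"
    unfolding vec_scalar_prod_eq[OF t] by measurable
  have "\<upsilon> * mat_norm \<Sigma> t * a \<le> \<upsilon> * s * a"
    using \<upsilon> nt a by (intro mult_right_mono mult_left_mono) auto
  then have "prob {\<omega> \<in> space M. \<upsilon> * s * a \<le> \<bar>vec p (x \<omega>) \<bullet> t\<bar>} \<le>
     prob {\<omega> \<in> space M. \<upsilon> * mat_norm \<Sigma> t * a \<le> \<bar>vec p (x \<omega>) \<bullet> t\<bar>}"
    by (intro finite_measure_mono) auto
  with le show ?thesis by linarith
qed

end

section \<open>Deviation over finitely many directions\<close>

locale rsc_setting = design M p x for M :: "'a measure" and p x +
  fixes y \<epsilon> :: "'a \<Rightarrow> real" and \<beta>s :: "real vec" and n :: nat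
    and X :: "nat \<Rightarrow> 'a \<Rightarrow> nat \<Rightarrow> real" and Y :: "nat \<Rightarrow> 'a \<Rightarrow> real"
    and \<upsilon> f\<^sub>l f\<^sub>u l\<^sub>0 r l h :: real
  assumes eps_meas [measurable]: "\<epsilon> \<in> borel_measurable M"
    and \<beta>s: "\<beta>s \<in> carrier_vec p"
    and model: "\<And>\<omega>. \<omega> \<in> space M \<Longrightarrow> y \<omega> = vec p (x \<omega>) \<bullet> \<beta>s + \<epsilon> \<omega>"
    and indep: "indep_vars (\<lambda>_. borel \<Otimes>\<^sub>M rvec_space p) (\<lambda>i \<omega>. (Y i \<omega>, X i \<omega>)) {..<n}"
    and ident: "\<And>i. i < n \<Longrightarrow> distr M (borel \<Otimes>\<^sub>M rvec_space p) (\<lambda>\<omega>. (Y i \<omega>, X i \<omega>)) =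
            distr M (borel \<Otimes>\<^sub>M rvec_space p) (\<lambda>\<omega>. (y \<omega>, x \<omega>))"
    and B1: "condition_B1 M p x \<epsilon> f\<^sub>l f\<^sub>u l\<^sub>0"
    and B3: "condition_B3 M p x \<upsilon>"
    and rlh: "0 < r" "0 < l" "0 < h" "20 * \<upsilon>\<^sup>2 * r \<le> h" "h \<le> f\<^sub>l / (2 * l\<^sub>0)"
begin

definition "R = h / (2 * r)"
definition "\<sigma> = sqrt (sigma_x_sq M p x)"
definition "\<mu> = distr M (borel \<Otimes>\<^sub>M rvec_space p) (\<lambda>\<omega>. (y \<omega>, x \<omega>))"
text \<open>Directions are functions rather than vectors, which gives them the product topology for
  separability and continuity.\<close>

definition dot :: "(nat \<Rightarrow> real) \<Rightarrow> (nat \<Rightarrow> real) \<Rightarrow> real" where "dot v t = (\<Sum>j<p. v j * t j)"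
text \<open>The sample consists of pairs without noise terms, so the noise is recovered as a
  residual.\<close>

definition window :: "real \<times> (nat \<Rightarrow> real) \<Rightarrow> real" where
  "window z = indicator {- (h / 2)..h / 2} (fst z - dot (snd z) (\<lambda>j. \<beta>s $ j))"
definition g :: "(nat \<Rightarrow> real) \<Rightarrow> real \<times> (nat \<Rightarrow> real) \<Rightarrow> real" where
  "g t z = window z * truncated_square R (dot (snd z) t)"

lemma fpos: "0 < f\<^sub>l" "f\<^sub>l \<le> f\<^sub>u" "0 < l\<^sub>0" "0 < f\<^sub>u"
  using B1 by (auto simp: condition_B1_def)

lemma upsilon_ge_1: "1 \<le> \<upsilon>"
  using B3 by (simp add: condition_B3_def)

lemma \<sigma>_ge_1: "1 \<le> \<sigma>"
  using sigma_x_sq_ge_1 by (simp add: \<sigma>_def)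

lemma R_ge: "0 < R" "10 * \<upsilon>\<^sup>2 \<le> R"
  using rlh by (auto simp: R_def field_simps)

lemma scalar_prod_dot: "t \<in> carrier_vec p \<Longrightarrow> vec p v \<bullet> t = dot v (\<lambda>j. t $ j)"
  by (simp add: vec_scalar_prod_eq dot_def)

lemma scalar_prod_dot_vec: "vec p v \<bullet> vec p t = dot v t"
  by (simp add: scalar_prod_def dot_def lessThan_atLeast0)

lemma dot_measurable [measurable]: "(\<lambda>v. dot v t) \<in> borel_measurable (rvec_space p)"
  unfolding dot_def by measurable

lemma y_measurable [measurable]: "y \<in> borel_measurable M"
proof -
  have "(\<lambda>\<omega>. dot (x \<omega>) (\<lambda>j. \<beta>s $ j) + \<epsilon> \<omega>) \<in> borel_measurable M" by measurable
  then show ?thesis by (subst measurable_cong[OF model]) (simp_all add: scalar_prod_dot[OF \<beta>s])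
qed

lemma window_measurable [measurable]: "window \<in> borel_measurable (borel \<Otimes>\<^sub>M rvec_space p)"
  unfolding window_def by measurable

lemma g_measurable [measurable]: "g t \<in> borel_measurable (borel \<Otimes>\<^sub>M rvec_space p)"
  unfolding g_def by measurable

lemma snd_coord_measurable:
  "j < p \<Longrightarrow> (\<lambda>z. snd z j) \<in> borel_measurable (borel \<Otimes>\<^sub>M rvec_space p)"
  by (rule measurable_compose[OF measurable_snd measurable_component_singleton]) simp

lemma window_model: "\<omega> \<in> space M \<Longrightarrow> window (y \<omega>, x \<omega>) = indicator {- (h / 2)..h / 2} (\<epsilon> \<omega>)"
  by (simp add: window_def model scalar_prod_dot[OF \<beta>s])

lemma window_cases: "window z = 0 \<or> window z = 1"
  by (auto simp: window_def indicator_def)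

lemma g_nonneg: "0 \<le> g t z"
  using window_cases[of z] by (auto simp: g_def truncated_square_nonneg)

lemma g_le: "g t z \<le> R\<^sup>2"
  using window_cases[of z] R_ge truncated_square_le_bound[of R] by (auto simp: g_def)

text \<open>With \<open>g_lipschitz\<close>, the input of the contraction. The window stays in the
  linear majorant because it brings the factor \<open>f\<^sub>u h\<close> into the exponential
  moment.\<close>

lemma g_linear: "g t z \<le> \<bar>8 * R * window z * dot (snd z) t\<bar>"
  using window_cases[of z] R_ge truncated_square_le_linear[of R "dot (snd z) t"] by (auto simp: g_def abs_mult)

lemma g_lipschitz:
  "\<bar>g s z - g t z\<bar> \<le> \<bar>8 * R * window z * dot (snd z) s - 8 * R * window z * dot (snd z) t\<bar>"
  using window_cases[of z] R_ge truncated_square_lipschitz[of R "dot (snd z) s" "dot (snd z) t"]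
  by (auto simp: g_def abs_mult simp flip: right_diff_distrib)

lemma prob_space_\<mu>: "prob_space \<mu>"
  unfolding \<mu>_def by (intro prob_space_distr) measurable

lemma sets_\<mu> [measurable_cong, simp]: "sets \<mu> = sets (borel \<Otimes>\<^sub>M rvec_space p)"
  by (simp add: \<mu>_def)

lemma nn_integral_\<mu>:
  "F \<in> borel_measurable (borel \<Otimes>\<^sub>M rvec_space p) \<Longrightarrow> (\<integral>\<^sup>+z. F z \<partial>\<mu>) = (\<integral>\<^sup>+\<omega>. F (y \<omega>, x \<omega>) \<partial>M)"
  unfolding \<mu>_def by (intro nn_integral_distr) measurable

interpretation \<mu>: prob_space \<mu> by (rule prob_space_\<mu>)

text \<open>One factor \<open>3/4\<close> is the truncation loss, the other the variation of the
  density over the window.\<close>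

lemma expectation_g_ge:
  assumes t: "mat_norm \<Sigma> (vec p t) = 1"
  shows "9 / 16 * f\<^sub>l * h \<le> (LINT z|\<mu>. g t z)"
proof -
  have [measurable]: "(\<lambda>\<omega>. dot (x \<omega>) t) \<in> borel_measurable M" by measurable
  have "(\<integral>\<^sup>+\<omega>. ennreal ((dot (x \<omega>) t)\<^sup>2) \<partial>M) = ennreal (LINT \<omega>|M. (dot (x \<omega>) t)\<^sup>2)"
    using scalar_prod_square_integrable[of "vec p t"]
    by (intro nn_integral_eq_integral) (auto simp: scalar_prod_dot_vec)
  also have "\<dots> = 1"
    using mat_norm_second_moment[of "vec p t"] t by (simp add: scalar_prod_dot_vec)
  finally have one: "(\<integral>\<^sup>+\<omega>. ennreal ((dot (x \<omega>) t)\<^sup>2) \<partial>M) = 1" .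
  have tail: "prob {\<omega> \<in> space M. \<upsilon> * a \<le> \<bar>dot (x \<omega>) t\<bar>} \<le> 2 * exp (- a)" if "0 \<le> a" for a
    using subexp_tail[OF B3, of "vec p t" 1 a] t that by (simp add: scalar_prod_dot_vec)
  have "ennreal (9 / 16 * f\<^sub>l * h) = ennreal (3 / 4 * f\<^sub>l * h) * ennreal (3 / 4)"
    using fpos rlh by (simp flip: ennreal_mult)
  also have "\<dots> \<le> ennreal (3 / 4 * f\<^sub>l * h) * (\<integral>\<^sup>+\<omega>. ennreal (truncated_square R (dot (x \<omega>) t)) \<partial>M)"
    by (intro mult_left_mono truncated_square_expectation_ge[OF _ upsilon_ge_1 tail R_ge(2) one]) auto
  also have "\<dots> \<le> (\<integral>\<^sup>+\<omega>. ennreal (truncated_square R (dot (x \<omega>) t)) * indicator {- (h / 2)..h / 2} (\<epsilon> \<omega>) \<partial>M)"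
    using rlh by (intro condition_B1_window(1)[OF B1]) measurable
  also have "\<dots> = (\<integral>\<^sup>+\<omega>. ennreal (g t (y \<omega>, x \<omega>)) \<partial>M)"
    by (intro nn_integral_cong) (simp add: g_def window_model indicator_def)
  also have "\<dots> = (\<integral>\<^sup>+z. ennreal (g t z) \<partial>\<mu>)" by (intro nn_integral_\<mu>[symmetric]) measurable
  also have "\<dots> = ennreal (LINT z|\<mu>. g t z)"
    using g_nonneg g_le by (intro nn_integral_eq_integral \<mu>.integrable_const_bound[of _ "R\<^sup>2"]) auto
  finally show ?thesis
    using g_nonneg by (subst (asm) ennreal_le_iff) (auto intro!: integral_nonneg_AE)
qed

text \<open>As the window only takes the values 0 and 1, it factors out of \<open>cosh - 1\<close>,
  and \<open>240 = 5/4 * 192\<close>. A coordinate is the linear form of a unit vector, whose norm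
  is at most \<open>\<sigma>\<close>.\<close>

lemma cosh_moment_le:
  assumes j: "j < p" and c: "0 \<le> c" "c * (\<upsilon> * \<sigma>) \<le> 1 / 4"
  shows "(\<integral>\<^sup>+z. ennreal (cosh (c * (window z * snd z j))) \<partial>\<mu>) \<le> ennreal (1 + 240 * f\<^sub>u * h * (c * (\<upsilon> * \<sigma>))\<^sup>2)"
proof -
  note [measurable] = snd_coord_measurable[OF j] coord_measurable[OF j]
  have v [measurable]: "(\<lambda>v. v j) \<in> borel_measurable (rvec_space p)"
    by (rule measurable_component_singleton) (use j in simp)
  have [measurable]: "(\<lambda>z. cosh (c * (window z * snd z j))) \<in> borel_measurable (borel \<Otimes>\<^sub>M rvec_space p)"
    unfolding cosh_def by measurable
  have [measurable]: "(\<lambda>\<omega>. cosh (c * x \<omega> j)) \<in> borel_measurable M"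
    unfolding cosh_def by measurable
  have [measurable]: "(\<lambda>v. cosh (c * v j)) \<in> borel_measurable (rvec_space p)"
    unfolding cosh_def by measurable
  have pos: "0 \<le> cosh (c * a) - 1" for a using cosh_real_ge_1[of "c * a"] by simp
  have moment: "(\<integral>\<^sup>+\<omega>. ennreal (cosh (c * x \<omega> j) - 1) \<partial>M) \<le> ennreal (192 * (c * (\<upsilon> * \<sigma>))\<^sup>2)"
  proof (rule subexp_cosh_moment)
    show "0 < \<upsilon> * \<sigma>" using upsilon_ge_1 \<sigma>_ge_1 by simp
    fix a :: real assume a: "0 \<le> a"
    have unit: "vec p (x \<omega>) \<bullet> unit_vec p j = x \<omega> j" for \<omega>
      using j by (simp add: scalar_prod_right_unit)
    have "(mat_norm \<Sigma> (unit_vec p j))\<^sup>2 = (LINT \<omega>|M. (x \<omega> j)\<^sup>2)"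
      by (subst mat_norm_second_moment) (simp_all only: unit unit_vec_carrier)
    also have "\<dots> \<le> sigma_x_sq M p x" by (rule second_moment_le[OF j])
    also have "\<dots> = \<sigma>\<^sup>2" using sigma_x_sq_ge_1 by (simp add: \<sigma>_def)
    finally have sq: "(mat_norm \<Sigma> (unit_vec p j))\<^sup>2 \<le> \<sigma>\<^sup>2" .
    have "0 \<le> \<sigma>" using \<sigma>_ge_1 by simp
    with sq have "mat_norm \<Sigma> (unit_vec p j) \<le> \<sigma>" by (rule power2_le_imp_le)
    from subexp_tail[OF B3 _ this _ a] \<sigma>_ge_1
    show "prob {\<omega> \<in> space M. \<upsilon> * \<sigma> * a \<le> \<bar>x \<omega> j\<bar>} \<le> 2 * exp (- a)"
      by (simp only: unit unit_vec_carrier)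
  qed (fact coord_measurable[OF j], fact c, fact c)
  have "(\<integral>\<^sup>+z. ennreal (cosh (c * (window z * snd z j))) \<partial>\<mu>) =
      (\<integral>\<^sup>+\<omega>. ennreal (cosh (c * (window (y \<omega>, x \<omega>) * x \<omega> j))) \<partial>M)"
    by (subst nn_integral_\<mu>) auto
  also have "\<dots> = (\<integral>\<^sup>+\<omega>. 1 + ennreal (cosh (c * x \<omega> j) - 1) * indicator {- (h / 2)..h / 2} (\<epsilon> \<omega>) \<partial>M)"
  proof (intro nn_integral_cong)
    fix \<omega> assume \<omega>: "\<omega> \<in> space M"
    have "1 + ennreal (cosh (c * x \<omega> j) - 1) = ennreal (cosh (c * x \<omega> j))"
      unfolding ennreal_1[symmetric] by (subst ennreal_plus[symmetric]) (use pos in simp_all)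
    then show "ennreal (cosh (c * (window (y \<omega>, x \<omega>) * x \<omega> j))) =
        1 + ennreal (cosh (c * x \<omega> j) - 1) * indicator {- (h / 2)..h / 2} (\<epsilon> \<omega>)"
      by (cases "\<epsilon> \<omega> \<in> {- (h / 2)..h / 2}") (simp_all add: window_model[OF \<omega>])
  qed
  also have "\<dots> = 1 + (\<integral>\<^sup>+\<omega>. ennreal (cosh (c * x \<omega> j) - 1) * indicator {- (h / 2)..h / 2} (\<epsilon> \<omega>) \<partial>M)"
    using j by (subst nn_integral_add) (auto simp: emeasure_space_1)
  also have "\<dots> \<le> 1 + ennreal (5 / 4 * f\<^sub>u * h) * (\<integral>\<^sup>+\<omega>. ennreal (cosh (c * x \<omega> j) - 1) \<partial>M)"
    using rlh j by (intro add_left_mono condition_B1_window(2)[OF B1]) measurable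
  also have "\<dots> \<le> 1 + ennreal (5 / 4 * f\<^sub>u * h) * ennreal (192 * (c * (\<upsilon> * \<sigma>))\<^sup>2)"
    by (intro add_left_mono mult_left_mono moment) simp
  also have "\<dots> = ennreal (1 + 240 * f\<^sub>u * h * (c * (\<upsilon> * \<sigma>))\<^sup>2)"
    using fpos rlh by (simp flip: ennreal_mult ennreal_plus ennreal_1)
  finally show ?thesis .
qed

text \<open>Chernoff's bound for the process scaled by \<open>\<theta>\<close>. Its slope
  \<open>8 \<theta> R\<close>, doubled by symmetrisation and multiplied by the radius
  \<open>l\<close>, gives \<open>16 l \<theta> R\<close>.\<close>

lemma empirical_deviation_PiM:
  assumes T: "finite T" "T \<noteq> {}" "\<And>t. t \<in> T \<Longrightarrow> mat_norm \<Sigma> (vec p t) = 1" "\<And>t. t \<in> T \<Longrightarrow> (\<Sum>j<p. \<bar>t j\<bar>) \<le> l"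
    and \<theta>: "0 \<le> \<theta>" "16 * l * \<theta> * R * (\<upsilon> * \<sigma>) \<le> 1 / 4"
  shows "emeasure (\<Pi>\<^sub>M i\<in>{..<n}. \<mu>) {Z \<in> space (\<Pi>\<^sub>M i\<in>{..<n}. \<mu>). \<exists>t\<in>T. (\<Sum>i<n. g t (Z i)) < n * (f\<^sub>l * h / 2)} \<le>
    ennreal (exp (- \<theta> * (n * (f\<^sub>l * h / 16))) * (2 * p) *
      (1 + 240 * f\<^sub>u * h * (16 * l * \<theta> * R * (\<upsilon> * \<sigma>))\<^sup>2) ^ n)"
proof -
  let ?P = "\<Pi>\<^sub>M i\<in>{..<n}. \<mu>"
  define s where "s = n * (f\<^sub>l * h / 16)"
  define B where "B = 1 + 240 * f\<^sub>u * h * (16 * l * \<theta> * R * (\<upsilon> * \<sigma>))\<^sup>2"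
  have "0 \<le> B" using fpos rlh by (simp add: B_def)
  \<comment> \<open>The weight \<open>w = 0\<close> is written out to match the inductive form;
    \<open>cosh 0 = 1\<close> then leaves the prefactor \<open>2 p\<close>.\<close>
  define F where "F = (\<lambda>Z. exp (MAX t\<in>T. (\<Sum>j<p. 0 * t j) + (\<Sum>i<n. (LINT z|\<mu>. \<theta> * g t z) - \<theta> * g t (Z i))))"
  have [measurable]: "F \<in> borel_measurable ?P" unfolding F_def using T by measurable
  have "emeasure ?P {Z \<in> space ?P. \<exists>t\<in>T. (\<Sum>i<n. g t (Z i)) < n * (f\<^sub>l * h / 2)} \<le>
     emeasure ?P {Z \<in> space ?P. 1 \<le> ennreal (exp (- \<theta> * s)) * ennreal (F Z)}"
  proof (intro emeasure_mono)
    show "{Z \<in> space ?P. \<exists>t\<in>T. (\<Sum>i<n. g t (Z i)) < n * (f\<^sub>l * h / 2)} \<subseteq>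
      {Z \<in> space ?P. 1 \<le> ennreal (exp (- \<theta> * s)) * ennreal (F Z)}"
    proof safe
      fix Z t assume t: "t \<in> T" "(\<Sum>i<n. g t (Z i)) < n * (f\<^sub>l * h / 2)"
      \<comment> \<open>The deviation \<open>s\<close> is the gap \<open>9/16 - 1/2 = 1/16\<close>
        between mean and target.\<close>
      have "n * (9 / 16 * f\<^sub>l * h) \<le> n * (LINT z|\<mu>. g t z)"
        using expectation_g_ge T t by (intro mult_left_mono) auto
      then have "s \<le> n * (LINT z|\<mu>. g t z) - (\<Sum>i<n. g t (Z i))"
        using t by (simp add: s_def)
      then have "\<theta> * s \<le> \<theta> * (n * (LINT z|\<mu>. g t z) - (\<Sum>i<n. g t (Z i)))"
        using \<theta> by (intro mult_left_mono)
      also have "\<dots> = (\<Sum>j<p. 0 * t j) + (\<Sum>i<n. (LINT z|\<mu>. \<theta> * g t z) - \<theta> * g t (Z i))"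
        by (simp add: sum_subtractf right_diff_distrib sum_distrib_left mult_ac)
      also have "\<dots> \<le> (MAX t\<in>T. (\<Sum>j<p. 0 * t j) + (\<Sum>i<n. (LINT z|\<mu>. \<theta> * g t z) - \<theta> * g t (Z i)))"
        using T t by (intro Max_ge) auto
      finally have "1 \<le> exp (- \<theta> * s) * F Z"
        unfolding F_def by (simp flip: exp_add)
      then show "1 \<le> ennreal (exp (- \<theta> * s)) * ennreal (F Z)"
        by (simp add: F_def ennreal_leI flip: ennreal_mult ennreal_1)
    qed
  qed measurable
  also have "\<dots> \<le> ennreal (exp (- \<theta> * s)) * (\<integral>\<^sup>+Z. ennreal (F Z) * indicator (space ?P) Z \<partial>?P)"
    by (rule nn_integral_Markov_inequality) auto
  also have "(\<integral>\<^sup>+Z. ennreal (F Z) * indicator (space ?P) Z \<partial>?P) = (\<integral>\<^sup>+Z. ennreal (F Z) \<partial>?P)"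
    by (intro nn_integral_cong) simp
  also have "\<dots> \<le> ennreal (\<Sum>j<p. 2 * cosh (l * 0)) * ennreal B ^ n"
    unfolding F_def
  proof (rule \<mu>.exp_Max_empirical_process[where u = "\<lambda>j z. \<theta> * 8 * R * window z * snd z j" and b = "\<theta> * R\<^sup>2", OF T(1,2)])
    have lin: "(\<Sum>j<p. \<theta> * 8 * R * window z * snd z j * t j) = \<theta> * (8 * R * window z * dot (snd z) t)" for z t
      by (simp add: dot_def sum_distrib_left mult_ac)
    show "p > 0" using intercept by simp
    fix s t z
    show "\<theta> * g t z \<le> \<theta> * R\<^sup>2" using \<theta> g_le by (intro mult_left_mono)
    show "0 \<le> \<theta> * g t z" using \<theta> g_nonneg by simp
    show "\<theta> * g t z \<le> \<bar>\<Sum>j<p. \<theta> * 8 * R * window z * snd z j * t j\<bar>"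
      unfolding lin abs_mult[of \<theta>] using \<theta> g_linear by (simp add: mult_left_mono)
    show "\<bar>\<theta> * g s z - \<theta> * g t z\<bar> \<le>
        \<bar>(\<Sum>j<p. \<theta> * 8 * R * window z * snd z j * s j) - (\<Sum>j<p. \<theta> * 8 * R * window z * snd z j * t j)\<bar>"
      unfolding lin right_diff_distrib[symmetric, of \<theta>] abs_mult[of \<theta>] using \<theta> g_lipschitz by (simp add: mult_left_mono)
  next
    fix j assume j: "j < p"
    have "(\<integral>\<^sup>+z. ennreal (cosh (16 * l * \<theta> * R * (window z * snd z j))) \<partial>\<mu>) \<le> ennreal B"
      unfolding B_def using \<theta> rlh R_ge by (intro cosh_moment_le j) auto
    then show "(\<integral>\<^sup>+z. ennreal (cosh (2 * l * (\<theta> * 8 * R * window z * snd z j))) \<partial>\<mu>) \<le> ennreal B"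
      by (simp add: mult_ac)
    note [measurable] = snd_coord_measurable[OF j]
    show "(\<lambda>z. \<theta> * 8 * R * window z * snd z j) \<in> borel_measurable \<mu>"
      by measurable
  qed (use T in auto)
  also have "ennreal (exp (- \<theta> * s)) * (ennreal (\<Sum>j<p. 2 * cosh (l * 0)) * ennreal B ^ n) =
      ennreal (exp (- \<theta> * s) * (2 * p) * B ^ n)"
    using \<open>0 \<le> B\<close> by (simp add: ennreal_power ennreal_mult mult_ac)
  finally show ?thesis by (simp add: s_def B_def mult_left_mono)
qed

lemma sample_measurable [measurable]: "i < n \<Longrightarrow> (\<lambda>\<omega>. (Y i \<omega>, X i \<omega>)) \<in> measurable M (borel \<Otimes>\<^sub>M rvec_space p)"
  using indep by (auto simp: indep_vars_def)

lemma distr_sample: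
  assumes "n > 0"
  shows "distr M (\<Pi>\<^sub>M i\<in>{..<n}. \<mu>) (\<lambda>\<omega>. \<lambda>i\<in>{..<n}. (Y i \<omega>, X i \<omega>)) = (\<Pi>\<^sub>M i\<in>{..<n}. \<mu>)"
proof -
  have "distr M (\<Pi>\<^sub>M i\<in>{..<n}. \<mu>) (\<lambda>\<omega>. \<lambda>i\<in>{..<n}. (Y i \<omega>, X i \<omega>)) =
      distr M (\<Pi>\<^sub>M i\<in>{..<n}. borel \<Otimes>\<^sub>M rvec_space p) (\<lambda>\<omega>. \<lambda>i\<in>{..<n}. (Y i \<omega>, X i \<omega>))"
    by (intro distr_cong sets_PiM_cong) auto
  also have "\<dots> = (\<Pi>\<^sub>M i\<in>{..<n}. distr M (borel \<Otimes>\<^sub>M rvec_space p) (\<lambda>\<omega>. (Y i \<omega>, X i \<omega>)))"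
    using indep assms by (subst (asm) indep_vars_iff_distr_eq_PiM') auto
  also have "\<dots> = (\<Pi>\<^sub>M i\<in>{..<n}. \<mu>)"
    by (intro PiM_cong refl) (simp add: ident \<mu>_def)
  finally show ?thesis .
qed

lemma empirical_deviation:
  assumes n: "n > 0" and T: "finite T" "T \<noteq> {}" "\<And>t. t \<in> T \<Longrightarrow> mat_norm \<Sigma> (vec p t) = 1" "\<And>t. t \<in> T \<Longrightarrow> (\<Sum>j<p. \<bar>t j\<bar>) \<le> l"
    and \<theta>: "0 \<le> \<theta>" "16 * l * \<theta> * R * (\<upsilon> * \<sigma>) \<le> 1 / 4"
  shows "prob {\<omega> \<in> space M. \<exists>t\<in>T. (\<Sum>i<n. g t (Y i \<omega>, X i \<omega>)) < n * (f\<^sub>l * h / 2)} \<le>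
    exp (- \<theta> * (n * (f\<^sub>l * h / 16))) * (2 * p) * (1 + 240 * f\<^sub>u * h * (16 * l * \<theta> * R * (\<upsilon> * \<sigma>))\<^sup>2) ^ n"
proof -
  let ?P = "\<Pi>\<^sub>M i\<in>{..<n}. \<mu>"
  let ?E = "{Z \<in> space ?P. \<exists>t\<in>T. (\<Sum>i<n. g t (Z i)) < n * (f\<^sub>l * h / 2)}"
  let ?Z = "\<lambda>\<omega>. \<lambda>i\<in>{..<n}. (Y i \<omega>, X i \<omega>)"
  have Z: "?Z \<in> measurable M ?P" by (intro measurable_restrict) simp
  have E: "?E \<in> sets ?P" using T by measurable
  have "emeasure M {\<omega> \<in> space M. \<exists>t\<in>T. (\<Sum>i<n. g t (Y i \<omega>, X i \<omega>)) < n * (f\<^sub>l * h / 2)} =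
      emeasure M (?Z -` ?E \<inter> space M)"
    using measurable_space[OF Z] by (intro arg_cong[where f = "emeasure M"]) auto
  also have "\<dots> = emeasure (distr M ?P ?Z) ?E" by (intro emeasure_distr[symmetric] Z E)
  also have "\<dots> = emeasure ?P ?E" by (simp only: distr_sample[OF n])
  also have "\<dots> \<le> ennreal (exp (- \<theta> * (n * (f\<^sub>l * h / 16))) * (2 * p) * (1 + 240 * f\<^sub>u * h * (16 * l * \<theta> * R * (\<upsilon> * \<sigma>))\<^sup>2) ^ n)"
    by (intro empirical_deviation_PiM T \<theta>)
  finally show ?thesis
    using fpos rlh by (simp add: emeasure_eq_measure)
qed

end

section \<open>Restricted strong convexity\<close>

text \<open>One point of \<open>S\<close> is chosen in each basic open set that meets
  \<open>S\<close>. A dense subset of the whole space might miss \<open>S\<close>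
  altogether.\<close>

lemma countable_dense_subset:
  fixes S :: "'a :: second_countable_topology set"
  obtains Q where "countable Q" "Q \<subseteq> S" "\<And>U. open U \<Longrightarrow> U \<inter> S \<noteq> {} \<Longrightarrow> U \<inter> Q \<noteq> {}"
proof -
  obtain B :: "'a set set" where B: "countable B" "topological_basis B"
    using ex_countable_basis by blast
  define f where "f = (\<lambda>b. SOME x. x \<in> b \<inter> S)"
  have f: "f b \<in> b \<inter> S" if "b \<inter> S \<noteq> {}" for b
    unfolding f_def using that someI_ex[of "\<lambda>x. x \<in> b \<inter> S"] by blast
  show ?thesis
  proof
    show "countable (f ` {b \<in> B. b \<inter> S \<noteq> {}})" using B(1) by auto
    show "f ` {b \<in> B. b \<inter> S \<noteq> {}} \<subseteq> S" using f by blast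
    fix U :: "'a set" assume "open U" "U \<inter> S \<noteq> {}"
    then obtain x where x: "x \<in> U" "x \<in> S" by blast
    then obtain b where b: "b \<in> B" "x \<in> b" "b \<subseteq> U"
      using topological_basisE[OF B(2) \<open>open U\<close>] by blast
    then have "f b \<in> b" "b \<inter> S \<noteq> {}" using f[of b] x by blast+
    then show "U \<inter> f ` {b \<in> B. b \<inter> S \<noteq> {}} \<noteq> {}" using b by blast
  qed
qed

text \<open>The value of \<open>\<theta>\<close> minimises \<open>- \<theta>ms + 240 f\<^sub>uh (\<theta>c)\<^sup>2 m\<close> with \<open>s = f\<^sub>lh/16\<close>; the minimum is
  \<open>- ms\<^sup>2/(960 f\<^sub>uhc\<^sup>2)\<close>, whence the constant \<open>31457280 = 2 * 960 * 8\<^sup>2 * 16\<^sup>2\<close>.\<close>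
lemma deviation_exponent:
  fixes f\<^sub>l f\<^sub>u h l r \<upsilon> \<sigma> P :: real and m :: nat
  assumes pos: "0 < f\<^sub>l" "f\<^sub>l \<le> f\<^sub>u" "0 < h" "0 < l" "0 < r" "1 \<le> \<upsilon>" "1 \<le> l * \<sigma>" "0 < \<sigma>" "1 \<le> P"
    and hr: "20 * \<upsilon>\<^sup>2 * r \<le> h"
    and m: "31457280 * \<upsilon>\<^sup>2 * \<sigma>\<^sup>2 * f\<^sub>u / f\<^sub>l\<^sup>2 * (l / r)\<^sup>2 * h * ln P \<le> real m"
  defines "c \<equiv> 8 * (h / r) * (l * \<sigma>) * \<upsilon>"
  defines "\<theta> \<equiv> (f\<^sub>l * h / 16) / (480 * f\<^sub>u * h * c\<^sup>2)"
  shows "0 \<le> \<theta>" "\<theta> * c \<le> 1 / 4"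
    "exp (- \<theta> * (m * (f\<^sub>l * h / 16))) * P * (1 + 240 * f\<^sub>u * h * (\<theta> * c)\<^sup>2) ^ m \<le> 1 / P"
proof -
  define s where "s = f\<^sub>l * h / 16"
  define A where "A = f\<^sub>u * h * c\<^sup>2"
  have fu: "0 < f\<^sub>u" using pos by linarith
  have s: "0 < s" using pos by (simp add: s_def)
  have "20 * r \<le> h"
  proof -
    have "1 \<le> \<upsilon>\<^sup>2" using pos by simp
    then have "20 * r \<le> 20 * \<upsilon>\<^sup>2 * r" using pos by simp
    then show ?thesis using hr by linarith
  qed
  then have "20 \<le> h / r" using pos by (simp add: field_simps)
  \<comment> \<open>A lower bound on \<open>c\<close> is enough for
    \<open>\<theta> c \<le> 1/4\<close>, and each factor beyond \<open>h / r \<ge> 20\<close> is at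
    least 1.\<close>
  then have "20 \<le> (h / r) * (l * \<sigma>)" using mult_mono[of 20 "h / r" 1 "l * \<sigma>"] pos by simp
  then have "20 \<le> ((h / r) * (l * \<sigma>)) * \<upsilon>"
    using mult_mono[of 20 "(h / r) * (l * \<sigma>)" 1 \<upsilon>] pos by simp
  then have c: "160 \<le> c" by (simp add: c_def)
  have A: "0 < A" using fu pos c by (simp add: A_def)
  have \<theta>: "\<theta> = s / (480 * A)" by (simp add: \<theta>_def s_def A_def)
  show "0 \<le> \<theta>" unfolding \<theta> using s A by simp
  have "\<theta> * c = f\<^sub>l / (7680 * f\<^sub>u * c)"
    unfolding \<theta> s_def A_def using c pos fu by (simp add: field_simps power2_eq_square)
  also have "\<dots> \<le> 1 / 4"
  proof -
    have "f\<^sub>l * 1 \<le> (f\<^sub>u * 1920) * c" using pos fu c by (intro mult_mono) auto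
    then show ?thesis using c fu by (simp add: field_simps)
  qed
  finally show "\<theta> * c \<le> 1 / 4" .
  have A_eq: "1920 * A * ln P = (31457280 * \<upsilon>\<^sup>2 * \<sigma>\<^sup>2 * f\<^sub>u / f\<^sub>l\<^sup>2 * (l / r)\<^sup>2 * h * ln P) * s\<^sup>2"
    unfolding A_def c_def s_def using pos by (simp add: field_simps power2_eq_square)
  have "1920 * A * ln P \<le> m * s\<^sup>2"
    unfolding A_eq using m by (intro mult_right_mono) auto
  \<comment> \<open>Twice \<open>ln P\<close>: one copy pays for the prefactor \<open>P\<close>, the
    other leaves \<open>1 / P\<close>.\<close>
  then have key: "2 * ln P \<le> m * s\<^sup>2 / (960 * A)"
    using A by (simp add: field_simps)
  have "240 * f\<^sub>u * h * (\<theta> * c)\<^sup>2 = 240 * A * \<theta>\<^sup>2" by (simp add: A_def power_mult_distrib)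
  also have "\<dots> = s\<^sup>2 / (960 * A)"
    unfolding \<theta> using A by (simp add: field_simps power2_eq_square)
  finally have sq: "240 * f\<^sub>u * h * (\<theta> * c)\<^sup>2 = s\<^sup>2 / (960 * A)" .
  have nn: "0 \<le> s\<^sup>2 / (960 * A)" using A by simp
  have "(1 + s\<^sup>2 / (960 * A)) ^ m \<le> exp (s\<^sup>2 / (960 * A)) ^ m"
    using nn exp_ge_add_one_self by (intro power_mono) auto
  also have "\<dots> = exp (m * s\<^sup>2 / (960 * A))" by (simp flip: exp_of_nat_mult)
  finally have pw: "(1 + s\<^sup>2 / (960 * A)) ^ m \<le> exp (m * s\<^sup>2 / (960 * A))" .
  have "\<theta> * (m * s) = 2 * (m * s\<^sup>2 / (960 * A))"
    unfolding \<theta> using A by (simp add: field_simps power2_eq_square)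
  then have ex: "exp (- \<theta> * (m * s)) * exp (m * s\<^sup>2 / (960 * A)) = exp (- (m * s\<^sup>2 / (960 * A)))"
    by (simp flip: exp_add)
  have "exp (- \<theta> * (m * s)) * P * (1 + s\<^sup>2 / (960 * A)) ^ m \<le>
      exp (- \<theta> * (m * s)) * P * exp (m * s\<^sup>2 / (960 * A))"
    using pos by (intro mult_left_mono pw) auto
  also have "\<dots> = P * exp (- (m * s\<^sup>2 / (960 * A)))"
    unfolding ex[symmetric] by simp
  also have "\<dots> \<le> P * exp (- (2 * ln P))"
    using key pos by (intro mult_left_mono) auto
  also have "\<dots> = 1 / P"
  proof -
    have "exp (- (2 * ln P)) = inverse (exp (ln P + ln P))" by (simp add: exp_minus)
    also have "\<dots> = inverse (P * P)" using pos by (simp only: exp_add) simp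
    finally show ?thesis using pos by (simp add: field_simps)
  qed
  finally show "exp (- \<theta> * (m * (f\<^sub>l * h / 16))) * P * (1 + 240 * f\<^sub>u * h * (\<theta> * c)\<^sup>2) ^ m \<le> 1 / P"
    unfolding sq s_def .
qed

section \<open>From finite sets of directions to the cone\<close>

context rsc_setting
begin

lemma lift_vec: "\<delta> \<in> carrier_vec p \<Longrightarrow> vec p (\<lambda>j. \<delta> $ j) = \<delta>"
  by (intro eq_vecI) auto

definition l1_cone :: "(nat \<Rightarrow> real) set" where
  "l1_cone = {d. mat_norm \<Sigma> (vec p d) \<le> r \<and> l1_norm (vec p d) \<le> l * mat_norm \<Sigma> (vec p d)}"

text \<open>Left minus right side of the strong convexity inequality, with the gradients already
  evaluated; in this form continuity in \<open>d\<close> and measurability in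
  \<open>\<omega>\<close> are accessible.\<close>

definition margin :: "(real \<Rightarrow> real) \<Rightarrow> real \<Rightarrow> 'a \<Rightarrow> (nat \<Rightarrow> real) \<Rightarrow> real" where
  "margin K \<kappa> \<omega> d = 1 / real n * (\<Sum>i<n.
      (kernel_cdf K ((dot (X i \<omega>) d - (Y i \<omega> - dot (X i \<omega>) (\<lambda>j. \<beta>s $ j))) / h) -
       kernel_cdf K (- (Y i \<omega> - dot (X i \<omega>) (\<lambda>j. \<beta>s $ j)) / h)) * dot (X i \<omega>) d) -
    \<kappa> * (mat_norm \<Sigma> (vec p d))\<^sup>2"

lemma rsc_event_eq:
  assumes B2: "condition_B2 K"
  shows "rsc_event M \<tau> K h p n X Y \<Sigma> \<beta>s r l \<kappa> = {\<omega> \<in> space M. \<forall>d\<in>l1_cone. 0 \<le> margin K \<kappa> \<omega> d}"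
proof -
  have eq: "(\<kappa> * (mat_norm \<Sigma> (\<beta> - \<beta>s))\<^sup>2 \<le>
      (gradient p (empirical_loss \<tau> K h p n (\<lambda>i. X i \<omega>) (\<lambda>i. Y i \<omega>)) \<beta> -
       gradient p (empirical_loss \<tau> K h p n (\<lambda>i. X i \<omega>) (\<lambda>i. Y i \<omega>)) \<beta>s) \<bullet> (\<beta> - \<beta>s)) \<longleftrightarrow>
      0 \<le> margin K \<kappa> \<omega> (\<lambda>j. (\<beta> - \<beta>s) $ j)" if \<beta>: "\<beta> \<in> carrier_vec p" for \<beta> \<omega>
  proof -
    have \<delta>: "\<beta> - \<beta>s \<in> carrier_vec p" using \<beta> \<beta>s by simp
    show ?thesis
      unfolding gradient_diff_scalar_prod[OF B2 rlh(3) \<beta> \<beta>s refl refl] margin_def lift_vec[OF \<delta>]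
        scalar_prod_dot[OF \<delta>] scalar_prod_dot[OF \<beta>s]
      by (simp only: diff_ge_0_iff_ge)
  qed
  show ?thesis
  proof (unfold rsc_event_def Let_def, intro Set.set_eqI iffI CollectI conjI ballI)
    fix \<omega> d
    assume \<omega>: "\<omega> \<in> {\<omega> \<in> space M. \<forall>\<beta>\<in>carrier_vec p. mat_norm \<Sigma> (\<beta> - \<beta>s) \<le> r \<and> l1_norm (\<beta> - \<beta>s) \<le> l * mat_norm \<Sigma> (\<beta> - \<beta>s) \<longrightarrow>
       (gradient p (empirical_loss \<tau> K h p n (\<lambda>i. X i \<omega>) (\<lambda>i. Y i \<omega>)) \<beta> -
       gradient p (empirical_loss \<tau> K h p n (\<lambda>i. X i \<omega>) (\<lambda>i. Y i \<omega>)) \<beta>s) \<bullet> (\<beta> - \<beta>s) \<ge> \<kappa> * (mat_norm \<Sigma> (\<beta> - \<beta>s))\<^sup>2}"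
    show "\<omega> \<in> space M" using \<omega> by simp
    assume d: "d \<in> l1_cone"
    have \<beta>: "\<beta>s + vec p d \<in> carrier_vec p" using \<beta>s by simp
    have diff: "\<beta>s + vec p d - \<beta>s = vec p d" using \<beta>s by (intro eq_vecI) auto
    have "0 \<le> margin K \<kappa> \<omega> (\<lambda>j. (\<beta>s + vec p d - \<beta>s) $ j)"
      using \<omega> d unfolding eq[OF \<beta>, symmetric] by (auto dest!: bspec[OF _ \<beta>] simp: l1_cone_def diff)
    moreover have "margin K \<kappa> \<omega> (\<lambda>j. (\<beta>s + vec p d - \<beta>s) $ j) = margin K \<kappa> \<omega> d"
    proof -
      have "dot v (\<lambda>j. vec p d $ j) = dot v d" for v by (simp add: dot_def)
      moreover have "vec p (\<lambda>j. vec p d $ j) = vec p d" by (intro eq_vecI) auto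
      ultimately show ?thesis unfolding margin_def diff by simp
    qed
    ultimately show "0 \<le> margin K \<kappa> \<omega> d" by simp
  next
    fix \<omega> assume \<omega>: "\<omega> \<in> {\<omega> \<in> space M. \<forall>d\<in>l1_cone. 0 \<le> margin K \<kappa> \<omega> d}"
    then show "\<omega> \<in> space M" by simp
    fix \<beta> :: "real vec" assume \<beta>: "\<beta> \<in> carrier_vec p"
    then have \<delta>: "\<beta> - \<beta>s \<in> carrier_vec p" using \<beta>s by simp
    show "mat_norm \<Sigma> (\<beta> - \<beta>s) \<le> r \<and> l1_norm (\<beta> - \<beta>s) \<le> l * mat_norm \<Sigma> (\<beta> - \<beta>s) \<longrightarrow>
       (gradient p (empirical_loss \<tau> K h p n (\<lambda>i. X i \<omega>) (\<lambda>i. Y i \<omega>)) \<beta> -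
       gradient p (empirical_loss \<tau> K h p n (\<lambda>i. X i \<omega>) (\<lambda>i. Y i \<omega>)) \<beta>s) \<bullet> (\<beta> - \<beta>s) \<ge> \<kappa> * (mat_norm \<Sigma> (\<beta> - \<beta>s))\<^sup>2"
      using \<omega> lift_vec[OF \<delta>] unfolding eq[OF \<beta>] by (auto simp: l1_cone_def)
  qed
qed

lemma mat_norm_quadratic: "(mat_norm \<Sigma> (vec p d))\<^sup>2 = (\<Sum>i<p. \<Sum>j<p. d i * d j * (LINT \<omega>|M. x \<omega> i * x \<omega> j))"
  by (simp add: mat_norm_second_moment scalar_prod_second_moment)

lemma margin_continuous:
  assumes B2: "condition_B2 K"
  shows "continuous_on UNIV (margin K \<kappa> \<omega>)"
proof -
  have K: "continuous_on UNIV (kernel_cdf K)"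
    using kernel_cdf_isCont[OF B2] by (simp add: continuous_on_eq_continuous_at)
  have d: "continuous_on UNIV (\<lambda>d :: nat \<Rightarrow> real. dot v d)" for v
    unfolding dot_def by (intro continuous_intros) auto
  show ?thesis
    unfolding margin_def mat_norm_quadratic
    by (intro continuous_intros continuous_on_compose2[OF K] d) (use rlh in auto)
qed

lemma margin_measurable:
  assumes B2: "condition_B2 K"
  shows "(\<lambda>\<omega>. margin K \<kappa> \<omega> d) \<in> borel_measurable M"
proof -
  have "continuous_on UNIV (kernel_cdf K)"
    using kernel_cdf_isCont[OF B2] by (simp add: continuous_on_eq_continuous_at)
  then have [measurable]: "kernel_cdf K \<in> borel_measurable borel"
    by (rule borel_measurable_continuous_onI)
  have [measurable]: "Y i \<in> borel_measurable M" "X i \<in> measurable M (rvec_space p)" if "i < n" for i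
    using measurable_compose[OF sample_measurable[OF that] measurable_fst]
      measurable_compose[OF sample_measurable[OF that] measurable_snd] by simp_all
  show ?thesis unfolding margin_def by measurable
qed

text \<open>The deterministic half: homogeneity returns the factor \<open>N\<^sup>2\<close>, and the
  \<open>h\<close> of the threshold cancels the \<open>1/h\<close> of the kernel bound, leaving
  \<open>\<kappa> f\<^sub>l / 2\<close>.\<close>

lemma margin_ge:
  assumes B2: "condition_B2 K" and \<kappa>: "\<And>u. \<bar>u\<bar> \<le> 1 \<Longrightarrow> \<kappa> \<le> K u" "0 \<le> \<kappa>" and n: "n > 0"
    and d: "d \<in> l1_cone" and t: "t = (\<lambda>j. d j / mat_norm \<Sigma> (vec p d))" and N: "0 < mat_norm \<Sigma> (vec p d)"
    and ge: "n * (f\<^sub>l * h / 2) \<le> (\<Sum>i<n. g t (Y i \<omega>, X i \<omega>))"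
  shows "0 \<le> margin K (\<kappa> * f\<^sub>l / 2) \<omega> d"
proof -
  define N where "N = mat_norm \<Sigma> (vec p d)"
  have N: "0 < N" "N \<le> r" using N d by (auto simp: N_def l1_cone_def)
  have dot_d: "dot v d = N * dot v t" for v
    unfolding t N_def[symmetric] dot_def using N by (simp add: sum_distrib_left)
  have summand: "\<kappa> / h * (N\<^sup>2 * g t (Y i \<omega>, X i \<omega>)) \<le>
      (kernel_cdf K ((dot (X i \<omega>) d - (Y i \<omega> - dot (X i \<omega>) (\<lambda>j. \<beta>s $ j))) / h) -
       kernel_cdf K (- (Y i \<omega> - dot (X i \<omega>) (\<lambda>j. \<beta>s $ j)) / h)) * dot (X i \<omega>) d" for i
  proof -
    define e v where "e = Y i \<omega> - dot (X i \<omega>) (\<lambda>j. \<beta>s $ j)" and "v = dot (X i \<omega>) d"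
    define a where "a = dot (X i \<omega>) t"
    have v: "v = N * a" by (simp add: v_def a_def dot_d)
    have w: "window (Y i \<omega>, X i \<omega>) = of_bool (\<bar>e\<bar> \<le> h / 2)"
    proof -
      have "e \<in> {- (h / 2)..h / 2} \<longleftrightarrow> \<bar>e\<bar> \<le> h / 2" by auto
      then show ?thesis by (simp add: window_def e_def[symmetric] indicator_def)
    qed
    \<comment> \<open>The radius enters here: \<open>N \<le> r\<close> turns the truncation level
      \<open>R = h / (2 r)\<close> into the half window \<open>h / 2\<close>.\<close>
    have small: "\<bar>v\<bar> \<le> h / 2" if "\<bar>a\<bar> \<le> R"
    proof -
      have "N * \<bar>a\<bar> \<le> r * R" using N that by (intro mult_mono) auto
      also have "r * R = h / 2" using rlh by (simp add: R_def)
      finally show ?thesis using N by (simp add: v abs_mult)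
    qed
    have "N\<^sup>2 * g t (Y i \<omega>, X i \<omega>) \<le> N\<^sup>2 * (of_bool (\<bar>e\<bar> \<le> h / 2) * (of_bool (\<bar>a\<bar> \<le> R) * a\<^sup>2))"
      unfolding g_def w a_def snd_conv by (intro mult_left_mono truncated_square_le) auto
    also have "\<dots> \<le> of_bool (\<bar>e\<bar> \<le> h / 2 \<and> \<bar>v\<bar> \<le> h / 2) * v\<^sup>2"
      using small by (auto simp: v power_mult_distrib)
    finally have "\<kappa> / h * (N\<^sup>2 * g t (Y i \<omega>, X i \<omega>)) \<le> \<kappa> / h * (of_bool (\<bar>e\<bar> \<le> h / 2 \<and> \<bar>v\<bar> \<le> h / 2) * v\<^sup>2)"
      using \<kappa> rlh by (intro mult_left_mono) auto
    also have "\<dots> \<le> (kernel_cdf K ((v - e) / h) - kernel_cdf K (- e / h)) * v"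
      by (rule kernel_cdf_increment_ge[OF B2 rlh(3) \<kappa>])
    finally show ?thesis by (simp only: e_def v_def)
  qed
  have "\<kappa> * f\<^sub>l / 2 * N\<^sup>2 = 1 / real n * (\<kappa> / h * (N\<^sup>2 * (n * (f\<^sub>l * h / 2))))"
    using n rlh by (simp add: field_simps)
  also have "\<dots> \<le> 1 / real n * (\<kappa> / h * (N\<^sup>2 * (\<Sum>i<n. g t (Y i \<omega>, X i \<omega>))))"
    using \<kappa> rlh ge by (intro mult_left_mono) auto
  also have "\<dots> = 1 / real n * (\<Sum>i<n. \<kappa> / h * (N\<^sup>2 * g t (Y i \<omega>, X i \<omega>)))"
    by (simp only: sum_distrib_left)
  also have "\<dots> \<le> 1 / real n * (\<Sum>i<n.
      (kernel_cdf K ((dot (X i \<omega>) d - (Y i \<omega> - dot (X i \<omega>) (\<lambda>j. \<beta>s $ j))) / h) -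
       kernel_cdf K (- (Y i \<omega> - dot (X i \<omega>) (\<lambda>j. \<beta>s $ j)) / h)) * dot (X i \<omega>) d)"
    by (intro mult_left_mono sum_mono summand) auto
  finally show ?thesis by (simp only: margin_def N_def diff_ge_0_iff_ge)
qed

text \<open>Treats the directions that cannot be normalised; by positive definiteness their
  coordinates below \<open>p\<close> vanish.\<close>

lemma margin_zero:
  assumes "mat_norm \<Sigma> (vec p d) = 0"
  shows "margin K \<kappa> \<omega> d = 0"
proof -
  have "vec p d = 0\<^sub>v p" using mat_norm_pos[of "vec p d"] assms by fastforce
  then have "d j = 0" if "j < p" for j
    using that by (metis index_vec index_zero_vec(1))
  then have "dot v d = 0" for v by (simp add: dot_def)
  then show ?thesis using assms by (simp add: margin_def)
qed

context
  fixes K :: "real \<Rightarrow> real" and \<kappa> :: real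
  assumes B2: "condition_B2 K" and \<kappa>: "\<And>u. \<bar>u\<bar> \<le> 1 \<Longrightarrow> \<kappa> \<le> K u" "0 \<le> \<kappa>"
    and n_ge: "31457280 * \<upsilon>\<^sup>2 * sigma_x_sq M p x * f\<^sub>u / f\<^sub>l\<^sup>2 * (l / r)\<^sup>2 * h * ln (2 * real p) \<le> real n"
begin

lemma sample_size_pos: "n > 0"
proof -
  have "0 < ln (2 * real p)" using intercept by simp
  then have "0 < 31457280 * \<upsilon>\<^sup>2 * sigma_x_sq M p x * f\<^sub>u / f\<^sub>l\<^sup>2 * (l / r)\<^sup>2 * h * ln (2 * real p)"
    using upsilon_ge_1 sigma_x_sq_ge_1 fpos rlh by simp
  then show ?thesis using n_ge by linarith
qed

lemma finite_cone_bound: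
  assumes Q: "finite Q" "Q \<subseteq> l1_cone"
  shows "prob {\<omega> \<in> space M. \<exists>d\<in>Q. margin K (\<kappa> * f\<^sub>l / 2) \<omega> d < 0} \<le> 1 / (2 * real p)"
proof -
  define N where "N = (\<lambda>d. mat_norm \<Sigma> (vec p d))"
  define T where "T = (\<lambda>d j. d j / N d) ` {d \<in> Q. 0 < N d}"
  have N: "0 < N d \<or> N d = 0" for d using mat_norm_nonneg[of "vec p d"] by (auto simp: N_def)
  show ?thesis
  proof (cases "T = {}")
    case True
    then have "N d = 0" if "d \<in> Q" for d using that N[of d] by (auto simp: T_def)
    then have empty: "{\<omega> \<in> space M. \<exists>d\<in>Q. margin K (\<kappa> * f\<^sub>l / 2) \<omega> d < 0} = {}"
      by (auto simp: N_def margin_zero)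
    show ?thesis unfolding empty by simp
  next
    case False
    have "finite T" using Q by (simp add: T_def)
    have vt: "vec p (\<lambda>j. d j / N d) = (1 / N d) \<cdot>\<^sub>v vec p d" for d by (intro eq_vecI) auto
    have T: "mat_norm \<Sigma> (vec p t) = 1" "(\<Sum>j<p. \<bar>t j\<bar>) \<le> l" if t: "t \<in> T" for t
    proof -
      obtain d where d: "d \<in> Q" "0 < N d" "t = (\<lambda>j. d j / N d)" using t by (auto simp: T_def)
      show "mat_norm \<Sigma> (vec p t) = 1"
        unfolding d(3) vt using d(2) by (subst mat_norm_smult) (auto simp: N_def)
      have "(\<Sum>j<p. \<bar>t j\<bar>) = l1_norm (vec p d) / N d"
        using d by (simp add: l1_norm_def sum_divide_distrib)
      also have "\<dots> \<le> l" using d Q by (auto simp: l1_cone_def N_def divide_le_eq)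
      finally show "(\<Sum>j<p. \<bar>t j\<bar>) \<le> l" .
    qed
    \<comment> \<open>Nonemptiness of \<open>T\<close> supplies this: a direction of norm 1 exists
      whose l1 norm is at most \<open>l\<close>.\<close>
    have l\<sigma>: "1 \<le> l * \<sigma>"
    proof -
      obtain t where t: "t \<in> T" using False by blast
      have "1 \<le> \<sigma> * l1_norm (vec p t)"
        using mat_norm_le_l1_norm[of "vec p t"] T(1)[OF t] by (simp add: \<sigma>_def)
      also have "\<dots> \<le> \<sigma> * l"
        using T(2)[OF t] \<sigma>_ge_1 by (intro mult_left_mono) (simp_all add: l1_norm_def)
      finally show ?thesis by (simp only: mult.commute)
    qed
    have \<sigma>2: "\<sigma>\<^sup>2 = sigma_x_sq M p x" using sigma_x_sq_ge_1 by (simp add: \<sigma>_def)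
    \<comment> \<open>\<open>\<theta> c\<close> is the argument of the moment bound, because
      \<open>16 R = 8 h / r\<close>.\<close>
    define c where "c = 8 * (h / r) * (l * \<sigma>) * \<upsilon>"
    define \<theta> where "\<theta> = (f\<^sub>l * h / 16) / (480 * f\<^sub>u * h * c\<^sup>2)"
    have \<sigma>0: "0 < \<sigma>" and P1: "1 \<le> 2 * real p" using \<sigma>_ge_1 intercept by simp_all
    note dev = deviation_exponent[OF fpos(1,2) rlh(3,2,1) upsilon_ge_1 l\<sigma> \<sigma>0 P1 rlh(4), of n,
      folded c_def, folded \<theta>_def, unfolded \<sigma>2, OF n_ge]
    have c: "16 * l * \<theta> * R * (\<upsilon> * \<sigma>) = \<theta> * c"
      using rlh by (simp add: R_def c_def field_simps)
    have "prob {\<omega> \<in> space M. \<exists>d\<in>Q. margin K (\<kappa> * f\<^sub>l / 2) \<omega> d < 0} \<le>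
        prob {\<omega> \<in> space M. \<exists>t\<in>T. (\<Sum>i<n. g t (Y i \<omega>, X i \<omega>)) < n * (f\<^sub>l * h / 2)}"
    proof (intro finite_measure_mono)
      show "{\<omega> \<in> space M. \<exists>d\<in>Q. margin K (\<kappa> * f\<^sub>l / 2) \<omega> d < 0} \<subseteq>
        {\<omega> \<in> space M. \<exists>t\<in>T. (\<Sum>i<n. g t (Y i \<omega>, X i \<omega>)) < n * (f\<^sub>l * h / 2)}"
      proof safe
        fix \<omega> d assume d: "d \<in> Q" "margin K (\<kappa> * f\<^sub>l / 2) \<omega> d < 0"
        then have "0 < N d" using N[of d] margin_zero[of d] by (auto simp: N_def)
        then have "(\<lambda>j. d j / N d) \<in> T" using d by (auto simp: T_def)
        moreover have "\<not> n * (f\<^sub>l * h / 2) \<le> (\<Sum>i<n. g (\<lambda>j. d j / N d) (Y i \<omega>, X i \<omega>))"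
          using margin_ge[OF B2 \<kappa> sample_size_pos, of d "\<lambda>j. d j / N d" \<omega>] d Q \<open>0 < N d\<close>
          by (auto simp: N_def)
        ultimately show "\<exists>t\<in>T. (\<Sum>i<n. g t (Y i \<omega>, X i \<omega>)) < n * (f\<^sub>l * h / 2)"
          by (meson not_le)
      qed
      have "(\<lambda>\<omega>. g t (Y i \<omega>, X i \<omega>)) \<in> borel_measurable M" if "i < n" for t i
        by (rule measurable_compose[OF sample_measurable[OF that] g_measurable])
      then have [measurable]: "(\<lambda>\<omega>. \<Sum>i<n. g t (Y i \<omega>, X i \<omega>)) \<in> borel_measurable M" for t
        by (intro borel_measurable_sum) simp
      show "{\<omega> \<in> space M. \<exists>t\<in>T. (\<Sum>i<n. g t (Y i \<omega>, X i \<omega>)) < n * (f\<^sub>l * h / 2)} \<in> events"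
        using \<open>finite T\<close> by measurable
    qed
    also have "\<dots> \<le> exp (- \<theta> * (n * (f\<^sub>l * h / 16))) * (2 * p) * (1 + 240 * f\<^sub>u * h * (\<theta> * c)\<^sup>2) ^ n"
      using empirical_deviation[OF sample_size_pos \<open>finite T\<close> False T dev(1)] dev(2) by (simp only: c)
    also have "\<dots> \<le> 1 / (2 * real p)" using dev(3) by simp
    finally show ?thesis .
  qed
qed

text \<open>The bound for finite sets does not depend on their size, so it survives the increasing
  limit to a countable dense set.\<close>

lemma rsc_event_prob:
  "1 - 1 / (2 * real p) \<le> prob (rsc_event M \<tau> K h p n X Y \<Sigma> \<beta>s r l (\<kappa> * f\<^sub>l / 2))"
proof -
  let ?m = "margin K (\<kappa> * f\<^sub>l / 2)"
  obtain Q where Q: "countable Q" "Q \<subseteq> l1_cone" "\<And>U. open U \<Longrightarrow> U \<inter> l1_cone \<noteq> {} \<Longrightarrow> U \<inter> Q \<noteq> {}"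
    using countable_dense_subset[of l1_cone] by blast
  have dense: "(\<forall>d\<in>l1_cone. 0 \<le> ?m \<omega> d) \<longleftrightarrow> (\<forall>d\<in>Q. 0 \<le> ?m \<omega> d)" for \<omega>
  proof
    assume Qm: "\<forall>d\<in>Q. 0 \<le> ?m \<omega> d"
    \<comment> \<open>A negative margin persists on an open set, which would then meet
      \<open>Q\<close> as well.\<close>
    have "open {d. ?m \<omega> d < 0}"
      by (intro open_Collect_less margin_continuous[OF B2] continuous_on_const)
    then have "{d. ?m \<omega> d < 0} \<inter> l1_cone \<noteq> {} \<Longrightarrow> {d. ?m \<omega> d < 0} \<inter> Q \<noteq> {}" by (rule Q(3))
    then show "\<forall>d\<in>l1_cone. 0 \<le> ?m \<omega> d" using Qm by (force simp: not_less[symmetric])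
  qed (use Q in blast)
  \<comment> \<open>Intersecting with \<open>Q\<close> discards the default value of
    \<open>from_nat_into\<close>, so that nonemptiness of \<open>Q\<close> need not be
    shown.\<close>
  define bad where "bad = (\<lambda>k. {\<omega> \<in> space M. \<exists>d\<in>Q \<inter> from_nat_into Q ` {..k}. ?m \<omega> d < 0})"
  note [measurable] = margin_measurable[OF B2]
  have [measurable]: "bad k \<in> events" for k unfolding bad_def by measurable
  have "incseq bad" unfolding bad_def incseq_def by force
  then have lim: "(\<lambda>k. prob (bad k)) \<longlonglongrightarrow> prob (\<Union>k. bad k)"
    by (intro finite_Lim_measure_incseq) auto
  have "prob (bad k) \<le> 1 / (2 * real p)" for k
    unfolding bad_def using Q(2) by (intro finite_cone_bound) auto
  then have le: "prob (\<Union>k. bad k) \<le> 1 / (2 * real p)"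
    by (intro LIMSEQ_le_const2[OF lim]) auto
  have "rsc_event M \<tau> K h p n X Y \<Sigma> \<beta>s r l (\<kappa> * f\<^sub>l / 2) = space M - (\<Union>k. bad k)"
  proof -
    have "(\<Union>k. bad k) = {\<omega> \<in> space M. \<exists>d\<in>Q. ?m \<omega> d < 0}"
    proof (intro Set.set_eqI iffI)
      fix \<omega> assume "\<omega> \<in> {\<omega> \<in> space M. \<exists>d\<in>Q. ?m \<omega> d < 0}"
      then obtain d where d: "\<omega> \<in> space M" "d \<in> Q" "?m \<omega> d < 0" by blast
      then have "d \<in> Q \<inter> from_nat_into Q ` {..to_nat_on Q d}"
        using from_nat_into_to_nat_on[OF Q(1) d(2)] by (auto intro!: image_eqI[of _ _ "to_nat_on Q d"])
      then show "\<omega> \<in> (\<Union>k. bad k)" using d unfolding bad_def by blast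
    qed (auto simp: bad_def)
    then show ?thesis unfolding rsc_event_eq[OF B2] dense by (auto simp: not_less)
  qed
  then have "prob (rsc_event M \<tau> K h p n X Y \<Sigma> \<beta>s r l (\<kappa> * f\<^sub>l / 2)) = 1 - prob (\<Union>k. bad k)"
    by (simp add: prob_compl)
  then show ?thesis using le by linarith
qed

end
end

theorem proposition4p2:
  fixes \<tau> \<upsilon>\<^sub>0 \<kappa>\<^sub>l :: real and K :: "real \<Rightarrow> real"
  assumes tau: "0 < \<tau>" "\<tau> < 1"
    and B2: "condition_B2 K"
    and kappa_min: "\<kappa>\<^sub>l \<in> K ` {-1..1}" "\<And>u. \<bar>u\<bar> \<le> 1 \<Longrightarrow> \<kappa>\<^sub>l \<le> K u"
    and kappa_pos: "\<kappa>\<^sub>l > 0"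
  shows "\<exists>C>0. \<forall>(M :: 'a measure) p x y \<epsilon> \<beta>s n X Y f\<^sub>l f\<^sub>u l\<^sub>0 (r::real) (l::real) (h::real).
    quantile_model M \<tau> p x y \<epsilon> \<beta>s n X Y \<longrightarrow>
    condition_B1 M p x \<epsilon> f\<^sub>l f\<^sub>u l\<^sub>0 \<longrightarrow>
    condition_B3 M p x \<upsilon>\<^sub>0 \<longrightarrow>
    r > 0 \<longrightarrow> l > 0 \<longrightarrow> h > 0 \<longrightarrow>
    20 * \<upsilon>\<^sub>0\<^sup>2 * r \<le> h \<longrightarrow> h \<le> f\<^sub>l / (2 * l\<^sub>0) \<longrightarrow>
    real n \<ge> C * sigma_x_sq M p x * f\<^sub>u / f\<^sub>l\<^sup>2 * (l / r)\<^sup>2 * h * ln (2 * real p) \<longrightarrow>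
    measure M (rsc_event M \<tau> K h p n X Y (second_moment_mat M p x) \<beta>s r l (\<kappa>\<^sub>l * f\<^sub>l / 2))
      \<ge> 1 - 1 / (2 * real p)"
proof (cases "\<upsilon>\<^sub>0 \<ge> 1")
  case False
  \<comment> \<open>\<open>condition_B3\<close> contains \<open>\<upsilon>\<^sub>0 \<ge> 1\<close>,
    so the claim is vacuous and any positive constant serves.\<close>
  then show ?thesis by (intro exI[of _ 1]) (auto simp: condition_B3_def)
next
  case True
  show ?thesis
  \<comment> \<open>The numerical constant of the exponent bound times the squared scale of the
    sub-exponential tail.\<close>
  proof (intro exI[of _ "31457280 * \<upsilon>\<^sub>0\<^sup>2"] conjI allI impI)
    show "0 < 31457280 * \<upsilon>\<^sub>0\<^sup>2" using True by simp
    fix M :: "'a measure" and p x y \<epsilon> \<beta>s n X Y f\<^sub>l f\<^sub>u l\<^sub>0 and r l h :: real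
    assume model: "quantile_model M \<tau> p x y \<epsilon> \<beta>s n X Y"
      and cond: "condition_B1 M p x \<epsilon> f\<^sub>l f\<^sub>u l\<^sub>0" "condition_B3 M p x \<upsilon>\<^sub>0"
      and rlh: "0 < r" "0 < l" "0 < h" "20 * \<upsilon>\<^sub>0\<^sup>2 * r \<le> h" "h \<le> f\<^sub>l / (2 * l\<^sub>0)"
      and n: "31457280 * \<upsilon>\<^sub>0\<^sup>2 * sigma_x_sq M p x * f\<^sub>u / f\<^sub>l\<^sup>2 * (l / r)\<^sup>2 * h * ln (2 * real p) \<le> real n"
    interpret prob_space M using model by (simp add: quantile_model_def)
    interpret rsc_setting M p x y \<epsilon> \<beta>s n X Y \<upsilon>\<^sub>0 f\<^sub>l f\<^sub>u l\<^sub>0 r l h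
      by unfold_locales (use model cond rlh in \<open>auto simp: quantile_model_def\<close>)
    show "1 - 1 / (2 * real p) \<le>
        measure M (rsc_event M \<tau> K h p n X Y (second_moment_mat M p x) \<beta>s r l (\<kappa>\<^sub>l * f\<^sub>l / 2))"
      using kappa_pos by (intro rsc_event_prob B2 kappa_min n) auto
  qed
qed

end
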